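(* Let $M$ be a connected smooth manifold of dimension $n-1$ and let $(g,\Psi)$ be immersion data for a $\pi_1(M)$-equivariant immersion of $\widetilde M$ into $\mathds{X}_n$. Assume that $g$ is real, namely that $g_{|TM}$ is pseudo-Riemannian, and has signature $(n-1-p,p)$, $0\le p\le n-1$. If $\Psi$ is real, i.e. $\Psi$ restricts to a bundle homomorphism $\Psi\colon TM\to TM$, then there exists an isometric $\pi_1(M)$-equivariant immersion $\sigma\colon\widetilde M\to\mathds{X}_n$, with immersion data $(g,\Psi)$, such that $\sigma(\widetilde M)\subset\iota(\mathbb{H}^{n-p,p})$. Similarly, if $i\Psi$ is real, then there exists an isometric $\pi_1(M)$-equivariant immersion $\sigma\colon\widetilde M\to\mathds{X}_n$, with immersion data $(g,\Psi)$, such that $\sigma(\widetilde M)\subset\iota(\mathbb{H}^{n-p-1,p+1})$.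
   Context: $n\ge 2$. $\mathds{X}_{n}=\{z\in\mathbb{C}^{n+1}:\sum z_i^2=-1\}$ with the holomorphic Riemannian metric $\langle\cdot,\cdot\rangle$ restricted from the standard $\mathbb{C}$-bilinear form $\sum z_iw_i$; $D$ is its Levi-Civita connection and $O(n+1,\mathbb{C})$ is its isometry group. For $0\le q\le n$, $\mathbb{H}^{n-q,q}$ is the simply connected $n$-dimensional pseudo-Riemannian space form of signature $(n-q,q)$ and constant curvature $-1$; it is the universal cover of (a connected component of) $Q^{n-q,q}=\{x\in\mathbb{R}^{n+1}:x_1^2+\dots+x_{n-q}^2-x_{n-q+1}^2-\dots-x_{n+1}^2=-1\}$ with the metric induced from the flat metric of signature $(n-q,q+1)$. The map $\iota\colon\mathbb{H}^{n-q,q}\to\mathds{X}_n$ is the isometric immersion induced by $(x_1,\dots,x_{n+1})\mapsto(x_1,\dots,x_{n-q},ix_{n-q+1},\dots,ix_{n+1})$; it is the unique isometric immersion of $\mathbb H^{n-q,q}$ into $\mathds X_n$ up to ambient isometry. $\mathbb{C}TM=TM\otimes_{\mathbb R}\mathbb{C}$. A complex metric is a smoothly varying non-degenerate symmetric $\mathbb{C}$-bilinear form on the complexified tangent spaces. The differential of an immersion $\sigma\colon\widetilde M\to\mathds{X}_n$ is extended $\mathbb{C}$-linearly to $\mathbb{C}T\widetilde M$; $\sigma$ is isometric for a complex metric if $\sigma^*\langle\cdot,\cdot\rangle$ equals it. In that case, choosing a normal field $\nu$ (section of $\sigma^*T\mathds{X}_n$ orthogonal to $\mathbb{C}T\widetilde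 M$ with $\langle\nu,\nu\rangle=1$, unique up to sign), the shape operator is $\overline\nabla\nu$, $\overline\nabla=\sigma^*D$ extended $\mathbb{C}$-linearly (defined up to sign). A pair $(g,\Psi)$ ($g$ a complex metric on $M$, $\Psi$ a section of $\mathrm{End}_{\mathbb{C}}(\mathbb{C}TM)$) is immersion data for a $\pi_1(M)$-equivariant immersion if there exist an immersion $\sigma\colon\widetilde M\to\mathds{X}_n$ whose pull-back metric and shape operator are the lifts of $g$ and $\Psi$, and a homomorphism $\rho$ from $\pi_1(M)$ to the isometry group of $\mathds{X}_n$ with $\sigma\circ\gamma=\rho(\gamma)\circ\sigma$ for all $\gamma\in\pi_1(M)$; such a $\sigma$ has immersion data $(g,\Psi)$. *)

theory Defs
  imports "HOL-Analysis.Analysis" "HOL-Algebra.Bij"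
begin

section \<open>Smooth manifolds\<close>

primrec Ck_on :: "nat \<Rightarrow> 'a::real_normed_vector set \<Rightarrow> ('a \<Rightarrow> 'b::real_normed_vector) \<Rightarrow> bool" where
  "Ck_on 0 S f \<longleftrightarrow> continuous_on S f"
| "Ck_on (Suc k) S f \<longleftrightarrow> (\<forall>x\<in>S. f differentiable (at x)) \<and>
     (\<forall>v. Ck_on k S (\<lambda>x. frechet_derivative f (at x) v))"

text \<open>Only used for open sets \<open>S\<close>.\<close>

definition smooth_on :: "'a::real_normed_vector set \<Rightarrow> ('a \<Rightarrow> 'b::real_normed_vector) \<Rightarrow> bool" where
  "smooth_on S f \<longleftrightarrow> (\<forall>k. Ck_on k S f)"

text \<open>A chart is a pair of its domain and its coordinate map. A manifold is given by an atlas,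
  which need not be maximal; the underlying set is the union of the chart domains, with the
  subspace topology of the ambient type.\<close>

type_synonym ('m, 'd) atlas = "('m set \<times> ('m \<Rightarrow> real^'d)) set"

definition points :: "('m, 'd) atlas \<Rightarrow> 'm set" where
  "points A = \<Union> (fst ` A)"

definition open_in :: "('m::topological_space, 'd) atlas \<Rightarrow> 'm set \<Rightarrow> bool" where
  "open_in A W \<longleftrightarrow> openin (top_of_set (points A)) W"

definition smooth_atlas :: "('m::topological_space, 'd::finite) atlas \<Rightarrow> bool" where
  "smooth_atlas A \<longleftrightarrow>
     (\<forall>(C, \<phi>) \<in> A. open_in A C \<and> open (\<phi> ` C) \<and> homeomorphism C (\<phi> ` C) \<phi> (inv_into C \<phi>)) \<and>
     (\<forall>(C, \<phi>) \<in> A. \<forall>(C', \<phi>') \<in> A. smooth_on (\<phi> ` (C \<inter> C')) (\<phi>' \<circ> inv_into C \<phi>))"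

definition smooth_map_on ::
  "('m::topological_space, 'd::finite) atlas \<Rightarrow> 'm set \<Rightarrow> ('m \<Rightarrow> 'b::real_normed_vector) \<Rightarrow> bool" where
  "smooth_map_on A W f \<longleftrightarrow> (\<forall>(C, \<phi>) \<in> A. smooth_on (\<phi> ` (C \<inter> W)) (f \<circ> inv_into C \<phi>))"

definition smooth_near ::
  "('m::topological_space, 'd::finite) atlas \<Rightarrow> 'm \<Rightarrow> ('m \<Rightarrow> 'b::real_normed_vector) \<Rightarrow> bool" where
  "smooth_near A p f \<longleftrightarrow> (\<exists>W. open_in A W \<and> p \<in> W \<and> smooth_map_on A W f)"

section \<open>The complexified tangent bundle\<close>

text \<open>The space \<open>\<complex>T\<^sub>pM = T\<^sub>pM \<otimes> \<complex>\<close> is represented by the complex derivations at \<open>p\<close> of the germs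
  of smooth complex valued functions at \<open>p\<close>, and \<open>T\<^sub>pM\<close> is the real subspace of the derivations
  that are real on real valued functions. As HOL functions are total, a derivation is set to
  \<open>0\<close> on the functions that are not smooth near \<open>p\<close>.\<close>

type_synonym 'm cvec = "('m \<Rightarrow> complex) \<Rightarrow> complex"

definition cvec_add :: "'m cvec \<Rightarrow> 'm cvec \<Rightarrow> 'm cvec" where
  "cvec_add X Y = (\<lambda>f. X f + Y f)"

definition cvec_scale :: "complex \<Rightarrow> 'm cvec \<Rightarrow> 'm cvec" where
  "cvec_scale c X = (\<lambda>f. c * X f)"

definition cvec_zero :: "'m cvec" where
  "cvec_zero = (\<lambda>f. 0)"

definition ctangent :: "('m::topological_space, 'd::finite) atlas \<Rightarrow> 'm \<Rightarrow> 'm cvec set" where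
  "ctangent A p = {X.
     (\<forall>f. \<not> smooth_near A p f \<longrightarrow> X f = 0) \<and>
     (\<forall>f h. smooth_near A p f \<and> smooth_near A p h \<longrightarrow>
        X (\<lambda>x. f x + h x) = X f + X h \<and>
        X (\<lambda>x. f x * h x) = X f * h p + f p * X h \<and>
        ((\<exists>W. open_in A W \<and> p \<in> W \<and> (\<forall>x\<in>W. f x = h x)) \<longrightarrow> X f = X h)) \<and>
     (\<forall>c f. smooth_near A p f \<longrightarrow> X (\<lambda>x. c * f x) = c * X f)}"

definition rtangent :: "('m::topological_space, 'd::finite) atlas \<Rightarrow> 'm \<Rightarrow> 'm cvec set" where
  "rtangent A p = {X \<in> ctangent A p. \<forall>f. smooth_near A p f \<and> (\<forall>x. f x \<in> \<real>) \<longrightarrow> X f \<in> \<real>}"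

text \<open>Differentials, extended complex linearly to the complexified tangent spaces: of a map into
  \<open>\<complex>\<^sup>N\<close>, and of a map between manifolds.\<close>

definition cdiff :: "('m \<Rightarrow> complex^'N) \<Rightarrow> 'm cvec \<Rightarrow> complex^'N" where
  "cdiff F X = (\<chi> i. X (\<lambda>x. F x $ i))"

definition push :: "('u \<Rightarrow> 'm) \<Rightarrow> 'u cvec \<Rightarrow> 'm cvec" where
  "push h X = (\<lambda>f. X (f \<circ> h))"

definition smooth_field :: "('m::topological_space, 'd::finite) atlas \<Rightarrow> 'm set \<Rightarrow> ('m \<Rightarrow> 'm cvec) \<Rightarrow> bool" where
  "smooth_field A W X \<longleftrightarrow> (\<forall>p\<in>W. X p \<in> ctangent A p) \<and>
     (\<forall>V f. open_in A V \<and> V \<subseteq> W \<and> smooth_map_on A V f \<longrightarrow> smooth_map_on A V (\<lambda>p. X p f))"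

section \<open>Complex metrics and endomorphism fields\<close>

type_synonym 'm cform = "'m \<Rightarrow> 'm cvec \<Rightarrow> 'm cvec \<Rightarrow> complex"
type_synonym 'm cendo = "'m \<Rightarrow> 'm cvec \<Rightarrow> 'm cvec"

definition complex_metric :: "('m::topological_space, 'd::finite) atlas \<Rightarrow> 'm cform \<Rightarrow> bool" where
  "complex_metric A g \<longleftrightarrow>
     (\<forall>p \<in> points A.
        (\<forall>X \<in> ctangent A p. \<forall>Y \<in> ctangent A p. g p X Y = g p Y X) \<and>
        (\<forall>X \<in> ctangent A p. \<forall>Y \<in> ctangent A p. \<forall>Z \<in> ctangent A p.
           g p (cvec_add X Y) Z = g p X Z + g p Y Z) \<and>
        (\<forall>c. \<forall>X \<in> ctangent A p. \<forall>Y \<in> ctangent A p. g p (cvec_scale c X) Y = c * g p X Y) \<and>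
        (\<forall>X \<in> ctangent A p. (\<forall>Y \<in> ctangent A p. g p X Y = 0) \<longrightarrow> X = cvec_zero)) \<and>
     (\<forall>W X Y. open_in A W \<and> smooth_field A W X \<and> smooth_field A W Y \<longrightarrow>
        smooth_map_on A W (\<lambda>p. g p (X p) (Y p)))"

definition endo_section :: "('m::topological_space, 'd::finite) atlas \<Rightarrow> 'm cendo \<Rightarrow> bool" where
  "endo_section A \<Psi> \<longleftrightarrow>
     (\<forall>p \<in> points A.
        (\<forall>X \<in> ctangent A p. \<Psi> p X \<in> ctangent A p) \<and>
        (\<forall>X \<in> ctangent A p. \<forall>Y \<in> ctangent A p.
           \<Psi> p (cvec_add X Y) = cvec_add (\<Psi> p X) (\<Psi> p Y)) \<and>
        (\<forall>c. \<forall>X \<in> ctangent A p. \<Psi> p (cvec_scale c X) = cvec_scale c (\<Psi> p X))) \<and>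
     (\<forall>W X. open_in A W \<and> smooth_field A W X \<longrightarrow> smooth_field A W (\<lambda>p. \<Psi> p (X p)))"

text \<open>The restriction of \<open>g\<close> to the real tangent bundle is pseudo-Riemannian of signature
  \<open>(r, s)\<close>, with \<open>r\<close> positive and \<open>s\<close> negative directions.\<close>

definition pseudo_riemannian_on_real ::
  "('m::topological_space, 'd::finite) atlas \<Rightarrow> 'm cform \<Rightarrow> nat \<Rightarrow> nat \<Rightarrow> bool" where
  "pseudo_riemannian_on_real A g r s \<longleftrightarrow> (\<forall>p \<in> points A.
     (\<forall>X \<in> rtangent A p. \<forall>Y \<in> rtangent A p. g p X Y \<in> \<real>) \<and>
     (\<exists>e. (\<forall>i < r + s. e i \<in> rtangent A p) \<and>
          (\<forall>X \<in> rtangent A p. \<exists>c :: nat \<Rightarrow> real. X = (\<lambda>f. \<Sum>i < r + s. of_real (c i) * e i f)) \<and>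
          (\<forall>i < r + s. \<forall>j < r + s.
             g p (e i) (e j) = (if i \<noteq> j then 0 else if i < r then 1 else -1))))"

definition real_endo :: "('m::topological_space, 'd::finite) atlas \<Rightarrow> 'm cendo \<Rightarrow> bool" where
  "real_endo A \<Psi> \<longleftrightarrow> (\<forall>p \<in> points A. \<forall>X \<in> rtangent A p. \<Psi> p X \<in> rtangent A p)"

section \<open>Universal covers and deck transformations\<close>

definition universal_cover ::
  "'u::topological_space set \<Rightarrow> ('u \<Rightarrow> 'm::topological_space) \<Rightarrow> 'm set \<Rightarrow> bool" where
  "universal_cover U \<pi> M \<longleftrightarrow> covering_space U \<pi> M \<and> simply_connected U"

text \<open>The smooth structure on the total space of a covering that makes it a local diffeomorphism.\<close>

definition pullback_atlas ::
  "'u::topological_space set \<Rightarrow> ('u \<Rightarrow> 'm::topological_space) \<Rightarrow> ('m, 'd) atlas \<Rightarrow> ('u, 'd) atlas" where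
  "pullback_atlas U \<pi> A =
     {(V, \<phi> \<circ> \<pi>) | V C \<phi>. (C, \<phi>) \<in> A \<and> openin (top_of_set U) V \<and> inj_on \<pi> V \<and> \<pi> ` V \<subseteq> C}"

text \<open>The fundamental group of the base acts on the universal cover as the group of deck
  transformations, with which it is identified. The maps are extensional, so that a deck
  transformation is determined by its values on \<open>U\<close>.\<close>

definition deck_group ::
  "'u::topological_space set \<Rightarrow> ('u \<Rightarrow> 'm) \<Rightarrow> ('u \<Rightarrow> 'u) monoid" where
  "deck_group U \<pi> = BijGroup U
     \<lparr>carrier := {\<gamma> \<in> Bij U. homeomorphism U U \<gamma> (inv_into U \<gamma>) \<and> (\<forall>x\<in>U. \<pi> (\<gamma> x) = \<pi> x)}\<rparr>"

definition lift_form :: "('u \<Rightarrow> 'm) \<Rightarrow> 'm cform \<Rightarrow> 'u cform" where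
  "lift_form \<pi> g = (\<lambda>x X Y. g (\<pi> x) (push \<pi> X) (push \<pi> Y))"

text \<open>Here \<open>B\<close> is the atlas of the covering manifold; the differential of \<open>\<pi>\<close> is bijective
  on each tangent space.\<close>

definition lift_endo ::
  "('u::topological_space, 'd::finite) atlas \<Rightarrow> ('u \<Rightarrow> 'm) \<Rightarrow> 'm cendo \<Rightarrow> 'u cendo" where
  "lift_endo B \<pi> \<Psi> = (\<lambda>x X. inv_into (ctangent B x) (push \<pi>) (\<Psi> (\<pi> x) (push \<pi> X)))"

section \<open>The space \<open>X\<^sub>n\<close>\<close>

definition cbil :: "complex^'N \<Rightarrow> complex^'N \<Rightarrow> complex" where
  "cbil z w = (\<Sum>i\<in>UNIV. z $ i * w $ i)"

definition XX :: "(complex^'N) set" where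
  "XX = {z. cbil z z = -1}"

definition tangent_XX :: "complex^'N \<Rightarrow> (complex^'N) set" where
  "tangent_XX z = {w. cbil w z = 0}"

text \<open>Orthogonal projection of \<open>\<complex>\<^sup>N\<close> onto the tangent space of \<open>X\<^sub>n\<close> at \<open>z\<close>. The Levi-Civita
  connection \<open>D\<close> of \<open>X\<^sub>n\<close> is the tangential part of the flat connection; this is justified by
  lemmas \<open>LC_metric\<close> and \<open>LC_torsion_free\<close> below.\<close>

definition proj_XX :: "complex^'N \<Rightarrow> complex^'N \<Rightarrow> complex^'N" where
  "proj_XX z w = w + cbil w z *s z"

text \<open>The derivative, with respect to \<open>\<sigma>\<^sup>*D\<close>, of a section \<open>\<nu>\<close> of \<open>\<sigma>\<^sup>*TX\<^sub>n\<close>.\<close>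

definition pullback_LC ::
  "('u \<Rightarrow> complex^'N) \<Rightarrow> ('u \<Rightarrow> complex^'N) \<Rightarrow> 'u \<Rightarrow> 'u cvec \<Rightarrow> complex^'N" where
  "pullback_LC \<sigma> \<nu> x X = proj_XX (\<sigma> x) (cdiff \<nu> X)"

definition orthogonal_group :: "(complex^'N^'N) monoid" where
  "orthogonal_group = \<lparr>carrier = {A. transpose A ** A = mat 1}, mult = (**), one = mat 1\<rparr>"

section \<open>Immersion data\<close>

definition immersion_XX ::
  "('u::topological_space, 'd::finite) atlas \<Rightarrow> ('u \<Rightarrow> complex^'N) \<Rightarrow> bool" where
  "immersion_XX B \<sigma> \<longleftrightarrow> smooth_map_on B (points B) \<sigma> \<and> \<sigma> ` points B \<subseteq> XX \<and>
     (\<forall>x \<in> points B. inj_on (cdiff \<sigma>) (rtangent B x))"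

definition has_pullback_metric ::
  "('u::topological_space, 'd::finite) atlas \<Rightarrow> ('u \<Rightarrow> complex^'N) \<Rightarrow> 'u cform \<Rightarrow> bool" where
  "has_pullback_metric B \<sigma> h \<longleftrightarrow> (\<forall>x \<in> points B. \<forall>X \<in> ctangent B x. \<forall>Y \<in> ctangent B x.
     cbil (cdiff \<sigma> X) (cdiff \<sigma> Y) = h x X Y)"

definition unit_normal ::
  "('u::topological_space, 'd::finite) atlas \<Rightarrow> ('u \<Rightarrow> complex^'N) \<Rightarrow> ('u \<Rightarrow> complex^'N) \<Rightarrow> bool" where
  "unit_normal B \<sigma> \<nu> \<longleftrightarrow> smooth_map_on B (points B) \<nu> \<and>
     (\<forall>x \<in> points B. \<nu> x \<in> tangent_XX (\<sigma> x) \<and> cbil (\<nu> x) (\<nu> x) = 1 \<and>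
        (\<forall>X \<in> ctangent B x. cbil (\<nu> x) (cdiff \<sigma> X) = 0))"

text \<open>\<open>S\<close> is the shape operator of \<open>\<sigma>\<close> for one of the two choices of the unit normal field.\<close>

definition has_shape_operator ::
  "('u::topological_space, 'd::finite) atlas \<Rightarrow> ('u \<Rightarrow> complex^'N) \<Rightarrow> 'u cendo \<Rightarrow> bool" where
  "has_shape_operator B \<sigma> S \<longleftrightarrow> (\<exists>\<nu>. unit_normal B \<sigma> \<nu> \<and>
     (\<forall>x \<in> points B. \<forall>X \<in> ctangent B x. cdiff \<sigma> (S x X) = pullback_LC \<sigma> \<nu> x X))"

definition equivariant ::
  "'u::topological_space set \<Rightarrow> ('u \<Rightarrow> 'm) \<Rightarrow> ('u \<Rightarrow> complex^'N) \<Rightarrow> bool" where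
  "equivariant U \<pi> \<sigma> \<longleftrightarrow> (\<exists>\<rho> \<in> hom (deck_group U \<pi>) orthogonal_group.
     \<forall>\<gamma> \<in> carrier (deck_group U \<pi>). \<forall>x\<in>U. \<sigma> (\<gamma> x) = \<rho> \<gamma> *v \<sigma> x)"

definition equivariant_immersion_with_data ::
  "('m::topological_space, 'd::finite) atlas \<Rightarrow> 'u::topological_space set \<Rightarrow> ('u \<Rightarrow> 'm) \<Rightarrow>
   'm cform \<Rightarrow> 'm cendo \<Rightarrow> ('u \<Rightarrow> complex^'N) \<Rightarrow> bool" where
  "equivariant_immersion_with_data A U \<pi> g \<Psi> \<sigma> \<longleftrightarrow>
     (let B = pullback_atlas U \<pi> A in
       immersion_XX B \<sigma> \<and> has_pullback_metric B \<sigma> (lift_form \<pi> g) \<and>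
       has_shape_operator B \<sigma> (lift_endo B \<pi> \<Psi>) \<and> equivariant U \<pi> \<sigma>)"

section \<open>The space forms \<open>H\<^sup>n\<^sup>-\<^sup>q\<^sup>,\<^sup>q\<close>\<close>

text \<open>The \<open>n + 1\<close> coordinates are indexed by a finite linear order; those of the first \<open>n - q\<close>
  positions carry the sign \<open>+\<close>.\<close>

definition positive_coord :: "nat \<Rightarrow> nat \<Rightarrow> 'N::{finite,linorder} \<Rightarrow> bool" where
  "positive_coord n q i \<longleftrightarrow> card {..<i} < n - q"

definition Q_quadric :: "nat \<Rightarrow> nat \<Rightarrow> (real^('N::{finite,linorder})) set" where
  "Q_quadric n q =
     {x. (\<Sum>i\<in>UNIV. if positive_coord n q i then (x $ i)\<^sup>2 else - (x $ i)\<^sup>2) = -1}"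

text \<open>\<open>H\<close>, with the covering map \<open>c\<close>, is a model of \<open>H\<^sup>n\<^sup>-\<^sup>q\<^sup>,\<^sup>q\<close>.\<close>

definition HH_model ::
  "nat \<Rightarrow> nat \<Rightarrow> 'h::topological_space set \<Rightarrow> ('h \<Rightarrow> real^('N::{finite,linorder})) \<Rightarrow> bool" where
  "HH_model n q H c \<longleftrightarrow> (\<exists>K \<in> components (Q_quadric n q). universal_cover H c K)"

definition iota :: "nat \<Rightarrow> nat \<Rightarrow> ('h \<Rightarrow> real^('N::{finite,linorder})) \<Rightarrow> 'h \<Rightarrow>
   complex^('N::{finite,linorder})" where
  "iota n q c y = (\<chi> i. if positive_coord n q i then of_real (c y $ i) else \<i> * of_real (c y $ i))"

section \<open>Characterization of the Levi-Civita connection of \<open>X\<^sub>n\<close>\<close>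

lemma bounded_bilinear_cbil: "bounded_bilinear (cbil :: complex^'N \<Rightarrow> complex^'N \<Rightarrow> complex)"
  unfolding bilinear_conv_bounded_bilinear[symmetric] bilinear_def
  by (auto intro!: linearI simp: cbil_def sum.distrib algebra_simps scaleR_right.sum)

lemma bounded_bilinear_vsm: "bounded_bilinear ((*s) :: complex \<Rightarrow> complex^'N \<Rightarrow> complex^'N)"
  unfolding bilinear_conv_bounded_bilinear[symmetric] bilinear_def
  by (auto intro!: linearI simp: vec_eq_iff algebra_simps)

lemma cbil_simps:
  "cbil (a + b) c = cbil a c + cbil b c" "cbil a (b + c) = cbil a b + cbil a c"
  "cbil (a - b) c = cbil a c - cbil b c" "cbil a (b - c) = cbil a b - cbil a c"
  "cbil (k *s a) b = k * cbil a b" "cbil a (k *s b) = k * cbil a b" "cbil (- a) b = - cbil a b"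
  "cbil a (- b) = - cbil a b"
  by (simp_all add: cbil_def sum.distrib sum_subtractf algebra_simps sum_distrib_left sum_negf)

lemma cbil_commute: "cbil a b = cbil b a"
  by (simp add: cbil_def mult.commute)

lemma proj_XX_tangent: "z \<in> XX \<Longrightarrow> proj_XX z w \<in> tangent_XX z"
  by (simp add: proj_XX_def XX_def tangent_XX_def cbil_simps)

lemma LC_metric:
  assumes "z \<in> XX" "V z \<in> tangent_XX z" "W z \<in> tangent_XX z"
    and V: "(V has_derivative V') (at z)" and W: "(W has_derivative W') (at z)"
  shows "((\<lambda>y. cbil (V y) (W y)) has_derivative
           (\<lambda>u. cbil (proj_XX z (V' u)) (W z) + cbil (V z) (proj_XX z (W' u)))) (at z)"
proof -
  have "((\<lambda>y. cbil (V y) (W y)) has_derivative (\<lambda>u. cbil (V z) (W' u) + cbil (V' u) (W z))) (at z)"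
    by (rule bounded_bilinear.FDERIV[OF bounded_bilinear_cbil V W])
  moreover have "cbil (W z) z = 0" "cbil z (W z) = 0" "cbil (V z) z = 0"
    using assms by (auto simp: tangent_XX_def cbil_commute)
  ultimately show ?thesis
    by (simp add: proj_XX_def cbil_simps add.commute)
qed

text \<open>The bracket of two vector fields tangent to \<open>X\<^sub>n\<close> is \<open>D\<^sub>V W - D\<^sub>W V\<close>.\<close>

lemma curve_in_XX:
  fixes z v :: "complex^'N"
  assumes z: "z \<in> XX" and v: "v \<in> tangent_XX z"
  shows "\<exists>c :: real \<Rightarrow> complex^'N. c 0 = z \<and> (c has_vector_derivative v) (at 0) \<and>
           (\<forall>\<^sub>F t in at 0. c t \<in> XX)"
proof -
  define k where "k = cbil v v"
  define q where "q = (\<lambda>w :: complex. 1 - w\<^sup>2 * k)"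
  define f where "f = (\<lambda>t :: real. inverse (csqrt (q (of_real t))))"
  define c where "c = (\<lambda>t :: real. f t *s (z + t *\<^sub>R v))"
  have "((\<lambda>w. inverse (csqrt (q w))) has_field_derivative 0) (at (of_real 0))"
    unfolding q_def by (auto intro!: derivative_eq_intros)
  then have f: "(f has_vector_derivative 0) (at 0)"
    unfolding f_def by (rule has_vector_derivative_real_field)
  have l: "((\<lambda>t. z + t *\<^sub>R v) has_vector_derivative v) (at 0)"
    by (auto intro!: derivative_eq_intros)
  have f0: "f 0 = 1" by (simp add: f_def q_def)
  have "(c has_vector_derivative (f 0 *s v + 0 *s (z + 0 *\<^sub>R v))) (at 0)"
    unfolding c_def by (rule bounded_bilinear.has_vector_derivative[OF bounded_bilinear_vsm f l])
  then have c: "(c has_vector_derivative v) (at 0)" by (simp add: f0)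
  have "((\<lambda>t. q (of_real t)) \<longlongrightarrow> q (of_real 0)) (at (0::real))"
    unfolding q_def by (intro tendsto_intros)
  then have "\<forall>\<^sub>F t in at (0::real). q (of_real t) \<noteq> 0"
    by (rule tendsto_imp_eventually_ne) (simp add: q_def)
  moreover have "c t \<in> XX" if "q (of_real t) \<noteq> 0" for t
  proof -
    have "t *\<^sub>R v = of_real t *s v" by (simp add: vec_eq_iff scaleR_conv_of_real[where 'a = complex])
    moreover have "cbil z z = -1" "cbil v z = 0" "cbil z v = 0"
      using z v by (auto simp: XX_def tangent_XX_def cbil_commute)
    ultimately have "cbil (c t) (c t) = (f t)\<^sup>2 * (- q (of_real t))"
      by (simp add: c_def cbil_simps k_def q_def power2_eq_square algebra_simps)
    also have "\<dots> = -1"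
      using that by (simp add: f_def power_inverse)
    finally show ?thesis by (simp add: XX_def)
  qed
  ultimately have "\<forall>\<^sub>F t in at 0. c t \<in> XX" by (auto elim: eventually_mono)
  moreover have "c 0 = z" by (simp add: c_def f0)
  ultimately show ?thesis using c by blast
qed

lemma tangent_derivative:
  fixes z v :: "complex^'N"
  assumes z: "z \<in> XX" and v: "v \<in> tangent_XX z"
    and W: "(W has_derivative W') (at z)" and tan: "\<And>y. y \<in> XX \<Longrightarrow> W y \<in> tangent_XX y"
  shows "cbil (W' v) z = - cbil (W z) v"
proof -
  obtain c :: "real \<Rightarrow> complex^'N" where c0: "c 0 = z" and c: "(c has_vector_derivative v) (at 0)"
    and ev: "\<forall>\<^sub>F t in at 0. c t \<in> XX"
    using curve_in_XX[OF z v] by blast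
  have W1: "((\<lambda>y. cbil (W y) y) has_derivative (\<lambda>u. cbil (W z) u + cbil (W' u) z)) (at z)"
    by (rule bounded_bilinear.FDERIV[OF bounded_bilinear_cbil W has_derivative_ident])
  have "((\<lambda>y. cbil (W y) y) \<circ> c has_vector_derivative (cbil (W z) v + cbil (W' v) z)) (at 0)"
    by (rule vector_derivative_diff_chain_within[OF c]) (use W1 c0 in \<open>auto intro: has_derivative_at_withinI\<close>)
  moreover have "((\<lambda>y. cbil (W y) y) \<circ> c has_vector_derivative 0) (at 0)"
  proof -
    have "\<forall>\<^sub>F t in nhds 0. c t \<in> XX"
      using ev c0 z by (simp add: eventually_nhds_conv_at)
    then have "\<forall>\<^sub>F t in nhds 0. ((\<lambda>y. cbil (W y) y) \<circ> c) t = 0"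
      by (rule eventually_mono) (use tan in \<open>auto simp: tangent_XX_def\<close>)
    then have "((\<lambda>y. cbil (W y) y) \<circ> c has_vector_derivative 0) (at 0) \<longleftrightarrow>
        ((\<lambda>t::real. 0::complex) has_vector_derivative 0) (at 0)"
      by (intro has_vector_derivative_cong_ev) (auto dest: eventually_nhds_x_imp_x)
    then show ?thesis by simp
  qed
  ultimately have "cbil (W z) v + cbil (W' v) z = 0"
    using vector_derivative_unique_at by blast
  then show ?thesis by (simp add: eq_neg_iff_add_eq_0 add.commute)
qed

lemma LC_torsion_free:
  assumes z: "z \<in> XX"
    and V: "(V has_derivative V') (at z)" and W: "(W has_derivative W') (at z)"
    and tan: "\<And>y. y \<in> XX \<Longrightarrow> V y \<in> tangent_XX y" "\<And>y. y \<in> XX \<Longrightarrow> W y \<in> tangent_XX y"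
  shows "proj_XX z (W' (V z)) - proj_XX z (V' (W z)) = W' (V z) - V' (W z)"
proof -
  have "cbil (W' (V z)) z = cbil (V' (W z)) z"
    using tangent_derivative[OF z tan(1)[OF z] W tan(2)] tangent_derivative[OF z tan(2)[OF z] V tan(1)]
    by (simp add: cbil_commute)
  then show ?thesis by (simp add: proj_XX_def)
qed

end

theory Submission
  imports Defs
begin

text \<open>Why the theorem holds. Let \<open>\<sigma>\<close> be the given immersion and \<open>\<nu>\<close> its unit normal. Put \<open>\<kappa> = 1\<close>
if \<open>\<Psi>\<close> is real and \<open>\<kappa> = \<i>\<close> if \<open>\<i>\<Psi>\<close> is real. At each point \<open>x\<close> of the universal cover, the
vectors \<open>\<sigma>(x)\<close>, \<open>\<kappa>\<nu>(x)\<close> and \<open>d\<sigma>(X)\<close>, \<open>X\<close> real, span a real subspace \<open>V\<^sub>x\<close> of \<open>\<complex>\<^sup>n\<^sup>+\<^sup>1\<close> of real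
dimension \<open>n + 1\<close>, on which the bilinear form is real. The vector \<open>\<sigma>(x)\<close> has square \<open>-1\<close>, the
vector \<open>\<kappa>\<nu>(x)\<close> has square \<open>\<kappa>\<^sup>2\<close>, and \<open>d\<sigma>\<close> is isometric; so the form has \<open>n - q\<close> positive and \<open>q +
1\<close> negative directions on \<open>V\<^sub>x\<close>, where \<open>q = p\<close> for \<open>\<kappa> = 1\<close> and \<open>q = p + 1\<close> for \<open>\<kappa> = \<i>\<close>. This is
the signature of the real subspace \<open>L\<close> of \<open>\<complex>\<^sup>n\<^sup>+\<^sup>1\<close> that contains the image of \<open>\<iota>\<close>.

The point is that \<open>V\<^sub>x\<close> does not depend on \<open>x\<close>. The derivatives of the frame \<open>\<sigma>, \<kappa>\<nu>, \<partial>\<^sub>k\<sigma>\<close> have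
real coefficients with respect to the frame: by the Gauss and Weingarten formulas these
coefficients are built from the metric, from its Christoffel symbols, which are real by the
Koszul formula as the metric is real, and from \<open>\<kappa>\<Psi>\<close>. A frame and its complex conjugate therefore
satisfy the same linear differential equation, so the matrix \<open>C\<close> that maps each frame vector to
its conjugate has zero derivative (\<open>parallel_real_frame\<close>, \<open>local_real_form\<close>). It is determined
by its values on the frame (\<open>conj_at_unique\<close>) and hence globally constant on the connected cover
(\<open>conj_at_global\<close>). So every \<open>\<sigma>(x)\<close> lies in the real form \<open>{z. C z = cnj z}\<close>.

An orthonormal basis of this real form at one point, sorted by signs, gives a complex orthogonal
matrix that carries the real form to \<open>L\<close> (\<open>real_form\<close>). The quadric in \<open>L\<close> may be disconnected,
so a reflection, or minus a reflection, is applied in addition to move one image point into the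
component covered by the space form (\<open>isometry_moving_point\<close>); connectedness keeps all other
image points there. Composition with an orthogonal matrix changes neither the pull-back metric
nor the shape operator, and it conjugates the representation of the deck group
(\<open>orthogonal_transform_data\<close>).

Tangent vectors, which are derivations of germs, are handled as combinations of coordinate
vectors. These span the real tangent space because the signature hypothesis bounds its dimension
by \<open>n - 1\<close> (\<open>rtangent_coord_span\<close>).\<close>

section \<open>Functions of class \<open>C\<^sup>k\<close> on open sets\<close>

lemma Ck_on_cong:
  assumes S: "open S" and eq: "\<And>x. x \<in> S \<Longrightarrow> f x = g x"
  shows "Ck_on k S f \<longleftrightarrow> Ck_on k S g"
  using eq
proof (induction k arbitrary: f g)
  case 0
  then show ?case by (simp cong: continuous_on_cong)
next
  case (Suc k)
  have D: "(f has_derivative f') (at x) \<longleftrightarrow> (g has_derivative f') (at x)" if "x \<in> S" for x f'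
    using has_derivative_transform_within_open[OF _ S that, of f f' UNIV g]
      has_derivative_transform_within_open[OF _ S that, of g f' UNIV f] Suc.prems by auto
  have "f differentiable at x \<longleftrightarrow> g differentiable at x" if "x \<in> S" for x
    using D[OF that] by (simp add: differentiable_def)
  moreover have "frechet_derivative f (at x) = frechet_derivative g (at x)" if "x \<in> S" for x
    using D[OF that] by (simp add: frechet_derivative_def)
  ultimately show ?case
    using Suc.IH[of "\<lambda>x. frechet_derivative f (at x) _" "\<lambda>x. frechet_derivative g (at x) _"]
    by (auto simp: Ball_def)
qed

lemma Ck_on_subset: "Ck_on k S f \<Longrightarrow> T \<subseteq> S \<Longrightarrow> Ck_on k T f"
  by (induction k arbitrary: f) (auto intro: continuous_on_subset)

lemma Ck_on_SucD: "Ck_on (Suc k) S f \<Longrightarrow> Ck_on k S f"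
proof (induction k arbitrary: f)
  case 0
  then show ?case
    by (auto intro: differentiable_imp_continuous_within continuous_at_imp_continuous_on)
next
  case (Suc k)
  then show ?case by (metis Ck_on.simps(2))
qed

lemma Ck_on_bounded_linear:
  assumes S: "open S" and L: "bounded_linear L"
  shows "Ck_on k S f \<Longrightarrow> Ck_on k S (\<lambda>x. L (f x))"
proof (induction k arbitrary: f)
  case 0
  then show ?case using bounded_linear.continuous_on[OF L] by auto
next
  case (Suc k)
  have D: "((\<lambda>x. L (f x)) has_derivative (\<lambda>v. L (frechet_derivative f (at x) v))) (at x)"
    if "x \<in> S" for x
    using Suc.prems that
    by (auto intro!: bounded_linear.has_derivative[OF L] simp flip: frechet_derivative_works)
  have "frechet_derivative (\<lambda>x. L (f x)) (at x) v = L (frechet_derivative f (at x) v)"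
    if "x \<in> S" for x v
    using frechet_derivative_at[OF D[OF that]] by metis
  moreover have "(\<lambda>x. L (f x)) differentiable at x" if "x \<in> S" for x
    using D[OF that] by (auto simp: differentiable_def)
  ultimately show ?case
    using Suc.prems Suc.IH
    by (auto simp: Ck_on_cong[OF S, of "\<lambda>x. frechet_derivative (\<lambda>x. L (f x)) (at x) _"
      "\<lambda>x. L (frechet_derivative f (at x) _)"])
qed

lemma Ck_on_add:
  assumes S: "open S"
  shows "Ck_on k S f \<Longrightarrow> Ck_on k S g \<Longrightarrow> Ck_on k S (\<lambda>x. f x + g x)"
proof (induction k arbitrary: f g)
  case 0
  then show ?case by (auto intro: continuous_on_add)
next
  case (Suc k)
  have D: "((\<lambda>x. f x + g x) has_derivative
      (\<lambda>v. frechet_derivative f (at x) v + frechet_derivative g (at x) v)) (at x)"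
    if "x \<in> S" for x
    using Suc.prems that
    by (auto intro!: has_derivative_add simp flip: frechet_derivative_works)
  have "frechet_derivative (\<lambda>x. f x + g x) (at x) v
      = frechet_derivative f (at x) v + frechet_derivative g (at x) v" if "x \<in> S" for x v
    using frechet_derivative_at[OF D[OF that]] by metis
  moreover have "(\<lambda>x. f x + g x) differentiable at x" if "x \<in> S" for x
    using D[OF that] by (auto simp: differentiable_def)
  ultimately show ?case
    using Suc.prems Suc.IH
    by (auto simp: Ck_on_cong[OF S, of "\<lambda>x. frechet_derivative (\<lambda>x. f x + g x) (at x) _"
      "\<lambda>x. frechet_derivative f (at x) _ + frechet_derivative g (at x) _"])
qed

lemma Ck_on_bilinear:
  assumes S: "open S" and p: "bounded_bilinear p"
  shows "Ck_on k S f \<Longrightarrow> Ck_on k S g \<Longrightarrow> Ck_on k S (\<lambda>x. p (f x) (g x))"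
proof (induction k arbitrary: f g)
  case 0
  then show ?case using bounded_bilinear.continuous_on[OF p] by auto
next
  case (Suc k)
  let ?D = "\<lambda>f x. frechet_derivative f (at x)"
  have D: "((\<lambda>x. p (f x) (g x)) has_derivative
      (\<lambda>v. p (f x) (?D g x v) + p (?D f x v) (g x))) (at x)"
    if "x \<in> S" for x
    using Suc.prems that
    by (auto intro!: bounded_bilinear.FDERIV[OF p] simp flip: frechet_derivative_works)
  have e: "?D (\<lambda>x. p (f x) (g x)) x v = p (f x) (?D g x v) + p (?D f x v) (g x)" if "x \<in> S" for x v
    using frechet_derivative_at[OF D[OF that]] by metis
  have d: "(\<lambda>x. p (f x) (g x)) differentiable at x" if "x \<in> S" for x
    using D[OF that] by (auto simp: differentiable_def)
  have "Ck_on k S (\<lambda>x. p (f x) (?D g x v) + p (?D f x v) (g x))" for v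
    using Suc.prems Ck_on_SucD[OF Suc.prems(1)] Ck_on_SucD[OF Suc.prems(2)]
    by (intro Ck_on_add[OF S] Suc.IH) auto
  then have "Ck_on k S (\<lambda>x. ?D (\<lambda>x. p (f x) (g x)) x v)" for v
    by (subst Ck_on_cong[OF S e]) auto
  then show ?case using d by simp
qed

lemma smooth_on_cong:
  "open S \<Longrightarrow> (\<And>x. x \<in> S \<Longrightarrow> f x = g x) \<Longrightarrow> smooth_on S f \<longleftrightarrow> smooth_on S g"
  unfolding smooth_on_def using Ck_on_cong by blast

lemma smooth_on_subset: "smooth_on S f \<Longrightarrow> T \<subseteq> S \<Longrightarrow> smooth_on T f"
  unfolding smooth_on_def using Ck_on_subset by blast

lemma smooth_on_differentiable: "smooth_on S f \<Longrightarrow> x \<in> S \<Longrightarrow> f differentiable at x"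
  unfolding smooth_on_def using Ck_on.simps(2) by blast

lemma smooth_on_frechet_derivative:
  "smooth_on S f \<Longrightarrow> smooth_on S (\<lambda>x. frechet_derivative f (at x) v)"
  unfolding smooth_on_def using Ck_on.simps(2) by blast

lemma smooth_on_continuous: "smooth_on S f \<Longrightarrow> continuous_on S f"
  unfolding smooth_on_def using Ck_on.simps(1) by blast

text \<open>The derivative of an explicitly given function can be read off from \<open>has_derivative\<close> facts
and transferred to \<open>frechet_derivative\<close>, on which \<open>Ck_on\<close> is built.\<close>

lemma has_derivative_iff_frechet:
  "(f has_derivative f') (at x) \<longleftrightarrow> f differentiable at x \<and> frechet_derivative f (at x) = f'"
  by (metis differentiableI frechet_derivative_at frechet_derivative_works)

section \<open>Symmetry of second derivatives\<close>

text \<open>Both mixed derivatives are limits of the second order difference quotient, which is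
symmetric in the two directions: applying the mean value theorem first along \<open>v\<close> and then along
\<open>w\<close> writes the quotient as a value of one of them at a nearby point.\<close>

lemma second_difference_mvt:
  fixes f :: "'e::real_normed_vector \<Rightarrow> real"
  assumes t: "0 < t"
    and D: "\<And>a b. 0 \<le> a \<Longrightarrow> a \<le> t \<Longrightarrow> 0 \<le> b \<Longrightarrow> b \<le> t \<Longrightarrow>
       f differentiable at (x + a *\<^sub>R v + b *\<^sub>R w) \<and>
       (\<lambda>y. frechet_derivative f (at y) v) differentiable at (x + a *\<^sub>R v + b *\<^sub>R w)"
  shows "\<exists>a b. 0 \<le> a \<and> a \<le> t \<and> 0 \<le> b \<and> b \<le> t \<and>
    f (x + t *\<^sub>R v + t *\<^sub>R w) - f (x + t *\<^sub>R v) - f (x + t *\<^sub>R w) + f x =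
    t * t * frechet_derivative (\<lambda>y. frechet_derivative f (at y) v) (at (x + a *\<^sub>R v + b *\<^sub>R w)) w"
proof -
  let ?f' = "\<lambda>y. frechet_derivative f (at y)"
  let ?g = "\<lambda>a. f (x + a *\<^sub>R v + t *\<^sub>R w) - f (x + a *\<^sub>R v)"
  have 1: "((\<lambda>a. f (x + a *\<^sub>R v + b *\<^sub>R w)) has_derivative (\<lambda>h. ?f' (x + a *\<^sub>R v + b *\<^sub>R w) (h *\<^sub>R v)))
      (at a)" if "0 \<le> a" "a \<le> t" "0 \<le> b" "b \<le> t" for a b
  proof -
    have "((\<lambda>a. x + a *\<^sub>R v + b *\<^sub>R w) has_derivative (\<lambda>h. h *\<^sub>R v)) (at a)"
      by (auto intro!: derivative_eq_intros)
    moreover have "(f has_derivative ?f' (x + a *\<^sub>R v + b *\<^sub>R w)) (at (x + a *\<^sub>R v + b *\<^sub>R w))"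
      using D[OF that] by (simp add: frechet_derivative_works)
    ultimately show ?thesis by (rule has_derivative_compose)
  qed
  have lin: "linear (?f' (x + a *\<^sub>R v + b *\<^sub>R w))" if "0 \<le> a" "a \<le> t" "0 \<le> b" "b \<le> t" for a b
    using D[OF that] by (auto intro: linear_frechet_derivative)
  have g: "(?g has_derivative (\<lambda>h. h * (?f' (x + a *\<^sub>R v + t *\<^sub>R w) v - ?f' (x + a *\<^sub>R v) v))) (at a)"
    if "0 \<le> a" "a \<le> t" for a
    using has_derivative_diff[OF 1[of a t] 1[of a 0]] that t lin[of a t] lin[of a 0]
    by (simp add: linear_scale algebra_simps)
  obtain a where a: "0 < a" "a < t"
    and ga: "?g t - ?g 0 = t * (?f' (x + a *\<^sub>R v + t *\<^sub>R w) v - ?f' (x + a *\<^sub>R v) v)"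
    using mvt_simple[OF t has_derivative_at_withinI[OF g]] by fastforce
  let ?k = "\<lambda>b. ?f' (x + a *\<^sub>R v + b *\<^sub>R w) v"
  let ?f'' = "\<lambda>y. frechet_derivative (\<lambda>y. frechet_derivative f (at y) v) (at y)"
  have k: "(?k has_derivative (\<lambda>h. h * ?f'' (x + a *\<^sub>R v + b *\<^sub>R w) w)) (at b)"
    if "0 \<le> b" "b \<le> t" for b
  proof -
    have "((\<lambda>b. x + a *\<^sub>R v + b *\<^sub>R w) has_derivative (\<lambda>h. h *\<^sub>R w)) (at b)"
      by (auto intro!: derivative_eq_intros)
    moreover have d: "((\<lambda>y. frechet_derivative f (at y) v)
        has_derivative ?f'' (x + a *\<^sub>R v + b *\<^sub>R w))
       (at (x + a *\<^sub>R v + b *\<^sub>R w))"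
      using D[of a b] a that by (simp add: frechet_derivative_works)
    ultimately have "(?k has_derivative (\<lambda>h. ?f'' (x + a *\<^sub>R v + b *\<^sub>R w) (h *\<^sub>R w))) (at b)"
      by (rule has_derivative_compose)
    moreover have "linear (?f'' (x + a *\<^sub>R v + b *\<^sub>R w))"
      using d by (rule has_derivative_linear)
    ultimately show ?thesis by (simp add: linear_scale)
  qed
  obtain b where b: "0 < b" "b < t"
    and kb: "?k t - ?k 0 = t * ?f'' (x + a *\<^sub>R v + b *\<^sub>R w) w"
    using mvt_simple[OF t has_derivative_at_withinI[OF k]] by fastforce
  have "f (x + t *\<^sub>R v + t *\<^sub>R w) - f (x + t *\<^sub>R v) - f (x + t *\<^sub>R w) + f x = ?g t - ?g 0" by simp
  also have "\<dots> = t * t * ?f'' (x + a *\<^sub>R v + b *\<^sub>R w) w"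
    using ga kb by simp
  finally show ?thesis using a b by (intro exI[of _ a] exI[of _ b]) auto
qed

lemma second_difference_tendsto:
  fixes f :: "'e::real_normed_vector \<Rightarrow> real"
  assumes S: "open S" "x \<in> S" and f: "Ck_on 2 S f"
  shows "((\<lambda>t. (f (x + t *\<^sub>R v + t *\<^sub>R w) - f (x + t *\<^sub>R v) - f (x + t *\<^sub>R w) + f x) / (t * t))
    \<longlongrightarrow> frechet_derivative (\<lambda>y. frechet_derivative f (at y) v) (at x) w) (at_right 0)"
proof (rule tendstoI)
  fix e :: real assume e: "0 < e"
  let ?f' = "\<lambda>y. frechet_derivative f (at y) v"
  let ?f'' = "\<lambda>y. frechet_derivative ?f' (at y) w"
  have f2: "f differentiable at y" "?f' differentiable at y" if "y \<in> S" for y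
    using f that by (auto simp: numeral_2_eq_2)
  have "continuous_on S ?f''"
    using f by (auto simp: numeral_2_eq_2)
  then have "continuous (at x) ?f''"
    using S by (simp add: continuous_on_eq_continuous_at)
  then obtain d1 where d1: "0 < d1" "\<And>y. dist y x < d1 \<Longrightarrow> dist (?f'' y) (?f'' x) < e"
    using e by (auto simp: continuous_at_eps_delta)
  obtain d2 where d2: "0 < d2" "ball x d2 \<subseteq> S"
    using S openE by blast
  \<comment> \<open>The \<open>1\<close> in the denominator covers the case that \<open>v\<close> and \<open>w\<close> both vanish.\<close>
  define d where "d = min d1 d2 / (norm v + norm w + 1)"
  have d0: "0 < d"
    using d1 d2 by (auto simp: d_def intro!: divide_pos_pos add_nonneg_pos)
  have close: "dist (x + a *\<^sub>R v + b *\<^sub>R w) x < min d1 d2"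
    if "0 \<le> a" "a \<le> t" "0 \<le> b" "b \<le> t" "t < d" for a b t
  proof -
    have "dist (x + a *\<^sub>R v + b *\<^sub>R w) x \<le> norm (a *\<^sub>R v) + norm (b *\<^sub>R w)"
      using norm_triangle_ineq[of "a *\<^sub>R v" "b *\<^sub>R w"] by (simp add: dist_norm add.assoc)
    also have "\<dots> \<le> t * norm v + t * norm w"
      using that by (intro add_mono) (auto intro!: mult_right_mono)
    also have "\<dots> \<le> t * (norm v + norm w + 1)"
      using that by (simp add: algebra_simps)
    also have "\<dots> < d * (norm v + norm w + 1)"
      using that by (intro mult_strict_right_mono) (auto simp: add_nonneg_pos)
    also have "\<dots> = min d1 d2"
      using add_nonneg_pos[of "norm v + norm w" 1] by (simp add: d_def)
    finally show ?thesis .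
  qed
  have "dist ((f (x + t *\<^sub>R v + t *\<^sub>R w) - f (x + t *\<^sub>R v) - f (x + t *\<^sub>R w) + f x) / (t * t))
      (?f'' x) < e" if t: "0 < t" "t < d" for t
  proof -
    have "x + a *\<^sub>R v + b *\<^sub>R w \<in> S" if "0 \<le> a" "a \<le> t" "0 \<le> b" "b \<le> t" for a b
      using close[OF that t(2)] d2 by (auto simp: dist_commute)
    then obtain a b where ab: "0 \<le> a" "a \<le> t" "0 \<le> b" "b \<le> t"
      and "f (x + t *\<^sub>R v + t *\<^sub>R w) - f (x + t *\<^sub>R v) - f (x + t *\<^sub>R w) + f x =
        t * t * ?f'' (x + a *\<^sub>R v + b *\<^sub>R w)"
      using second_difference_mvt[OF t(1), of f x v w] f2 by blast
    then show ?thesis using t close[OF ab t(2)] d1 by simp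
  qed
  then show "\<forall>\<^sub>F t in at_right 0. dist ((f (x + t *\<^sub>R v + t *\<^sub>R w) - f (x + t *\<^sub>R v) - f (x + t *\<^sub>R w) +
      f x) / (t * t))
      (?f'' x) < e"
    using d0 by (auto simp: eventually_at_right_field)
qed

lemma mixed_partials_commute:
  fixes f :: "'e::real_normed_vector \<Rightarrow> 'b::euclidean_space"
  assumes S: "open S" "x \<in> S" and f: "Ck_on 2 S f"
  shows "frechet_derivative (\<lambda>y. frechet_derivative f (at y) v) (at x) w =
         frechet_derivative (\<lambda>y. frechet_derivative f (at y) w) (at x) v"
proof (rule euclidean_eqI)
  fix b :: 'b assume "b \<in> Basis"
  let ?h = "\<lambda>y. f y \<bullet> b"
  have bl: "bounded_linear (\<lambda>z. z \<bullet> b)" by (rule bounded_linear_inner_left)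
  have h: "Ck_on 2 S ?h" using Ck_on_bounded_linear[OF S(1) bl f] .
  have d1: "frechet_derivative ?h (at y) v = frechet_derivative f (at y) v \<bullet> b" if "y \<in> S" for y v
  proof -
    have "(f has_derivative frechet_derivative f (at y)) (at y)"
      using f that by (simp add: numeral_2_eq_2 flip: frechet_derivative_works)
    from bounded_linear.has_derivative[OF bl this] show ?thesis
      by (simp add: has_derivative_iff_frechet)
  qed
  have d2: "frechet_derivative (\<lambda>y. frechet_derivative ?h (at y) v) (at x) w
      = frechet_derivative (\<lambda>y. frechet_derivative f (at y) v) (at x) w \<bullet> b" for v w
  proof -
    have "((\<lambda>y. frechet_derivative f (at y) v) has_derivative
        frechet_derivative (\<lambda>y. frechet_derivative f (at y) v) (at x)) (at x)"
      using f S by (simp add: numeral_2_eq_2 flip: frechet_derivative_works)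
    from bounded_linear.has_derivative[OF bl this]
    have "((\<lambda>y. frechet_derivative ?h (at y) v) has_derivative
        (\<lambda>w. frechet_derivative (\<lambda>y. frechet_derivative f (at y) v) (at x) w \<bullet> b)) (at x)"
      by (rule has_derivative_transform_within_open[OF _ S]) (simp add: d1)
    then show ?thesis by (simp add: has_derivative_iff_frechet)
  qed
  have "((\<lambda>t. (?h (x + t *\<^sub>R v + t *\<^sub>R w) - ?h (x + t *\<^sub>R v) - ?h (x + t *\<^sub>R w) + ?h x) / (t * t))
    \<longlongrightarrow> frechet_derivative (\<lambda>y. frechet_derivative ?h (at y) v) (at x) w) (at_right 0)"
    by (rule second_difference_tendsto[OF S h])
  moreover have "((\<lambda>t. (?h (x + t *\<^sub>R v + t *\<^sub>R w) - ?h (x + t *\<^sub>R v) - ?h (x + t *\<^sub>R w) + ?h x) / (t *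
      t))
    \<longlongrightarrow> frechet_derivative (\<lambda>y. frechet_derivative ?h (at y) w) (at x) v) (at_right 0)"
    using second_difference_tendsto[OF S h, of w v] by (simp add: algebra_simps)
  ultimately show "frechet_derivative (\<lambda>y. frechet_derivative f (at y) v) (at x) w \<bullet> b =
         frechet_derivative (\<lambda>y. frechet_derivative f (at y) w) (at x) v \<bullet> b"
    unfolding d2 using tendsto_unique[OF trivial_limit_at_right_real] by blast
qed

section \<open>Conjugation and the bilinear form\<close>

definition cnjv :: "complex^'N \<Rightarrow> complex^'N" where
  "cnjv z = (\<chi> i. cnj (z $ i))"

lemma cnjv_cnjv [simp]: "cnjv (cnjv z) = z"
  by (simp add: cnjv_def vec_eq_iff)

lemma cnjv_eq_0_iff [simp]: "cnjv z = 0 \<longleftrightarrow> z = 0"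
  by (simp add: cnjv_def vec_eq_iff)

lemma bounded_linear_cnjv: "bounded_linear cnjv"
  unfolding linear_conv_bounded_linear[symmetric]
  by (auto intro!: linearI simp: cnjv_def vec_eq_iff)

lemma cbil_cnjv: "cbil (cnjv z) (cnjv w) = cnj (cbil z w)"
  by (simp add: cbil_def cnjv_def)

lemma cbil_matrix_vector: "cbil (M *v z) w = cbil z (transpose M *v w)"
proof -
  have "cbil (M *v z) w = (\<Sum>i\<in>UNIV. \<Sum>j\<in>UNIV. M $ i $ j * z $ j * w $ i)"
    by (simp add: cbil_def matrix_vector_mult_def sum_distrib_right)
  also have "\<dots> = (\<Sum>j\<in>UNIV. \<Sum>i\<in>UNIV. M $ i $ j * z $ j * w $ i)"
    by (rule sum.swap)
  also have "\<dots> = cbil z (transpose M *v w)"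
    by (simp add: cbil_def matrix_vector_mult_def transpose_def sum_distrib_left mult_ac)
  finally show ?thesis .
qed

lemma cbil_sum_left: "cbil (\<Sum>a\<in>I. f a) w = (\<Sum>a\<in>I. cbil (f a) w)"
  by (induction I rule: infinite_finite_induct) (simp_all add: cbil_simps(1), simp_all add:
      cbil_def)

lemma cbil_sum_right: "cbil w (\<Sum>a\<in>I. f a) = (\<Sum>a\<in>I. cbil w (f a))"
  using cbil_sum_left[of f I w] by (simp add: cbil_commute)

lemma matrix_vector_vsm: "(M :: complex^'N^'N) *v (k *s z) = k *s (M *v z)"
  by (simp add: matrix_vector_mult_def vec_eq_iff sum_distrib_left mult_ac)

lemma frame_matrix_invertible:
  fixes E :: "'N::finite \<Rightarrow> complex^'N"
  assumes nd: "\<And>v. (\<And>a. cbil (E a) v = 0) \<Longrightarrow> v = 0"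
  shows "invertible (\<chi> a. E a)"
proof -
  have "v = 0" if "(\<chi> a. E a) *v v = 0" for v
    using that by (intro nd) (simp add: matrix_vector_mult_def vec_eq_iff cbil_def)
  then show ?thesis
    unfolding invertible_left_inverse matrix_left_invertible_ker by blast
qed

text \<open>A family with trivial orthogonal complement forms an invertible matrix, so it is a basis.\<close>

lemma frame_spans:
  fixes E :: "'N::finite \<Rightarrow> complex^'N"
  assumes nd: "\<And>v. (\<And>a. cbil (E a) v = 0) \<Longrightarrow> v = 0"
  obtains c where "v = (\<Sum>a\<in>UNIV. c a *s E a)"
proof -
  have "invertible (transpose (\<chi> a. E a))"
    using frame_matrix_invertible[OF nd] by (simp add: invertible_det_nz)
  then obtain B where B: "transpose (\<chi> a. E a) ** B = mat 1"
    unfolding invertible_def by blast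
  have "v = transpose (\<chi> a. E a) *v (B *v v)"
    by (simp add: matrix_vector_mul_assoc B)
  also have "\<dots> = (\<Sum>a\<in>UNIV. (B *v v) $ a *s E a)"
    by (subst matrix_vector_mult_def) (simp add: transpose_def vec_eq_iff mult.commute)
  finally show ?thesis by (rule that)
qed

text \<open>If the Gram matrix of a frame is real, the frame and its conjugate have the same Gram
matrix, so the matrix that exchanges them preserves the bilinear form. A vector whose products
with the frame are real is a real combination of the frame, and is conjugated as well.\<close>

lemma conjugation_matrix:
  fixes E :: "'N::finite \<Rightarrow> complex^'N"
  assumes nd: "\<And>v. (\<And>a. cbil (E a) v = 0) \<Longrightarrow> v = 0"
    and gram: "\<And>a b. cbil (E a) (E b) \<in> \<real>"
    and C: "\<And>a. C *v E a = cnjv (E a)"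
  shows "cbil (C *v v) (C *v w) = cbil v w"
    and "(\<And>b. cbil z (E b) \<in> \<real>) \<Longrightarrow> C *v z = cnjv z"
proof -
  show orth: "cbil (C *v v) (C *v w) = cbil v w" for v w
  proof -
    obtain c where v: "v = (\<Sum>a\<in>UNIV. c a *s E a)" using frame_spans[OF nd] .
    obtain d where w: "w = (\<Sum>a\<in>UNIV. d a *s E a)" using frame_spans[OF nd] .
    have "cbil (cnjv (E a)) (cnjv (E b)) = cbil (E a) (E b)" for a b
      using gram[of a b] by (simp add: cbil_cnjv Reals_cnj_iff)
    then show ?thesis
      unfolding v w by (simp add: vec.sum matrix_vector_vsm C cbil_sum_left cbil_sum_right
          cbil_simps)
  qed
  show "C *v z = cnjv z" if real: "\<And>b. cbil z (E b) \<in> \<real>"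
  proof -
    have "cbil (C *v z) (cnjv (E b)) = cbil (cnjv z) (cnjv (E b))" for b
      using orth[of z "E b"] real[of b] by (simp add: C cbil_cnjv Reals_cnj_iff)
    then have "cbil (cnjv (C *v z - cnjv z)) (cnjv (cnjv (E b))) = 0" for b
      by (simp only: cbil_cnjv cbil_simps) simp
    then have "cnjv (C *v z - cnjv z) = 0"
      by (intro nd) (simp add: cbil_commute)
    then show ?thesis by simp
  qed
qed

section \<open>Frames with real connection coefficients\<close>

lemma det_differentiable:
  fixes M :: "'e::real_normed_vector \<Rightarrow> complex^'N^'N"
  assumes "\<And>i j. (\<lambda>y. M y $ i $ j) differentiable at x"
  shows "(\<lambda>y. det (M y)) differentiable at x"
proof -
  obtain D where D: "\<And>i j. ((\<lambda>y. M y $ i $ j) has_derivative D i j) (at x)"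
    using assms unfolding differentiable_def by metis
  have "((\<lambda>y. \<Sum>p\<in>{p. p permutes UNIV}. of_int (sign p) * (\<Prod>i\<in>UNIV. M y $ i $ p i)) has_derivative
     (\<lambda>v. \<Sum>p\<in>{p. p permutes (UNIV::'N set)}. of_int (sign p) *
        (\<Sum>i\<in>UNIV. D i (p i) v * (\<Prod>j\<in>UNIV - {i}. M x $ j $ p j)))) (at x)"
    by (intro has_derivative_sum has_derivative_mult_right has_derivative_prod D)
  then show ?thesis unfolding det_def differentiable_def by blast
qed

text \<open>Differentiating \<open>C E = cnj E\<close> gives \<open>C' E + C E' = cnj E'\<close>. The products of \<open>E'\<close> with the
frame are real, hence \<open>C E' = cnj E'\<close>, so that \<open>C'\<close> kills the frame and vanishes. Cramer's rule
provides a \<open>C\<close> that is differentiable to begin with.\<close>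

lemma parallel_real_frame:
  fixes E :: "'N::finite \<Rightarrow> 'e::euclidean_space \<Rightarrow> complex^'N"
  assumes S: "open S" "convex S"
    and D: "\<And>a y. y \<in> S \<Longrightarrow> (E a has_derivative E' a y) (at y)"
    and gram: "\<And>a b y. y \<in> S \<Longrightarrow> cbil (E a y) (E b y) \<in> \<real>"
    and par: "\<And>a b y v. y \<in> S \<Longrightarrow> v \<in> Basis \<Longrightarrow> cbil (E' a y v) (E b y) \<in> \<real>"
    and nd: "\<And>y v. y \<in> S \<Longrightarrow> (\<And>a. cbil (E a y) v = 0) \<Longrightarrow> v = 0"
  shows "\<exists>C. \<forall>y\<in>S. \<forall>a. C *v E a y = cnjv (E a y)"
proof -
  let ?F = "\<lambda>y. \<chi> a. E a y"
  define C where "C = (\<lambda>y. (\<chi> j k. det (\<chi> a l. if l = k then cnj (E a y $ j) else E a y $ l)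
      / det (?F y)) :: complex^'N^'N)"
  have det: "det (?F y) \<noteq> 0" if "y \<in> S" for y
    using frame_matrix_invertible[OF nd[OF that]] by (simp add: invertible_det_nz)
  have C: "C y *v E a y = cnjv (E a y)" if "y \<in> S" for y a
  proof -
    have "?F y *v (\<chi> k. C y $ j $ k) = (\<chi> a. cnj (E a y $ j))" for j
      unfolding cramer[OF det[OF that]] by (simp add: C_def cong: if_cong)
    then show ?thesis
      by (simp add: vec_eq_iff matrix_vector_mult_def cnjv_def mult.commute)
  qed
  have comp: "((\<lambda>y. E a y $ k) has_derivative (\<lambda>v. E' a y v $ k)) (at y)" if "y \<in> S" for y a k
    by (rule bounded_linear.has_derivative[OF bounded_linear_vec_nth D[OF that]])
  have cnj: "((\<lambda>y. cnj (E a y $ k)) has_derivative (\<lambda>v. cnj (E' a y v $ k))) (at y)"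
    if "y \<in> S" for y a k
    by (rule bounded_linear.has_derivative[OF bounded_linear_cnj comp[OF that]])
  have Cdiff: "(\<lambda>y. C y $ j $ k) differentiable at y" if "y \<in> S" for y j k
  proof -
    have "(\<lambda>y. det (\<chi> a l. if l = k then cnj (E a y $ j) else E a y $ l)) differentiable at y"
    proof (rule det_differentiable)
      fix a l
      show "(\<lambda>y. (\<chi> a l. if l = k then cnj (E a y $ j) else E a y $ l) $ a $ l) differentiable at y"
        using differentiableI[OF comp[OF that]] differentiableI[OF cnj[OF that]] by (cases "l =
            k") simp_all
    qed
    moreover have "(\<lambda>y. det (?F y)) differentiable at y"
      by (rule det_differentiable) (use comp[OF that] in \<open>auto simp: differentiable_def\<close>)
    ultimately have "(\<lambda>y. det (\<chi> a l. if l = k then cnj (E a y $ j) else E a y $ l) / det (?F y))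
        differentiable at y"
      using det[OF that] by (rule differentiable_divide)
    then show ?thesis by (simp only: C_def vec_lambda_beta)
  qed
  have const: "\<exists>c. \<forall>y\<in>S. C y $ j $ k = c" for j k
  proof -
    have "((\<lambda>y. C y $ j $ k) has_derivative (\<lambda>v. 0)) (at y within S)" if y: "y \<in> S" for y
    proof -
      let ?d = "\<lambda>k. frechet_derivative (\<lambda>y. C y $ j $ k) (at y)"
      have d: "((\<lambda>y. C y $ j $ k) has_derivative ?d k) (at y)" for k
        using Cdiff[OF y] by (simp flip: frechet_derivative_works)
      have "?d k v = 0" if v: "v \<in> Basis" for k v
      proof -
        have "cbil (E a y) (\<chi> k. ?d k v) = 0" for a
        proof -
          have "((\<lambda>y. \<Sum>k\<in>UNIV. C y $ j $ k * E a y $ k) has_derivative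
              (\<lambda>v. \<Sum>k\<in>UNIV. C y $ j $ k * E' a y v $ k + ?d k v * E a y $ k)) (at y)"
            by (rule has_derivative_sum) (rule has_derivative_mult[OF d comp[OF y]])
          moreover have "((\<lambda>y. \<Sum>k\<in>UNIV. C y $ j $ k * E a y $ k) has_derivative
              (\<lambda>v. cnj (E' a y v $ j))) (at y)"
          proof (rule has_derivative_transform_within_open[OF cnj[OF y] S(1) y])
            fix y assume "y \<in> S"
            then have "(C y *v E a y) $ j = cnjv (E a y) $ j" by (simp only: C)
            then show "cnj (E a y $ j) = (\<Sum>k\<in>UNIV. C y $ j $ k * E a y $ k)"
              by (simp add: matrix_vector_mult_def cnjv_def)
          qed
          ultimately have "(\<Sum>k\<in>UNIV. C y $ j $ k * E' a y v $ k + ?d k v * E a y $ k)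
              = cnj (E' a y v $ j)"
            by (rule has_derivative_unique[THEN fun_cong])
          moreover have "C y *v E' a y v = cnjv (E' a y v)"
            by (rule conjugation_matrix(2)[where E = "\<lambda>a. E a y",
                OF nd[OF y] gram[OF y] C[OF y] par[OF y v]])
          then have "(C y *v E' a y v) $ j = cnjv (E' a y v) $ j" by simp
          then have "(\<Sum>k\<in>UNIV. C y $ j $ k * E' a y v $ k) = cnj (E' a y v $ j)"
            by (simp add: matrix_vector_mult_def cnjv_def)
          ultimately show ?thesis
            by (simp add: sum.distrib cbil_def mult.commute)
        qed
        then have "(\<chi> k. ?d k v) = 0" by (rule nd[OF y])
        then show ?thesis by (simp add: vec_eq_iff)
      qed
      then have "?d k = (\<lambda>v. 0)"
        using linear_eq_stdbasis[OF has_derivative_linear[OF d[of k]] linear_zero] by blast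
      with d[of k] show ?thesis by (auto intro: has_derivative_at_withinI)
    qed
    from has_derivative_zero_constant[OF S(2) this] show ?thesis by blast
  qed
  show ?thesis
  proof (cases "S = {}")
    case False
    then obtain y0 where "y0 \<in> S" by blast
    have "C y = C y0" if "y \<in> S" for y
    proof -
      have "C y $ j $ k = C y0 $ j $ k" for j k
      proof -
        obtain c where "\<forall>y\<in>S. C y $ j $ k = c" using const by blast
        then show ?thesis using that \<open>y0 \<in> S\<close> by simp
      qed
      then show ?thesis by (simp add: vec_eq_iff)
    qed
    then have "\<forall>y\<in>S. \<forall>a. C y0 *v E a y = cnjv (E a y)" using C by auto
    then show ?thesis by blast
  qed simp
qed

lemma has_derivative_real_valued:
  fixes f :: "'e::real_normed_vector \<Rightarrow> complex"
  assumes f: "(f has_derivative f') (at x)" and S: "open S" "x \<in> S"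
    and real: "\<And>y. y \<in> S \<Longrightarrow> f y \<in> \<real>"
  shows "f' v \<in> \<real>"
proof -
  have "((\<lambda>y. Im (f y)) has_derivative (\<lambda>v. Im (f' v))) (at x)"
    by (rule bounded_linear.has_derivative[OF bounded_linear_Im f])
  moreover have "((\<lambda>y. Im (f y)) has_derivative (\<lambda>v. 0)) (at x)"
    by (rule has_derivative_transform_within_open[OF has_derivative_const S])
      (use real in \<open>auto simp: complex_is_Real_iff\<close>)
  ultimately have "Im (f' v) = 0" using has_derivative_unique by metis
  then show ?thesis by (simp add: complex_is_Real_iff)
qed

lemma cbil_derivative_const:
  fixes f g :: "'e::real_normed_vector \<Rightarrow> complex^'N"
  assumes f: "(f has_derivative f') (at x)" and g: "(g has_derivative g') (at x)"
    and S: "open S" "x \<in> S" and c: "\<And>y. y \<in> S \<Longrightarrow> cbil (f y) (g y) = c"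
  shows "cbil (f x) (g' v) + cbil (f' v) (g x) = 0"
proof -
  have "((\<lambda>y. cbil (f y) (g y)) has_derivative (\<lambda>v. cbil (f x) (g' v) + cbil (f' v) (g x))) (at x)"
    by (rule bounded_bilinear.FDERIV[OF bounded_bilinear_cbil f g])
  moreover have "((\<lambda>y. cbil (f y) (g y)) has_derivative (\<lambda>v. 0)) (at x)"
    by (rule has_derivative_transform_within_open[OF has_derivative_const S]) (use c in auto)
  ultimately show ?thesis using has_derivative_unique by metis
qed

text \<open>The algebra behind the uniqueness of the Levi-Civita connection.\<close>

lemma alternating_symmetric_zero:
  fixes a :: "'i \<Rightarrow> 'i \<Rightarrow> 'i \<Rightarrow> real"
  assumes "\<And>k j l. a k j l = - a k l j" "\<And>k j l. a k j l = a j k l"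
  shows "a k j l = 0"
  using assms(1)[of k j l] assms(2)[of k l j] assms(1)[of l k j] assms(2)[of l j k]
    assms(1)[of j l k] assms(2)[of j k l] by linarith

text \<open>The frame \<open>s, u, \<partial>\<^sub>k s\<close> satisfies the hypotheses of \<open>parallel_real_frame\<close>. The products of
its derivatives with its members follow from the constancy of the products of the members, from
\<open>shape\<close>, and, for \<open>\<partial>\<^sub>k \<partial>\<^sub>j s\<close> against \<open>\<partial>\<^sub>l s\<close>, from the Koszul argument applied to imaginary parts:
these are antisymmetric in \<open>j, l\<close> because the metric coefficients are real and symmetric in \<open>k,
j\<close> because second derivatives commute.\<close>

lemma local_real_form:
  fixes s u :: "real^'d \<Rightarrow> complex^'N"
  defines "pd \<equiv> \<lambda>f k y. frechet_derivative f (at y) (axis k 1)"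
  assumes N: "CARD('N) = CARD('d::finite) + 2" and S: "open S" "convex S"
    and s: "smooth_on S s" and u: "smooth_on S u"
    and ss: "\<And>y. y \<in> S \<Longrightarrow> cbil (s y) (s y) = -1"
    and us: "\<And>y. y \<in> S \<Longrightarrow> cbil (u y) (s y) = 0"
    and uu: "\<And>y. y \<in> S \<Longrightarrow> cbil (u y) (u y) = of_real \<epsilon>"
    and uds: "\<And>k y. y \<in> S \<Longrightarrow> cbil (u y) (pd s k y) = 0"
    and metric: "\<And>k j y. y \<in> S \<Longrightarrow> cbil (pd s k y) (pd s j y) \<in> \<real>"
    and shape: "\<And>k j y. y \<in> S \<Longrightarrow> cbil (pd u k y) (pd s j y) \<in> \<real>"
    and nd: "\<And>y v. y \<in> S \<Longrightarrow> cbil (s y) v = 0 \<Longrightarrow> cbil (u y) v = 0 \<Longrightarrow>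
       (\<And>k. cbil (pd s k y) v = 0) \<Longrightarrow> v = 0"
  shows "\<exists>C. \<forall>y\<in>S. C *v s y = cnjv (s y) \<and> C *v u y = cnjv (u y)"
proof -
  have "CARD('N) = CARD('d option option)"
    using N by (simp add: card_UNIV_option)
  \<comment> \<open>\<open>None\<close> stands for \<open>s\<close>, \<open>Some None\<close> for \<open>u\<close> and \<open>Some (Some k)\<close> for the \<open>k\<close>-th
    derivative of \<open>s\<close>; the bijection makes the frame a square matrix.\<close>
  then obtain b :: "'N \<Rightarrow> 'd option option" where b: "bij b"
    using finite_same_card_bij[of "UNIV :: 'N set" "UNIV :: 'd option option set"] by auto
  define E where "E = (\<lambda>i y. case i of None \<Rightarrow> s y | Some None \<Rightarrow> u y | Some (Some k) \<Rightarrow> pd s k y)"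
  define E' where "E' = (\<lambda>i y. frechet_derivative (E i) (at y))"
  have Es: "smooth_on S (E i)" for i
    using s u smooth_on_frechet_derivative[OF s]
    by (cases i; cases "the i") (auto simp: E_def pd_def)
  have D: "(E i has_derivative E' i y) (at y)" if "y \<in> S" for i y
    using smooth_on_differentiable[OF Es that] by (simp add: E'_def flip: frechet_derivative_works)
  have sds: "cbil (s y) (pd s k y) = 0" if "y \<in> S" for y k
    using cbil_derivative_const[OF D[OF that, of None] D[OF that, of None] S(1) that, of "-1"
        "axis k 1"] ss
    by (auto simp: E_def E'_def pd_def cbil_commute)
  have gram: "cbil (E i y) (E j y) \<in> \<real>" if y: "y \<in> S" for i j y
    using ss[OF y] us[OF y] uu[OF y] uds[OF y] metric[OF y] sds[OF y]
    by (cases i; cases "the i"; cases j; cases "the j") (auto simp: E_def cbil_commute)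
  define \<Gamma> where "\<Gamma> = (\<lambda>y k j l. cbil (pd (pd s j) k y) (pd s l y))"
  have christoffel: "\<Gamma> y k j l \<in> \<real>" if y: "y \<in> S" for y k j l
  proof -
    have "\<Gamma> y k j l + \<Gamma> y k l j \<in> \<real>" for k j l
    proof -
      note d = D[OF y, of "Some (Some j)"] D[OF y, of "Some (Some l)"]
      have "((\<lambda>y. cbil (pd s j y) (pd s l y)) has_derivative
          (\<lambda>v. cbil (E (Some (Some j)) y) (E' (Some (Some l)) y v)
             + cbil (E' (Some (Some j)) y v) (E (Some (Some l)) y))) (at y)"
        using bounded_bilinear.FDERIV[OF bounded_bilinear_cbil d] by (simp add: E_def)
      from has_derivative_real_valued[OF this S(1) y metric, of "axis k 1"]
      show ?thesis
        by (simp add: \<Gamma>_def E_def E'_def pd_def cbil_commute add.commute)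
    qed
    then have alt: "Im (\<Gamma> y k j l) = - Im (\<Gamma> y k l j)" for k j l
      by (simp add: complex_is_Real_iff eq_neg_iff_add_eq_0)
    have "Ck_on 2 S s" using s by (simp add: smooth_on_def)
    then have "\<Gamma> y k j l = \<Gamma> y j k l" for k j l
      using mixed_partials_commute[OF S(1) y, of s] by (simp add: \<Gamma>_def pd_def)
    then have "Im (\<Gamma> y k j l) = Im (\<Gamma> y j k l)" for k j l by metis
    from alternating_symmetric_zero[of "\<lambda>k j l. Im (\<Gamma> y k j l)", OF alt this]
    show ?thesis by (simp add: complex_is_Real_iff)
  qed
  have par: "cbil (E' i y v) (E j y) \<in> \<real>" if y: "y \<in> S" and "v \<in> Basis" for i j y v
  proof -
    obtain k where v: "v = axis k 1"
      using \<open>v \<in> Basis\<close> by (auto simp: Basis_vec_def)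
    have c: "cbil (E i y) (E' j y v) + cbil (E' i y v) (E j y) = 0"
      if "\<And>y. y \<in> S \<Longrightarrow> cbil (E i y) (E j y) = c" for i j c
      by (rule cbil_derivative_const[OF D[OF y] D[OF y] S(1) y that])
    have E'0: "E' None y v = pd s k y" "E' (Some None) y v = pd u k y"
      "E' (Some (Some l)) y v = pd (pd s l) k y" for l
      by (simp_all add: E'_def E_def pd_def v)
    have us': "cbil (pd u k y) (s y) = 0"
      using c[of "Some None" None 0] us uds[OF y] by (simp add: E'0 E_def)
    have uu': "cbil (pd u k y) (u y) = 0"
      using c[of "Some None" "Some None" "of_real \<epsilon>"] uu by (simp add: E'0 E_def cbil_commute)
    have dds_s: "cbil (pd (pd s l) k y) (s y) = - cbil (pd s l y) (pd s k y)" for l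
      using c[of "Some (Some l)" None 0] sds
      by (simp add: E'0 E_def cbil_commute eq_neg_iff_add_eq_0 add.commute)
    have dds_u: "cbil (pd (pd s l) k y) (u y) = - cbil (pd u k y) (pd s l y)" for l
      using c[of "Some (Some l)" "Some None" 0] uds
      by (simp add: E'0 E_def cbil_commute eq_neg_iff_add_eq_0 add.commute)
    show ?thesis
      using us' uu' dds_s dds_u sds[OF y] uds[OF y] metric[OF y] shape[OF y] christoffel[OF y]
      by (cases i; cases "the i"; cases j; cases "the j")
        (auto simp: E'0 E_def \<Gamma>_def cbil_commute)
  qed
  have ndE: "v = 0" if y: "y \<in> S" and "\<And>a. cbil (E (b a) y) v = 0" for y v
  proof -
    have "cbil (E i y) v = 0" for i
      using that(2) b by (metis bij_pointE)
    from this[of None] this[of "Some None"] this[of "Some (Some _)"]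
    show ?thesis by (intro nd[OF y]) (auto simp: E_def)
  qed
  have "\<exists>C. \<forall>y\<in>S. \<forall>a. C *v E (b a) y = cnjv (E (b a) y)"
    by (rule parallel_real_frame[OF S, where E = "\<lambda>a. E (b a)" and E' = "\<lambda>a. E' (b a)"])
      (use D gram par ndE in auto)
  then obtain C where "\<And>y a. y \<in> S \<Longrightarrow> C *v E (b a) y = cnjv (E (b a) y)" by blast
  then have "C *v E i y = cnjv (E i y)" if "y \<in> S" for i y
    using b that by (metis bij_pointE)
  from this[of _ None] this[of _ "Some None"] show ?thesis
    by (intro exI[of _ C]) (auto simp: E_def)
qed

section \<open>Smooth functions and tangent vectors in charts\<close>

text \<open>The topological half of a smooth atlas. It carries the calculus of germs and derivations,
and it passes to the covering manifold chart by chart.\<close>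

definition open_charts :: "('m::topological_space, 'd::finite) atlas \<Rightarrow> bool" where
  "open_charts A \<longleftrightarrow> (\<forall>(C, \<phi>) \<in> A. open_in A C \<and> inj_on \<phi> C \<and> continuous_on C \<phi> \<and>
     (\<forall>W. open_in A W \<longrightarrow> open (\<phi> ` (C \<inter> W))))"

lemma open_chartsD:
  assumes "open_charts A" "(C, \<phi>) \<in> A"
  shows "open_in A C" "inj_on \<phi> C" "continuous_on C \<phi>" "open_in A W \<Longrightarrow> open (\<phi> ` (C \<inter> W))"
    "open (\<phi> ` C)"
proof -
  show *: "open_in A C" "inj_on \<phi> C" "continuous_on C \<phi>" and **: "open_in A W \<Longrightarrow> open (\<phi> ` (C \<inter> W))"
      for W
    using assms by (auto simp: open_charts_def)
  show "open (\<phi> ` C)" using **[OF *(1)] by simp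
qed

lemma smooth_atlas_open_charts:
  assumes "smooth_atlas A"
  shows "open_charts A"
  unfolding open_charts_def
proof safe
  fix C \<phi> assume "(C, \<phi>) \<in> A"
  then have C: "open_in A C" "open (\<phi> ` C)" and h: "homeomorphism C (\<phi> ` C) \<phi> (inv_into C \<phi>)"
    using assms by (auto simp: smooth_atlas_def)
  show "open_in A C" by (rule C)
  show "inj_on \<phi> C" using h by (metis homeomorphism_def inj_on_inverseI)
  show "continuous_on C \<phi>" using h by (simp add: homeomorphism_def)
  fix W assume W: "open_in A W"
  have "openin (top_of_set C) (C \<inter> W)"
    using W C(1) openin_imp_subset unfolding open_in_def
    by (metis openin_Int openin_open_trans openin_subset_trans inf.cobounded1 openin_subtopology_Int
        openin_subset topspace_euclidean_subtopology)
  then have "openin (top_of_set (\<phi> ` C)) (\<phi> ` (C \<inter> W))"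
    by (rule homeomorphism_imp_open_map[OF h])
  then show "open (\<phi> ` (C \<inter> W))"
    using C(2) by (rule openin_open_trans)
qed

lemma open_in_Int: "open_in A W \<Longrightarrow> open_in A W' \<Longrightarrow> open_in A (W \<inter> W')"
  by (simp add: open_in_def openin_Int)

lemma smooth_map_on_subset: "smooth_map_on A W f \<Longrightarrow> V \<subseteq> W \<Longrightarrow> smooth_map_on A V f"
  unfolding smooth_map_on_def
  by (clarify, rule smooth_on_subset[where S = "_ ` (_ \<inter> W)"]) auto

lemma smooth_map_on_bounded_linear:
  assumes "open_charts A" "open_in A W" "smooth_map_on A W f" and L: "bounded_linear L"
  shows "smooth_map_on A W (\<lambda>x. L (f x))"
  unfolding smooth_map_on_def smooth_on_def
proof safe
  fix C \<phi> k assume c: "(C, \<phi>) \<in> A"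
  have "Ck_on k (\<phi> ` (C \<inter> W)) (f \<circ> inv_into C \<phi>)"
    using assms(3) c by (auto simp: smooth_map_on_def smooth_on_def)
  then have "Ck_on k (\<phi> ` (C \<inter> W)) (\<lambda>x. L ((f \<circ> inv_into C \<phi>) x))"
    by (rule Ck_on_bounded_linear[OF open_chartsD(4)[OF assms(1) c assms(2)] L])
  then show "Ck_on k (\<phi> ` (C \<inter> W)) ((\<lambda>x. L (f x)) \<circ> inv_into C \<phi>)" by (simp add: o_def)
qed

lemma smooth_near_bounded_linear:
  "open_charts A \<Longrightarrow> smooth_near A p f \<Longrightarrow> bounded_linear L \<Longrightarrow> smooth_near A p (\<lambda>x. L (f x))"
  unfolding smooth_near_def using smooth_map_on_bounded_linear by blast

lemma smooth_near_add:
  assumes A: "open_charts A" and f: "smooth_near A p f" and h: "smooth_near A p h"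
  shows "smooth_near A p (\<lambda>x. f x + h x)"
proof -
  obtain W where W: "open_in A W" "p \<in> W" "smooth_map_on A W f"
    using f by (auto simp: smooth_near_def)
  obtain V where V: "open_in A V" "p \<in> V" "smooth_map_on A V h"
    using h by (auto simp: smooth_near_def)
  have "smooth_map_on A (W \<inter> V) (\<lambda>x. f x + h x)"
    unfolding smooth_map_on_def smooth_on_def
  proof safe
    fix C \<phi> k assume c: "(C, \<phi>) \<in> A"
    note o = open_chartsD(4)[OF A c open_in_Int[OF W(1) V(1)]]
    have "Ck_on k (\<phi> ` (C \<inter> (W \<inter> V))) (f \<circ> inv_into C \<phi>)"
      "Ck_on k (\<phi> ` (C \<inter> (W \<inter> V))) (h \<circ> inv_into C \<phi>)"
      using smooth_map_on_subset[OF W(3), of "W \<inter> V"] smooth_map_on_subset[OF V(3), of "W \<inter> V"] c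
      by (auto simp: smooth_map_on_def smooth_on_def)
    then have "Ck_on k (\<phi> ` (C \<inter> (W \<inter> V))) (\<lambda>x. (f \<circ> inv_into C \<phi>) x + (h \<circ> inv_into C \<phi>) x)"
      by (rule Ck_on_add[OF o])
    then show "Ck_on k (\<phi> ` (C \<inter> (W \<inter> V))) ((\<lambda>x. f x + h x) \<circ> inv_into C \<phi>)"
      by (simp add: o_def)
  qed
  then show ?thesis
    unfolding smooth_near_def using open_in_Int[OF W(1) V(1)] W(2) V(2) by blast
qed

lemma smooth_near_mult:
  fixes f h :: "'m::topological_space \<Rightarrow> complex"
  assumes A: "open_charts A" and f: "smooth_near A p f" and h: "smooth_near A p h"
  shows "smooth_near A p (\<lambda>x. f x * h x)"
proof -
  obtain W where W: "open_in A W" "p \<in> W" "smooth_map_on A W f"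
    using f by (auto simp: smooth_near_def)
  obtain V where V: "open_in A V" "p \<in> V" "smooth_map_on A V h"
    using h by (auto simp: smooth_near_def)
  have "smooth_map_on A (W \<inter> V) (\<lambda>x. f x * h x)"
    unfolding smooth_map_on_def smooth_on_def
  proof safe
    fix C \<phi> k assume c: "(C, \<phi>) \<in> A"
    note o = open_chartsD(4)[OF A c open_in_Int[OF W(1) V(1)]]
    have "Ck_on k (\<phi> ` (C \<inter> (W \<inter> V))) (f \<circ> inv_into C \<phi>)"
      "Ck_on k (\<phi> ` (C \<inter> (W \<inter> V))) (h \<circ> inv_into C \<phi>)"
      using smooth_map_on_subset[OF W(3), of "W \<inter> V"] smooth_map_on_subset[OF V(3), of "W \<inter> V"] c
      by (auto simp: smooth_map_on_def smooth_on_def)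
    then have "Ck_on k (\<phi> ` (C \<inter> (W \<inter> V))) (\<lambda>x. (f \<circ> inv_into C \<phi>) x * (h \<circ> inv_into C \<phi>) x)"
      by (rule Ck_on_bilinear[OF o bounded_bilinear_mult])
    then show "Ck_on k (\<phi> ` (C \<inter> (W \<inter> V))) ((\<lambda>x. f x * h x) \<circ> inv_into C \<phi>)"
      by (simp add: o_def)
  qed
  then show ?thesis
    unfolding smooth_near_def using open_in_Int[OF W(1) V(1)] W(2) V(2) by blast
qed

lemma Ck_on_const: "Ck_on k S (\<lambda>x. c)"
  by (induction k arbitrary: c) auto

lemma smooth_near_const: "p \<in> points A \<Longrightarrow> smooth_near A p (\<lambda>x. c)"
  unfolding smooth_near_def
  by (rule exI[of _ "points A"]) (auto simp: open_in_def smooth_map_on_def smooth_on_def o_def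
      Ck_on_const)

lemma smooth_near_chart:
  assumes A: "open_charts A" and c: "(C, \<phi>) \<in> A" "p \<in> C" and f: "smooth_near A p f"
  shows "\<exists>S. open S \<and> \<phi> p \<in> S \<and> S \<subseteq> \<phi> ` C \<and> smooth_on S (f \<circ> inv_into C \<phi>)"
    and "(f \<circ> inv_into C \<phi> has_derivative frechet_derivative (f \<circ> inv_into C \<phi>) (at (\<phi> p))) (at (\<phi>
        p))"
proof -
  obtain W where W: "open_in A W" "p \<in> W" "smooth_map_on A W f"
    using f by (auto simp: smooth_near_def)
  have "open (\<phi> ` (C \<inter> W))" "\<phi> p \<in> \<phi> ` (C \<inter> W)" and s: "smooth_on (\<phi> ` (C \<inter> W)) (f \<circ> inv_into C \<phi>)"
    using open_chartsD(4)[OF A c(1) W(1)] W c by (auto simp: smooth_map_on_def)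
  then show "\<exists>S. open S \<and> \<phi> p \<in> S \<and> S \<subseteq> \<phi> ` C \<and> smooth_on S (f \<circ> inv_into C \<phi>)" by blast
  show "(f \<circ> inv_into C \<phi> has_derivative frechet_derivative (f \<circ> inv_into C \<phi>) (at (\<phi> p))) (at (\<phi>
      p))"
    using smooth_on_differentiable[OF s] c W by (simp flip: frechet_derivative_works)
qed

text \<open>The partial derivative in direction \<open>k\<close> of a chart, cut off to \<open>0\<close> on functions that are
not smooth near the point, as tangent vectors are required to be.\<close>

definition coord_vec ::
  "('m::topological_space, 'd::finite) atlas \<Rightarrow> 'm set \<Rightarrow> ('m \<Rightarrow> real^'d) \<Rightarrow> 'd \<Rightarrow> 'm \<Rightarrow> 'm cvec" where
  "coord_vec A C \<phi> k p = (\<lambda>f. if smooth_near A p f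
     then frechet_derivative (f \<circ> inv_into C \<phi>) (at (\<phi> p)) (axis k 1) else 0)"

lemma coord_vec_in_rtangent:
  assumes A: "open_charts A" and c: "(C, \<phi>) \<in> A" "p \<in> C"
  shows "coord_vec A C \<phi> k p \<in> rtangent A p"
proof -
  let ?D = "\<lambda>f. frechet_derivative (f \<circ> inv_into C \<phi>) (at (\<phi> p))"
  have D: "(f \<circ> inv_into C \<phi> has_derivative ?D f) (at (\<phi> p))" if "smooth_near A p f" for f ::
      "'a \<Rightarrow> complex"
    using smooth_near_chart(2)[OF A c that] .
  have inv: "inv_into C \<phi> (\<phi> p) = p"
    using open_chartsD(2)[OF A c(1)] c(2) by simp
  have add: "?D (\<lambda>x. f x + h x) v = ?D f v + ?D h v" if "smooth_near A p f" "smooth_near A p h"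
    for f h :: "'a \<Rightarrow> complex" and v
    using has_derivative_add[OF D[OF that(1)] D[OF that(2)]]
    by (simp add: has_derivative_iff_frechet o_def)
  have mult: "?D (\<lambda>x. f x * h x) v = ?D f v * h p + f p * ?D h v"
    if "smooth_near A p f" "smooth_near A p h" for f h :: "'a \<Rightarrow> complex" and v
    using has_derivative_mult[OF D[OF that(1)] D[OF that(2)]]
    by (simp add: has_derivative_iff_frechet o_def inv)
  have scale: "?D (\<lambda>x. z * f x) v = z * ?D f v"
    if "smooth_near A p f" for f :: "'a \<Rightarrow> complex" and v z
    using has_derivative_mult_right[OF D[OF that], of z]
    by (simp add: has_derivative_iff_frechet o_def)
  have loc: "?D f = ?D h" if "smooth_near A p f" "open_in A W" "p \<in> W" "\<forall>x\<in>W. f x = h x"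
    for f h :: "'a \<Rightarrow> complex" and W
  proof -
    have "(h \<circ> inv_into C \<phi> has_derivative ?D f) (at (\<phi> p))"
      by (rule has_derivative_transform_within_open[OF D[OF that(1)], of "\<phi> ` (C \<inter> W)"])
        (use that c open_chartsD[OF A c(1)] in auto)
    then show ?thesis by (simp add: has_derivative_iff_frechet)
  qed
  have real: "?D f v \<in> \<real>" if "smooth_near A p f" "\<forall>x. f x \<in> \<real>" for f :: "'a \<Rightarrow> complex" and v
    by (rule has_derivative_real_valued[OF D[OF that(1)] open_UNIV]) (use that in auto)
  have "coord_vec A C \<phi> k p \<in> ctangent A p"
    unfolding ctangent_def mem_Collect_eq
  proof (intro conjI allI impI)
    fix f :: "'a \<Rightarrow> complex" assume "\<not> smooth_near A p f"
    then show "coord_vec A C \<phi> k p f = 0" by (simp add: coord_vec_def)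
  next
    fix f h :: "'a \<Rightarrow> complex" assume s: "smooth_near A p f \<and> smooth_near A p h"
    then show "coord_vec A C \<phi> k p (\<lambda>x. f x + h x) = coord_vec A C \<phi> k p f + coord_vec A C \<phi> k p h"
      using smooth_near_add[OF A, of p f h] add by (simp add: coord_vec_def)
    show "coord_vec A C \<phi> k p (\<lambda>x. f x * h x) =
        coord_vec A C \<phi> k p f * h p + f p * coord_vec A C \<phi> k p h"
      using smooth_near_mult[OF A, of p f h] mult s by (simp add: coord_vec_def)
    assume "\<exists>W. open_in A W \<and> p \<in> W \<and> (\<forall>x\<in>W. f x = h x)"
    then have "?D f = ?D h" using loc s by blast
    then show "coord_vec A C \<phi> k p f = coord_vec A C \<phi> k p h"
      using s by (simp add: coord_vec_def)
  next
    fix z and f :: "'a \<Rightarrow> complex" assume "smooth_near A p f"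
    then show "coord_vec A C \<phi> k p (\<lambda>x. z * f x) = z * coord_vec A C \<phi> k p f"
      using smooth_near_bounded_linear[OF A _ bounded_linear_mult_right, of p f z] scale
      by (simp add: coord_vec_def)
  qed
  then show ?thesis
    unfolding rtangent_def using real by (auto simp: coord_vec_def)
qed

lemma coord_vec_coordinate:
  assumes A: "smooth_atlas A" and c: "(C, \<phi>) \<in> A" "p \<in> C"
  shows "coord_vec A C \<phi> k p (\<lambda>x. of_real (\<phi> x $ j)) = (if j = k then 1 else 0)"
proof -
  note oc = smooth_atlas_open_charts[OF A]
  have bl: "bounded_linear (\<lambda>y::real^'b. complex_of_real (y $ j))"
    by (rule bounded_linear_compose[OF bounded_linear_of_real bounded_linear_vec_nth])
  have "smooth_map_on A C \<phi>"
    using A c(1) unfolding smooth_map_on_def smooth_atlas_def by (fastforce simp: Int_commute)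
  then have "smooth_map_on A C (\<lambda>x. complex_of_real (\<phi> x $ j))"
    using smooth_map_on_bounded_linear[OF oc open_chartsD(1)[OF oc c(1)] _ bl, of \<phi>] by simp
  then have "smooth_near A p (\<lambda>x. complex_of_real (\<phi> x $ j))"
    unfolding smooth_near_def using c open_chartsD(1)[OF oc c(1)] by blast
  moreover have "((\<lambda>x. complex_of_real (\<phi> x $ j)) \<circ> inv_into C \<phi> has_derivative
      (\<lambda>y. complex_of_real (y $ j))) (at (\<phi> p))"
    by (rule has_derivative_transform_within_open[OF bounded_linear_imp_has_derivative[OF bl],
        of "\<phi> ` C"]) (use c open_chartsD[OF oc c(1)] in \<open>auto simp: f_inv_into_f\<close>)
  ultimately show ?thesis
    by (simp add: coord_vec_def has_derivative_iff_frechet axis_def)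
qed

definition cvec_sum :: "'i set \<Rightarrow> ('i \<Rightarrow> complex) \<Rightarrow> ('i \<Rightarrow> 'm cvec) \<Rightarrow> 'm cvec" where
  "cvec_sum I c X = (\<lambda>f. \<Sum>i\<in>I. c i * X i f)"

lemma cvec_sum_in_ctangent:
  fixes A :: "('m::topological_space, 'd::finite) atlas"
  assumes "\<And>i. i \<in> I \<Longrightarrow> X i \<in> ctangent A p"
  shows "cvec_sum I c X \<in> ctangent A p"
  unfolding ctangent_def mem_Collect_eq
proof (intro conjI allI impI)
  fix f :: "'m \<Rightarrow> complex" assume "\<not> smooth_near A p f"
  then show "cvec_sum I c X f = 0"
    using assms by (auto simp: cvec_sum_def ctangent_def intro!: sum.neutral)
next
  fix f h :: "'m \<Rightarrow> complex" assume s: "smooth_near A p f \<and> smooth_near A p h"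
  have x: "X i (\<lambda>x. f x + h x) = X i f + X i h" "X i (\<lambda>x. f x * h x) = X i f * h p + f p * X i h"
    if "i \<in> I" for i
    using assms[OF that] s by (auto simp: ctangent_def)
  show "cvec_sum I c X (\<lambda>x. f x + h x) = cvec_sum I c X f + cvec_sum I c X h"
    by (simp add: cvec_sum_def x algebra_simps sum.distrib)
  show "cvec_sum I c X (\<lambda>x. f x * h x) = cvec_sum I c X f * h p + f p * cvec_sum I c X h"
    by (simp add: cvec_sum_def x algebra_simps sum.distrib sum_distrib_left)
  assume w: "\<exists>W. open_in A W \<and> p \<in> W \<and> (\<forall>x\<in>W. f x = h x)"
  have "X i f = X i h" if "i \<in> I" for i
    using assms[OF that] s w unfolding ctangent_def by blast
  then show "cvec_sum I c X f = cvec_sum I c X h" by (simp add: cvec_sum_def)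
next
  fix z and f :: "'m \<Rightarrow> complex" assume s: "smooth_near A p f"
  have x: "X i (\<lambda>x. z * f x) = z * X i f" if "i \<in> I" for i
    using assms[OF that] s by (auto simp: ctangent_def)
  show "cvec_sum I c X (\<lambda>x. z * f x) = z * cvec_sum I c X f"
    by (simp add: cvec_sum_def x algebra_simps sum_distrib_left)
qed

lemma rtangent_subset: "X \<in> rtangent A p \<Longrightarrow> X \<in> ctangent A p"
  by (simp add: rtangent_def)

lemma ctangent_simps:
  assumes "X \<in> ctangent A p"
  shows "smooth_near A p f \<Longrightarrow> smooth_near A p h \<Longrightarrow> X (\<lambda>x. f x + h x) = X f + X h"
    "smooth_near A p f \<Longrightarrow> X (\<lambda>x. c * f x) = c * X f"
  using assms by (auto simp: ctangent_def)

lemma ctangent_mult: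
  assumes "X \<in> ctangent A p" "smooth_near A p f" "smooth_near A p h"
  shows "X (\<lambda>x. f x * h x) = X f * h p + f p * X h"
  using assms by (auto simp: ctangent_def)

lemma ctangent_local:
  assumes "X \<in> ctangent A p" "smooth_near A p f" "smooth_near A p h"
    "open_in A W" "p \<in> W" "\<And>x. x \<in> W \<Longrightarrow> f x = h x"
  shows "X f = X h"
  using assms unfolding ctangent_def by blast

lemma ctangent_sum:
  assumes A: "open_charts A" and p: "p \<in> points A" and X: "X \<in> ctangent A p"
    and f: "\<And>i. smooth_near A p (f i)"
  shows "smooth_near A p (\<lambda>x. \<Sum>i\<in>I. c i * f i x) \<and>
    X (\<lambda>x. \<Sum>i\<in>I. c i * f i x) = (\<Sum>i\<in>I. c i * X (f i))"
proof -
  have c: "smooth_near A p (\<lambda>x. z * f i x)" for z i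
    by (rule smooth_near_bounded_linear[OF A f bounded_linear_mult_right])
  have 0: "X (\<lambda>x. 0) = 0"
    using ctangent_simps(2)[OF X smooth_near_const[OF p, of 0], of 0] by simp
  show ?thesis
    by (induction I rule: infinite_finite_induct)
      (auto simp: smooth_near_const[OF p] 0 c smooth_near_add[OF A] ctangent_simps[OF X] f)
qed

lemma cdiff_matrix:
  assumes A: "open_charts A" and p: "p \<in> points A" and X: "X \<in> ctangent A p"
    and F: "smooth_near A p F"
  shows "cdiff (\<lambda>x. M *v F x) X = (M :: complex^'N^'N) *v cdiff F X"
proof -
  have "smooth_near A p (\<lambda>x. F x $ i)" for i
    by (rule smooth_near_bounded_linear[OF A F bounded_linear_vec_nth])
  then have "X (\<lambda>x. \<Sum>j\<in>UNIV. M $ i $ j * F x $ j) = (\<Sum>j\<in>UNIV. M $ i $ j * X (\<lambda>x. F x $ j))" for i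
    using ctangent_sum[OF A p X, where f = "\<lambda>j x. F x $ j" and I = UNIV and c = "\<lambda>j. M $ i $ j"]
        by blast
  then show ?thesis
    by (simp add: cdiff_def matrix_vector_mult_def vec_eq_iff)
qed

lemma cdiff_cvec_sum:
  fixes F :: "'m \<Rightarrow> complex^'N"
  shows "cdiff F (cvec_sum I c X) = (\<Sum>i\<in>I. c i *s cdiff F (X i))"
  by (simp add: cdiff_def cvec_sum_def vec_eq_iff)

lemma cdiff_coord_vec:
  fixes F :: "'m::topological_space \<Rightarrow> complex^'N"
  assumes A: "open_charts A" and c: "(C, \<phi>) \<in> A" "p \<in> C" and F: "smooth_near A p F"
  shows "cdiff F (coord_vec A C \<phi> k p) = frechet_derivative (F \<circ> inv_into C \<phi>) (at (\<phi> p)) (axis k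
      1)"
proof -
  have "coord_vec A C \<phi> k p (\<lambda>x. F x $ i) = frechet_derivative (F \<circ> inv_into C \<phi>) (at (\<phi> p)) (axis
      k 1) $ i"
    for i
  proof -
    have "smooth_near A p (\<lambda>x. F x $ i)"
      by (rule smooth_near_bounded_linear[OF A F bounded_linear_vec_nth])
    moreover have "((\<lambda>x. F x $ i) \<circ> inv_into C \<phi> has_derivative
       (\<lambda>v. frechet_derivative (F \<circ> inv_into C \<phi>) (at (\<phi> p)) v $ i)) (at (\<phi> p))"
      using bounded_linear.has_derivative[OF bounded_linear_vec_nth smooth_near_chart(2)[OF A c F]]
      by (simp add: o_def)
    ultimately show ?thesis
      by (simp add: coord_vec_def has_derivative_iff_frechet)
  qed
  then show ?thesis by (simp add: cdiff_def vec_eq_iff)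
qed

text \<open>The coordinate vectors are linearly independent, by evaluation on the coordinate
functions, and there are \<open>m\<close> of them in a space spanned by \<open>m\<close> vectors. So the matrix that
expresses them by the spanning vectors is invertible.\<close>

lemma rtangent_coord_span:
  fixes e :: "nat \<Rightarrow> 'm::topological_space cvec" and A :: "('m, 'd::finite) atlas"
  assumes A: "smooth_atlas A" and c: "(C, \<phi>) \<in> A" "p \<in> C" and d: "CARD('d) = m"
    and span: "\<forall>X \<in> rtangent A p. \<exists>c :: nat \<Rightarrow> real. X = (\<lambda>f. \<Sum>i < m. of_real (c i) * e i f)"
  shows "\<exists>\<beta>. \<forall>i<m. e i = cvec_sum UNIV (\<lambda>k. of_real (\<beta> i k)) (\<lambda>k. coord_vec A C \<phi> k p)"
    and "X \<in> rtangent A p \<Longrightarrow>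
      \<exists>\<gamma>. X = cvec_sum UNIV (\<lambda>k. of_real (\<gamma> k)) (\<lambda>k. coord_vec A C \<phi> k p)"
proof -
  let ?cv = "\<lambda>k. coord_vec A C \<phi> k p"
  obtain b :: "'d \<Rightarrow> nat" where b: "bij_betw b UNIV {..<m}"
    using finite_same_card_bij[of "UNIV :: 'd set" "{..<m}"] d by auto
  have "\<forall>k. \<exists>c :: nat \<Rightarrow> real. ?cv k = (\<lambda>f. \<Sum>i < m. of_real (c i) * e i f)"
    using span coord_vec_in_rtangent[OF smooth_atlas_open_charts[OF A] c] by blast
  then obtain a :: "'d \<Rightarrow> nat \<Rightarrow> real" where a: "\<And>k. ?cv k = (\<lambda>f. \<Sum>i < m. of_real (a k i) * e i f)"
    by metis
  have a': "?cv k f = (\<Sum>l\<in>UNIV. of_real (a k (b l)) * e (b l) f)" for k f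
    by (simp add: a sum.reindex_bij_betw[OF b, symmetric])
  define M where "M = (\<chi> l k. a k (b l))"
  have "v = 0" if "M *v v = 0" for v
  proof -
    have "v $ j = 0" for j
    proof -
      let ?f = "\<lambda>x. complex_of_real (\<phi> x $ j)"
      have "(\<Sum>k\<in>UNIV. of_real (v $ k) * ?cv k ?f)
          = (\<Sum>l\<in>UNIV. of_real (\<Sum>k\<in>UNIV. a k (b l) * v $ k) * e (b l) ?f)"
        by (simp add: a' sum_distrib_left sum_distrib_right mult_ac, subst sum.swap, simp add:
            mult_ac)
      also have "\<dots> = 0"
        using that by (simp add: M_def vec_eq_iff matrix_vector_mult_def)
      finally show ?thesis
        by (simp add: coord_vec_coordinate[OF A c] if_distrib cong: if_cong)
    qed
    then show ?thesis by (simp add: vec_eq_iff)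
  qed
  then have "invertible M"
    unfolding invertible_left_inverse matrix_left_invertible_ker by blast
  then obtain R where R: "M ** R = mat 1" unfolding invertible_def by blast
  have e: "e (b l) f = (\<Sum>k\<in>UNIV. of_real (R $ k $ l) * ?cv k f)" for l f
  proof -
    have "(\<Sum>k\<in>UNIV. of_real (R $ k $ l) * ?cv k f)
        = (\<Sum>l'\<in>UNIV. of_real ((M ** R) $ l' $ l) * e (b l') f)"
      by (simp add: a' M_def matrix_matrix_mult_def sum_distrib_left sum_distrib_right mult_ac,
          subst sum.swap, simp add: mult_ac)
    then show ?thesis by (simp add: R mat_def if_distrib if_distribR cong: if_cong)
  qed
  define \<beta> where "\<beta> = (\<lambda>i k. R $ k $ (inv_into UNIV b i))"
  have \<beta>: "e i = cvec_sum UNIV (\<lambda>k. of_real (\<beta> i k)) ?cv" if "i < m" for i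
  proof -
    have "b (inv_into UNIV b i) = i"
      using b that by (metis bij_betw_def f_inv_into_f lessThan_iff)
    then show ?thesis
      using e[of "inv_into UNIV b i"] by (auto simp: cvec_sum_def \<beta>_def)
  qed
  then show "\<exists>\<beta>. \<forall>i<m. e i = cvec_sum UNIV (\<lambda>k. of_real (\<beta> i k)) (\<lambda>k. coord_vec A C \<phi> k p)"
    by blast
  assume "X \<in> rtangent A p"
  then obtain \<gamma> :: "nat \<Rightarrow> real" where \<gamma>: "X = (\<lambda>f. \<Sum>i < m. of_real (\<gamma> i) * e i f)"
    using span by blast
  have "X f = (\<Sum>k\<in>UNIV. of_real (\<Sum>i<m. \<gamma> i * \<beta> i k) * ?cv k f)" for f
    by (simp add: \<gamma> \<beta> cvec_sum_def sum_distrib_left sum_distrib_right mult_ac, subst sum.swap, simp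
        add: mult_ac)
  then show "\<exists>\<gamma>. X = cvec_sum UNIV (\<lambda>k. of_real (\<gamma> k)) (\<lambda>k. coord_vec A C \<phi> k p)"
    unfolding cvec_sum_def by (intro exI[of _ "\<lambda>k. \<Sum>i<m. \<gamma> i * \<beta> i k"]) blast
qed

text \<open>The conjugate of \<open>X\<close> is the derivation that sends \<open>f\<close> to \<open>cnj (X (cnj f))\<close>; the two parts
are the usual real and imaginary part with respect to it.\<close>

lemma ctangent_decomp:
  assumes A: "open_charts A" and X: "X \<in> ctangent A p"
  shows "\<exists>X1 \<in> rtangent A p. \<exists>X2 \<in> rtangent A p. X = cvec_add X1 (cvec_scale \<i> X2)"
proof -
  define Y where "Y = (\<lambda>f. cnj (X (\<lambda>x. cnj (f x))))"
  have sm: "smooth_near A p (\<lambda>x. cnj (f x)) \<longleftrightarrow> smooth_near A p f" for f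
    using smooth_near_bounded_linear[OF A _ bounded_linear_cnj, of p f]
      smooth_near_bounded_linear[OF A _ bounded_linear_cnj, of p "\<lambda>x. cnj (f x)"] by auto
  have Xp: "X (\<lambda>x. f x * h x) = X f * h p + f p * X h" "X (\<lambda>x. f x + h x) = X f + X h"
    "X (\<lambda>x. z * f x) = z * X f"
    if "smooth_near A p f" "smooth_near A p h" for f h z
    using X that by (auto simp: ctangent_def)
  have Xl: "X f = X h" if "smooth_near A p f" "smooth_near A p h"
    "open_in A W" "p \<in> W" "\<forall>x\<in>W. f x = h x" for f h W
    using X that unfolding ctangent_def by blast
  have Y: "Y \<in> ctangent A p"
    unfolding ctangent_def mem_Collect_eq
  proof (intro conjI allI impI)
    fix f :: "'a \<Rightarrow> complex" assume "\<not> smooth_near A p f"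
    then show "Y f = 0"
      using X sm[of f] by (auto simp: Y_def ctangent_def)
  next
    fix f h :: "'a \<Rightarrow> complex" assume s: "smooth_near A p f \<and> smooth_near A p h"
    then have s': "smooth_near A p (\<lambda>x. cnj (f x))" "smooth_near A p (\<lambda>x. cnj (h x))"
      by (simp_all add: sm)
    show "Y (\<lambda>x. f x + h x) = Y f + Y h" "Y (\<lambda>x. f x * h x) = Y f * h p + f p * Y h"
      using Xp[OF s'] by (simp_all add: Y_def)
    assume "\<exists>W. open_in A W \<and> p \<in> W \<and> (\<forall>x\<in>W. f x = h x)"
    then show "Y f = Y h" using Xl[OF s'] unfolding Y_def by metis
  next
    fix z and f :: "'a \<Rightarrow> complex" assume "smooth_near A p f"
    then show "Y (\<lambda>x. z * f x) = z * Y f"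
      using Xp(3)[of "\<lambda>x. cnj (f x)"] by (simp add: Y_def sm)
  qed
  define X1 where "X1 = cvec_sum {True, False} (\<lambda>b. 1/2) (\<lambda>b. if b then X else Y)"
  define X2 where "X2 = cvec_sum {True, False} (\<lambda>b. if b then -\<i>/2 else \<i>/2) (\<lambda>b.
      if b then X else Y)"
  have "X1 \<in> ctangent A p" "X2 \<in> ctangent A p"
    unfolding X1_def X2_def by (rule cvec_sum_in_ctangent; use X Y in auto)+
  moreover have "X1 f \<in> \<real>" "X2 f \<in> \<real>" if "\<forall>x. f x \<in> \<real>" for f
    using that by (simp_all add: X1_def X2_def cvec_sum_def Y_def Reals_cnj_iff)
  moreover have "X = cvec_add X1 (cvec_scale \<i> X2)"
    by (auto simp: X1_def X2_def cvec_sum_def cvec_add_def cvec_scale_def algebra_simps)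
  ultimately show ?thesis unfolding rtangent_def by blast
qed

section \<open>The covering manifold\<close>

locale covered_manifold =
  fixes A :: "('m::topological_space, 'd::finite) atlas"
    and U :: "'u::topological_space set" and \<pi> :: "'u \<Rightarrow> 'm"
  assumes A: "smooth_atlas A" and cov: "covering_space U \<pi> (points A)"
begin

abbreviation "B \<equiv> pullback_atlas U \<pi> A"

lemma open_charts_base: "open_charts A"
  by (rule smooth_atlas_open_charts[OF A])

lemma pi_in: "x \<in> U \<Longrightarrow> \<pi> x \<in> points A"
  using covering_space_imp_surjective[OF cov] by blast

lemma preimage_open:
  assumes "open_in A W"
  shows "openin (top_of_set U) (U \<inter> \<pi> -` W)"
  by (rule continuous_openin_preimage[OF covering_space_imp_continuous[OF cov]])
    (use assms pi_in in \<open>auto simp: open_in_def\<close>)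

lemma chart_exists:
  assumes x: "x \<in> U" and c: "(C, \<phi>) \<in> A" "\<pi> x \<in> C"
  shows "\<exists>V. x \<in> V \<and> openin (top_of_set U) V \<and> inj_on \<pi> V \<and> \<pi> ` V \<subseteq> C"
proof -
  obtain T u q where T: "x \<in> T" "openin (top_of_set U) T" and h: "homeomorphism T u \<pi> q"
    using covering_space_local_homeomorphism[OF cov x] by metis
  have "inj_on \<pi> T"
    using h by (metis homeomorphism_def inj_on_inverseI)
  moreover have "openin (top_of_set U) (T \<inter> (U \<inter> \<pi> -` C))"
    using T preimage_open[OF open_chartsD(1)[OF open_charts_base c(1)]] by (simp add: openin_Int)
  ultimately show ?thesis
    using T x c by (intro exI[of _ "T \<inter> (U \<inter> \<pi> -` C)"]) (auto intro: inj_on_subset)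
qed

lemma pullback_chart:
  "(V, \<psi>) \<in> B \<longleftrightarrow>
     (\<exists>C \<phi>. \<psi> = \<phi> \<circ> \<pi> \<and> (C, \<phi>) \<in> A \<and> openin (top_of_set U) V \<and> inj_on \<pi> V \<and> \<pi> ` V \<subseteq> C)"
  by (auto simp: pullback_atlas_def)

lemma points_B [simp]: "points B = U"
proof
  show "points B \<subseteq> U"
  proof
    fix x assume "x \<in> points B"
    then obtain V \<psi> where "(V, \<psi>) \<in> B" "x \<in> V" by (auto simp: points_def)
    then have "openin (top_of_set U) V" unfolding pullback_chart by blast
    from openin_imp_subset[OF this] \<open>x \<in> V\<close> show "x \<in> U" by blast
  qed
  show "U \<subseteq> points B"
  proof
    fix x assume x: "x \<in> U"
    then obtain C \<phi> where c: "(C, \<phi>) \<in> A" "\<pi> x \<in> C"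
      using pi_in[OF x] by (force simp: points_def)
    obtain V where V: "x \<in> V" "openin (top_of_set U) V" "inj_on \<pi> V" "\<pi> ` V \<subseteq> C"
      using chart_exists[OF x c] by blast
    then have "(V, \<phi> \<circ> \<pi>) \<in> B" using c(1) unfolding pullback_chart by blast
    then show "x \<in> points B"
      unfolding points_def by (rule UN_I) (simp add: V)
  qed
qed

lemma open_in_B: "open_in B W \<longleftrightarrow> openin (top_of_set U) W"
  by (simp add: open_in_def)

lemma image_open: "openin (top_of_set U) W \<Longrightarrow> open_in A (\<pi> ` W)"
  unfolding open_in_def
proof (subst openin_subopen, safe)
  fix x assume W: "openin (top_of_set U) W" and x: "x \<in> W"
  have xU: "x \<in> U" using openin_imp_subset[OF W] x by blast
  obtain T u q where T: "x \<in> T" "openin (top_of_set U) T" and u: "openin (top_of_set (points A)) u"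
    and h: "homeomorphism T u \<pi> q"
    using covering_space_local_homeomorphism[OF cov xU] by metis
  have "openin (top_of_set T) (T \<inter> W)"
  proof -
    obtain G where "open G" "W = U \<inter> G" using W by (auto simp: openin_open)
    then have "T \<inter> W = T \<inter> G" using openin_imp_subset[OF T(2)] by blast
    then show ?thesis using \<open>open G\<close> by (auto simp: openin_open)
  qed
  then have "openin (top_of_set u) (\<pi> ` (T \<inter> W))"
    by (rule homeomorphism_imp_open_map[OF h])
  then have "openin (top_of_set (points A)) (\<pi> ` (T \<inter> W))"
    using u openin_trans by blast
  then show "\<exists>V. openin (top_of_set (points A)) V \<and> \<pi> x \<in> V \<and> V \<subseteq> \<pi> ` W"
    using T(1) x by (intro exI[of _ "\<pi> ` (T \<inter> W)"]) auto
qed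

lemma open_charts_cover: "open_charts B"
  unfolding open_charts_def
proof safe
  fix V \<psi> assume "(V, \<psi>) \<in> B"
  then obtain C \<phi> where \<psi>: "\<psi> = \<phi> \<circ> \<pi>" and c: "(C, \<phi>) \<in> A"
    and V: "openin (top_of_set U) V" "inj_on \<pi> V" "\<pi> ` V \<subseteq> C"
    unfolding pullback_chart by blast
  show "open_in B V" using V by (simp add: open_in_B)
  show "inj_on \<psi> V"
    unfolding \<psi> by (rule comp_inj_on[OF V(2) inj_on_subset[OF open_chartsD(2)[OF open_charts_base
        c] V(3)]])
  have "continuous_on V \<pi>"
    using covering_space_imp_continuous[OF cov] openin_imp_subset[OF V(1)] continuous_on_subset
        by blast
  then show "continuous_on V \<psi>"
    unfolding \<psi> using continuous_on_subset[OF open_chartsD(3)[OF open_charts_base c] V(3)]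
    by (rule continuous_on_compose)
  fix W assume "open_in B W"
  then have "open_in A (\<pi> ` (V \<inter> W))"
    using V by (intro image_open) (simp add: open_in_B openin_Int)
  from open_chartsD(4)[OF open_charts_base c this] have "open (\<phi> ` (C \<inter> \<pi> ` (V \<inter> W)))" .
  moreover have "C \<inter> \<pi> ` (V \<inter> W) = \<pi> ` (V \<inter> W)" using V(3) by blast
  ultimately show "open (\<psi> ` (V \<inter> W))" by (simp add: \<psi> image_comp)
qed

lemma pi_inv_chart:
  assumes c: "(C, \<phi>) \<in> A" and V: "inj_on \<pi> V" "\<pi> ` V \<subseteq> C" and y: "y \<in> (\<phi> \<circ> \<pi>) ` V"
  shows "\<pi> (inv_into V (\<phi> \<circ> \<pi>) y) = inv_into C \<phi> y"
proof -
  obtain v where v: "v \<in> V" "y = \<phi> (\<pi> v)" using y by auto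
  have "inj_on \<phi> C" by (rule open_chartsD(2)[OF open_charts_base c])
  moreover from this have "inj_on (\<phi> \<circ> \<pi>) V"
    using V by (meson comp_inj_on inj_on_subset)
  ultimately show ?thesis
    using v V inv_into_f_f[of "\<phi> \<circ> \<pi>" V v] inv_into_f_f[of \<phi> C "\<pi> v"] by auto
qed

text \<open>In matching charts \<open>f\<close> and \<open>f \<circ> \<pi>\<close> have the same coordinate expression. The backward
direction works because the pull-back atlas contains the restriction of every lifted chart to
every smaller open set.\<close>

lemma smooth_near_lift:
  assumes x: "x \<in> U"
  shows "smooth_near B x (f \<circ> \<pi>) \<longleftrightarrow> smooth_near A (\<pi> x) f"
proof
  assume "smooth_near A (\<pi> x) f"
  then obtain W where W: "open_in A W" "\<pi> x \<in> W" "smooth_map_on A W f"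
    by (auto simp: smooth_near_def)
  have "smooth_map_on B (U \<inter> \<pi> -` W) (f \<circ> \<pi>)"
    unfolding smooth_map_on_def
  proof safe
    fix V \<psi> assume B: "(V, \<psi>) \<in> B"
    then obtain C \<phi> where \<psi>: "\<psi> = \<phi> \<circ> \<pi>" and c: "(C, \<phi>) \<in> A"
      and V: "openin (top_of_set U) V" "inj_on \<pi> V" "\<pi> ` V \<subseteq> C"
      unfolding pullback_chart by blast
    have o: "open (\<psi> ` (V \<inter> (U \<inter> \<pi> -` W)))"
      by (rule open_chartsD(4)[OF open_charts_cover B]) (simp add: open_in_B preimage_open W)
    have "smooth_on (\<phi> ` (C \<inter> W)) (f \<circ> inv_into C \<phi>)"
      using W(3) c by (auto simp: smooth_map_on_def)
    then have "smooth_on (\<psi> ` (V \<inter> (U \<inter> \<pi> -` W))) (f \<circ> inv_into C \<phi>)"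
      by (rule smooth_on_subset) (use V(3) in \<open>auto simp: \<psi>\<close>)
    then show "smooth_on (\<psi> ` (V \<inter> (U \<inter> \<pi> -` W))) (f \<circ> \<pi> \<circ> inv_into V \<psi>)"
      by (subst smooth_on_cong[OF o, where g = "f \<circ> inv_into C \<phi>"])
        (auto simp: \<psi> pi_inv_chart[OF c V(2,3), unfolded o_def] o_def)
  qed
  then show "smooth_near B x (f \<circ> \<pi>)"
    unfolding smooth_near_def open_in_B using preimage_open[OF W(1)] W(2) x by blast
next
  assume "smooth_near B x (f \<circ> \<pi>)"
  then obtain W where W: "openin (top_of_set U) W" "x \<in> W" "smooth_map_on B W (f \<circ> \<pi>)"
    by (auto simp: smooth_near_def open_in_B)
  obtain C0 \<phi>0 where "(C0, \<phi>0) \<in> A" "\<pi> x \<in> C0"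
    using pi_in[OF x] by (force simp: points_def)
  then obtain V where V: "x \<in> V" "openin (top_of_set U) V" "inj_on \<pi> V"
    using chart_exists[OF x] by blast
  have "smooth_map_on A (\<pi> ` (W \<inter> V)) f"
    unfolding smooth_map_on_def
  proof safe
    fix C \<phi> assume c: "(C, \<phi>) \<in> A"
    define V' where "V' = W \<inter> V \<inter> (U \<inter> \<pi> -` C)"
    have V': "openin (top_of_set U) V'" "inj_on \<pi> V'" "\<pi> ` V' \<subseteq> C"
      unfolding V'_def using V W preimage_open[OF open_chartsD(1)[OF open_charts_base c]]
      by (auto simp: openin_Int intro: inj_on_subset)
    then have B: "(V', \<phi> \<circ> \<pi>) \<in> B" using c unfolding pullback_chart by blast
    have "V' \<inter> W = V'" by (auto simp: V'_def)
    moreover have "\<phi> ` (C \<inter> \<pi> ` (W \<inter> V)) = (\<phi> \<circ> \<pi>) ` V'"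
      unfolding V'_def using openin_imp_subset[OF V(2)] by (auto simp: image_iff)
    moreover have "smooth_on ((\<phi> \<circ> \<pi>) ` (V' \<inter> W)) (f \<circ> \<pi> \<circ> inv_into V' (\<phi> \<circ> \<pi>))"
      using W(3) B by (auto simp: smooth_map_on_def)
    ultimately have "smooth_on (\<phi> ` (C \<inter> \<pi> ` (W \<inter> V))) (f \<circ> \<pi> \<circ> inv_into V' (\<phi> \<circ> \<pi>))"
      and "\<phi> ` (C \<inter> \<pi> ` (W \<inter> V)) = (\<phi> \<circ> \<pi>) ` V'" by simp_all
    then show "smooth_on (\<phi> ` (C \<inter> \<pi> ` (W \<inter> V))) (f \<circ> inv_into C \<phi>)"
      using pi_inv_chart[OF c V'(2,3)]
      by (subst smooth_on_cong[OF open_chartsD(4)[OF open_charts_base c image_open], where g =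
          "f \<circ> \<pi> \<circ> inv_into V' (\<phi> \<circ> \<pi>)"])
        (use V W in \<open>auto simp: openin_Int\<close>)
  qed
  moreover have "open_in A (\<pi> ` (W \<inter> V))"
    by (rule image_open) (use V W in \<open>auto simp: openin_Int\<close>)
  ultimately show "smooth_near A (\<pi> x) f"
    unfolding smooth_near_def using V(1) W(2) by blast
qed

lemma push_coord_vec:
  assumes c: "(C, \<phi>) \<in> A" and V: "openin (top_of_set U) V" "inj_on \<pi> V" "\<pi> ` V \<subseteq> C"
    and x: "x \<in> V"
  shows "push \<pi> (coord_vec B V (\<phi> \<circ> \<pi>) k x) = coord_vec A C \<phi> k (\<pi> x)"
proof
  fix f :: "'m \<Rightarrow> complex"
  have xU: "x \<in> U" using x V(1) openin_imp_subset by blast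
  have B: "(V, \<phi> \<circ> \<pi>) \<in> B" using c V unfolding pullback_chart by blast
  show "push \<pi> (coord_vec B V (\<phi> \<circ> \<pi>) k x) f = coord_vec A C \<phi> k (\<pi> x) f"
  proof (cases "smooth_near A (\<pi> x) f")
    case True
    have "(f \<circ> inv_into C \<phi> has_derivative frechet_derivative (f \<circ> inv_into C \<phi>) (at (\<phi> (\<pi> x))))
        (at (\<phi> (\<pi> x)))"
      using smooth_near_chart(2)[OF open_charts_base c _ True] V(3) x by blast
    then have "(f \<circ> \<pi> \<circ> inv_into V (\<phi> \<circ> \<pi>) has_derivative
        frechet_derivative (f \<circ> inv_into C \<phi>) (at (\<phi> (\<pi> x)))) (at (\<phi> (\<pi> x)))"
      by (rule has_derivative_transform_within_open[OF _ open_chartsD(5)[OF open_charts_cover B]])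
        (use x pi_inv_chart[OF c V(2,3)] in auto)
    then have "frechet_derivative (f \<circ> \<pi> \<circ> inv_into V (\<phi> \<circ> \<pi>)) (at (\<phi> (\<pi> x)))
        = frechet_derivative (f \<circ> inv_into C \<phi>) (at (\<phi> (\<pi> x)))"
      unfolding has_derivative_iff_frechet by blast
    then show ?thesis
      using True by (simp add: push_def coord_vec_def smooth_near_lift[OF xU])
  next
    case False
    then show ?thesis
      by (simp add: push_def coord_vec_def smooth_near_lift[OF xU])
  qed
qed

lemma push_cvec_sum: "push \<pi> (cvec_sum I c X) = cvec_sum I c (\<lambda>i. push \<pi> (X i))"
  by (simp add: push_def cvec_sum_def)

lemma push_ctangent:
  assumes x: "x \<in> U" and X: "X \<in> ctangent B x"
  shows "push \<pi> X \<in> ctangent A (\<pi> x)"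
  unfolding ctangent_def mem_Collect_eq
proof (intro conjI allI impI)
  fix f :: "'m \<Rightarrow> complex" assume "\<not> smooth_near A (\<pi> x) f"
  then show "push \<pi> X f = 0"
    using X smooth_near_lift[OF x, of f] by (auto simp: push_def ctangent_def)
next
  fix f h :: "'m \<Rightarrow> complex" assume "smooth_near A (\<pi> x) f \<and> smooth_near A (\<pi> x) h"
  then have s: "smooth_near B x (f \<circ> \<pi>)" "smooth_near B x (h \<circ> \<pi>)"
    by (simp_all add: smooth_near_lift[OF x])
  show "push \<pi> X (\<lambda>x. f x + h x) = push \<pi> X f + push \<pi> X h"
    "push \<pi> X (\<lambda>x. f x * h x) = push \<pi> X f * h (\<pi> x) + f (\<pi> x) * push \<pi> X h"
    using ctangent_simps(1)[OF X s] ctangent_mult[OF X s] by (simp_all add: push_def o_def)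
  assume "\<exists>W. open_in A W \<and> \<pi> x \<in> W \<and> (\<forall>x\<in>W. f x = h x)"
  then obtain W where W: "open_in A W" "\<pi> x \<in> W" "\<forall>x\<in>W. f x = h x" by blast
  show "push \<pi> X f = push \<pi> X h"
    unfolding push_def
    by (rule ctangent_local[OF X s, of "U \<inter> \<pi> -` W"])
      (use W x preimage_open[OF W(1)] in \<open>auto simp: open_in_B\<close>)
next
  fix z and f :: "'m \<Rightarrow> complex" assume "smooth_near A (\<pi> x) f"
  then have "smooth_near B x (f \<circ> \<pi>)"
    by (simp add: smooth_near_lift[OF x])
  then have "X (\<lambda>x. z * (f \<circ> \<pi>) x) = z * X (f \<circ> \<pi>)"
    by (rule ctangent_simps(2)[OF X])
  then show "push \<pi> X (\<lambda>x. z * f x) = z * push \<pi> X f"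
    by (simp add: push_def o_def)
qed

text \<open>Each tangent vector of the base is a combination of coordinate vectors, which are the
images of the coordinate vectors of a lifted chart.\<close>

lemma push_onto:
  assumes x: "x \<in> U" and d: "CARD('d) = m"
    and span: "\<forall>X \<in> rtangent A (\<pi> x). \<exists>c :: nat \<Rightarrow> real. X = (\<lambda>f. \<Sum>i < m. of_real (c i) * e i f)"
    and Y: "Y \<in> ctangent A (\<pi> x)"
  shows "\<exists>X \<in> ctangent B x. push \<pi> X = Y"
proof -
  obtain C \<phi> where c: "(C, \<phi>) \<in> A" "\<pi> x \<in> C"
    using pi_in[OF x] by (force simp: points_def)
  then obtain V where V: "x \<in> V" "openin (top_of_set U) V" "inj_on \<pi> V" "\<pi> ` V \<subseteq> C"
    using chart_exists[OF x c] by blast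
  have B: "(V, \<phi> \<circ> \<pi>) \<in> B" using c V unfolding pullback_chart by blast
  obtain Y1 Y2 where Y12: "Y1 \<in> rtangent A (\<pi> x)" "Y2 \<in> rtangent A (\<pi> x)"
    and Yeq: "Y = cvec_add Y1 (cvec_scale \<i> Y2)"
    using ctangent_decomp[OF open_charts_base Y] by blast
  obtain \<gamma>1 \<gamma>2 where \<gamma>: "Y1 = cvec_sum UNIV (\<lambda>k. of_real (\<gamma>1 k)) (\<lambda>k. coord_vec A C \<phi> k (\<pi> x))"
     "Y2 = cvec_sum UNIV (\<lambda>k. of_real (\<gamma>2 k)) (\<lambda>k. coord_vec A C \<phi> k (\<pi> x))"
    using rtangent_coord_span(2)[OF A c d span] Y12 by metis
  let ?X = "cvec_sum UNIV (\<lambda>k. of_real (\<gamma>1 k) + \<i> * of_real (\<gamma>2 k)) (\<lambda>k. coord_vec B V (\<phi> \<circ> \<pi>) k x)"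
  have "?X \<in> ctangent B x"
    by (intro cvec_sum_in_ctangent rtangent_subset coord_vec_in_rtangent[OF open_charts_cover B
        V(1)])
  moreover have "push \<pi> ?X = Y"
    by (simp add: push_cvec_sum push_coord_vec[OF c(1) V(2-4,1)] Yeq \<gamma>)
      (simp add: cvec_sum_def cvec_add_def cvec_scale_def sum.distrib sum_distrib_left
          algebra_simps)
  ultimately show ?thesis by blast
qed

text \<open>The lift of an endomorphism field is defined through a choice of preimages under the
differential of \<open>\<pi>\<close>; surjectivity shows that the choice is a genuine tangent vector.\<close>

lemma lift_endo:
  assumes x: "x \<in> U" and d: "CARD('d) = m"
    and span: "\<forall>X \<in> rtangent A (\<pi> x). \<exists>c :: nat \<Rightarrow> real. X = (\<lambda>f. \<Sum>i < m. of_real (c i) * e i f)"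
    and \<Psi>: "endo_section A \<Psi>" and X: "X \<in> ctangent B x"
  shows "lift_endo B \<pi> \<Psi> x X \<in> ctangent B x"
    and "push \<pi> (lift_endo B \<pi> \<Psi> x X) = \<Psi> (\<pi> x) (push \<pi> X)"
proof -
  have "\<Psi> (\<pi> x) (push \<pi> X) \<in> ctangent A (\<pi> x)"
    using \<Psi> pi_in[OF x] push_ctangent[OF x X] by (auto simp: endo_section_def)
  then have *: "\<Psi> (\<pi> x) (push \<pi> X) \<in> push \<pi> ` ctangent B x"
    using push_onto[OF x d span] by (metis imageI)
  show "lift_endo B \<pi> \<Psi> x X \<in> ctangent B x"
    unfolding lift_endo_def by (rule inv_into_into[OF *])
  show "push \<pi> (lift_endo B \<pi> \<Psi> x X) = \<Psi> (\<pi> x) (push \<pi> X)"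
    unfolding lift_endo_def by (rule f_inv_into_f[OF *])
qed

end

section \<open>Connectedness, coordinate signs and orthonormal families\<close>

text \<open>A homotopy of loops between two constant loops is traced by a path between their values.\<close>

lemma simply_connected_connected: "simply_connected S \<Longrightarrow> connected S"
proof (rule path_connected_imp_connected)
  assume S: "simply_connected S"
  show "path_connected S"
    unfolding path_connected_component
  proof safe
    fix a b assume "a \<in> S" "b \<in> S"
    then have "homotopic_loops S (\<lambda>_. a) (\<lambda>_. b)"
      by (intro S[unfolded simply_connected_def, rule_format])
        (auto simp: path_def pathstart_def pathfinish_def path_image_def)
    from homotopic_loops_imp_path_component_value[OF this, of 0] show "path_component S a b" by simp
  qed
qed

text \<open>Counting predecessors enumerates the index type by \<open>0, \<dots>, n\<close>.\<close>

lemma card_positive_coord: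
  assumes N: "CARD('N::{finite,linorder}) = n + 1"
  shows "card {a::'N. positive_coord n q a} = n - q"
proof -
  let ?r = "\<lambda>a::'N. card {..<a}"
  have mono: "?r a < ?r b" if "a < b" for a b
    using that by (intro psubset_card_mono) auto
  have inj: "inj ?r"
    by (rule injI) (metis mono less_irrefl neq_iff)
  have "?r a < n + 1" for a
  proof -
    have "card {..<a} < card (UNIV :: 'N set)" by (rule psubset_card_mono) auto
    then show ?thesis using N by simp
  qed
  then have sub: "range ?r \<subseteq> {..<n + 1}" by blast
  have "range ?r = {..<n + 1}"
    using card_image[OF inj] N by (intro card_subset_eq[OF _ sub]) auto
  then have "?r ` {a. positive_coord n q a} = {..<n - q}"
  proof (intro equalityI subsetI)
    fix k assume k: "k \<in> {..<n - q}"
    then have "k \<in> range ?r" using \<open>range ?r = {..<n + 1}\<close> by simp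
    then obtain a where "k = ?r a" by blast
    then show "k \<in> ?r ` {a. positive_coord n q a}" using k by (auto simp: positive_coord_def)
  qed (auto simp: positive_coord_def)
  then show ?thesis
    using card_image[OF inj_on_subset[OF inj subset_UNIV], of "{a. positive_coord n q a}"] by simp
qed

lemma bij_matching_predicates:
  assumes I: "finite I" "CARD('a::finite) = card I" and PQ: "card {a::'a. P a} = card {i\<in>I. Q i}"
  shows "\<exists>b. bij_betw b (UNIV :: 'a set) I \<and> (\<forall>a. P a \<longleftrightarrow> Q (b a))"
proof -
  obtain f where f: "bij_betw f {a. P a} {i\<in>I. Q i}"
    using finite_same_card_bij[OF _ _ PQ] I by auto
  have "card {a. \<not> P a} = card {i\<in>I. \<not> Q i}"
  proof -
    have "{a. \<not> P a} = UNIV - {a. P a}" "{i\<in>I. \<not> Q i} = I - {i\<in>I. Q i}" by auto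
    then show ?thesis using I PQ by (simp add: card_Diff_subset)
  qed
  then obtain h where h: "bij_betw h {a. \<not> P a} {i\<in>I. \<not> Q i}"
    using finite_same_card_bij[of "{a. \<not> P a}" "{i\<in>I. \<not> Q i}"] I by auto
  let ?b = "\<lambda>a. if P a then f a else h a"
  have "bij_betw ?b {a. P a} {i\<in>I. Q i}"
    by (subst bij_betw_cong[where g = f]) (use f in auto)
  moreover have "bij_betw ?b {a. \<not> P a} {i\<in>I. \<not> Q i}"
    by (subst bij_betw_cong[where g = h]) (use h in auto)
  ultimately have "bij_betw ?b ({a. P a} \<union> {a. \<not> P a}) ({i\<in>I. Q i} \<union> {i\<in>I. \<not> Q i})"
    by (rule bij_betw_combine) auto
  moreover have "{a. P a} \<union> {a. \<not> P a} = UNIV" "{i\<in>I. Q i} \<union> {i\<in>I. \<not> Q i} = I" by auto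
  moreover have "P a \<longleftrightarrow> Q (?b a)" for a
    using bij_betwE[OF f] bij_betwE[OF h] by auto
  ultimately show ?thesis by (intro exI[of _ ?b]) auto
qed

lemma cbil_zero: "cbil 0 v = 0" "cbil v 0 = 0"
  by (simp_all add: cbil_def)

text \<open>The square of the determinant of the family is the determinant of its Gram matrix.\<close>

lemma orthonormal_nondegenerate:
  fixes P :: "'N::finite \<Rightarrow> complex^'N"
  assumes P: "\<And>a b. cbil (P a) (P b) = (if a = b then s a else 0)" and s: "\<And>a. s a \<noteq> 0"
    and v: "\<And>a. cbil (P a) v = 0"
  shows "v = 0"
proof -
  let ?M = "\<chi> a. P a"
  have M: "(?M ** transpose ?M) $ i $ j = cbil (P i) (P j)" for i j
    by (simp add: matrix_matrix_mult_def transpose_def cbil_def)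
  have "det (?M ** transpose ?M) = (\<Prod>i\<in>UNIV. s i)"
    by (subst det_diagonal) (auto simp: M P)
  then have "det ?M \<noteq> 0"
    using s by (auto simp: det_mul)
  then obtain R where R: "R ** ?M = mat 1"
    unfolding invertible_det_nz[symmetric] invertible_def by blast
  have "?M *v v = 0"
    using v by (simp add: matrix_vector_mult_def vec_eq_iff cbil_def)
  then have "(R ** ?M) *v v = 0" by (simp add: matrix_vector_mul_assoc[symmetric])
  then show ?thesis by (simp add: R)
qed

section \<open>Adapted frames of an immersion with real data\<close>

text \<open>The two cases of the theorem are treated at once: \<open>\<kappa> = 1\<close> if \<open>\<Psi>\<close> is real and \<open>\<kappa> = \<i>\<close> if
\<open>\<i>\<Psi>\<close> is real, and \<open>q\<close> is the index of the space form that receives the immersion.\<close>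

locale real_immersion_data = covered_manifold A U \<pi>
  for A :: "('m::topological_space, 'd::finite) atlas"
    and U :: "'u::topological_space set" and \<pi> :: "'u \<Rightarrow> 'm" +
  fixes g :: "'m cform" and \<Psi> :: "'m cendo" and \<sigma> \<nu> :: "'u \<Rightarrow> complex^('N::{finite,linorder})"
    and \<kappa> :: complex and n p q :: nat
  assumes conn: "connected U"
    and n: "n \<ge> 2" and d: "CARD('d) = n - 1" and N: "CARD('N) = n + 1" and p: "p \<le> n - 1"
    and g: "complex_metric A g" and \<Psi>: "endo_section A \<Psi>"
    and \<sigma>: "smooth_map_on B U \<sigma>" "\<sigma> ` U \<subseteq> XX"
    and metric: "has_pullback_metric B \<sigma> (lift_form \<pi> g)"
    and normal: "unit_normal B \<sigma> \<nu>"
    and shape: "\<And>x X. x \<in> U \<Longrightarrow> X \<in> ctangent B x \<Longrightarrow>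
      cdiff \<sigma> (lift_endo B \<pi> \<Psi> x X) = pullback_LC \<sigma> \<nu> x X"
    and sig: "pseudo_riemannian_on_real A g (n - 1 - p) p"
    and \<kappa>: "\<kappa> = 1 \<and> q = p \<or> \<kappa> = \<i> \<and> q = p + 1"
    and real: "real_endo A (\<lambda>x X. cvec_scale \<kappa> (\<Psi> x X))"
begin

text \<open>The multiple of the normal field that belongs to the real frame.\<close>

abbreviation "u \<equiv> \<lambda>x. \<kappa> *s \<nu> x"

lemma kappa_square: "\<kappa> * \<kappa> = of_real (if \<kappa> = 1 then 1 else -1)"
  using \<kappa> by auto

lemma smooth_near_immersion: "x \<in> U \<Longrightarrow> smooth_near B x \<sigma>"
  unfolding smooth_near_def open_in_B using \<sigma>(1) openin_subtopology_self by blast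

lemma smooth_u: "smooth_map_on B U u"
proof (rule smooth_map_on_bounded_linear[OF open_charts_cover _ _
      bounded_bilinear.bounded_linear_right[OF bounded_bilinear_vsm]])
  show "open_in B U" by (simp add: open_in_B)
  show "smooth_map_on B U \<nu>" using normal by (simp add: unit_normal_def)
qed

lemma smooth_near_scaled_normal: "x \<in> U \<Longrightarrow> smooth_near B x u"
  unfolding smooth_near_def open_in_B using smooth_u openin_subtopology_self by blast

lemma smooth_near_normal: "x \<in> U \<Longrightarrow> smooth_near B x \<nu>"
  unfolding smooth_near_def open_in_B using normal openin_subtopology_self
  by (auto simp: unit_normal_def)

lemma cdiff_u:
  assumes "x \<in> U" "X \<in> ctangent B x"
  shows "cdiff u X = \<kappa> *s cdiff \<nu> X"
proof -
  have "X (\<lambda>x. \<kappa> * \<nu> x $ i) = \<kappa> * X (\<lambda>x. \<nu> x $ i)" for i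
    by (rule ctangent_simps(2)[OF assms(2)])
      (rule smooth_near_bounded_linear[OF open_charts_cover smooth_near_normal[OF assms(1)]
          bounded_linear_vec_nth])
  then show ?thesis by (simp add: cdiff_def vec_eq_iff)
qed

lemma pullback_metric:
  assumes "x \<in> U" "X \<in> ctangent B x" "Y \<in> ctangent B x"
  shows "cbil (cdiff \<sigma> X) (cdiff \<sigma> Y) = g (\<pi> x) (push \<pi> X) (push \<pi> Y)"
  using metric assms by (auto simp: has_pullback_metric_def lift_form_def)

text \<open>The last identity, orthogonality of position and tangent vectors, is the derivation rule
applied to the sum of the squares of the coordinates of \<open>\<sigma>\<close>, which is constant.\<close>

lemma frame_relations:
  assumes x: "x \<in> U"
  shows "cbil (\<sigma> x) (\<sigma> x) = -1" "cbil (u x) (\<sigma> x) = 0"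
    "cbil (u x) (u x) = of_real (if \<kappa> = 1 then 1 else -1)"
    "X \<in> ctangent B x \<Longrightarrow> cbil (u x) (cdiff \<sigma> X) = 0"
    "X \<in> ctangent B x \<Longrightarrow> cbil (\<sigma> x) (cdiff \<sigma> X) = 0"
proof -
  show *: "cbil (\<sigma> x) (\<sigma> x) = -1" using \<sigma>(2) x by (auto simp: XX_def)
  have "cbil (\<nu> x) (\<sigma> x) = 0" "cbil (\<nu> x) (\<nu> x) = 1"
    using normal x by (auto simp: unit_normal_def tangent_XX_def)
  then show "cbil (u x) (\<sigma> x) = 0" "cbil (u x) (u x) = of_real (if \<kappa> = 1 then 1 else -1)"
    using kappa_square by (simp_all add: cbil_simps)
  assume X: "X \<in> ctangent B x"
  show "cbil (u x) (cdiff \<sigma> X) = 0"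
    using normal x X by (auto simp: unit_normal_def cbil_simps)
  have s: "smooth_near B x (\<lambda>y. \<sigma> y $ i)" for i
    by (rule smooth_near_bounded_linear[OF open_charts_cover smooth_near_immersion[OF x]
        bounded_linear_vec_nth])
  have s2: "smooth_near B x (\<lambda>y. \<sigma> y $ i * \<sigma> y $ i)" for i
    by (rule smooth_near_mult[OF open_charts_cover s s])
  have xB: "x \<in> points B" using x by simp
  have ssum: "smooth_near B x (\<lambda>y. \<Sum>i\<in>UNIV. 1 * (\<sigma> y $ i * \<sigma> y $ i))"
    and sum: "X (\<lambda>y. \<Sum>i\<in>UNIV. 1 * (\<sigma> y $ i * \<sigma> y $ i)) = (\<Sum>i\<in>UNIV. 1 * X (\<lambda>y. \<sigma> y $ i * \<sigma> y $ i))"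
    using ctangent_sum[OF open_charts_cover xB X, of "\<lambda>i y. \<sigma> y $ i * \<sigma> y $ i" "\<lambda>_. 1" UNIV] s2
        by blast+
  have "X (\<lambda>y. \<Sum>i\<in>UNIV. 1 * (\<sigma> y $ i * \<sigma> y $ i)) = X (\<lambda>y. -1)"
    by (rule ctangent_local[OF X ssum smooth_near_const[OF xB], where W = U])
      (use x \<sigma>(2) in \<open>auto simp: open_in_B XX_def cbil_def\<close>)
  moreover have "X (\<lambda>y. -1) = 0"
    using ctangent_mult[OF X smooth_near_const[OF xB, of 1] smooth_near_const[OF xB, of 1]]
      ctangent_simps(2)[OF X smooth_near_const[OF xB, of 1], of "-1"] by simp
  ultimately have "(\<Sum>i\<in>UNIV. 2 * (\<sigma> x $ i * X (\<lambda>y. \<sigma> y $ i))) = 0"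
    using sum by (simp add: ctangent_mult[OF X s s] mult.commute)
  then show "cbil (\<sigma> x) (cdiff \<sigma> X) = 0"
    by (simp add: cbil_def cdiff_def sum_distrib_left[symmetric])
qed

lemma span_real: "x \<in> U \<Longrightarrow> \<exists>e. (\<forall>i<n - 1. e i \<in> rtangent A (\<pi> x)) \<and>
   (\<forall>X \<in> rtangent A (\<pi> x). \<exists>c :: nat \<Rightarrow> real. X = (\<lambda>f. \<Sum>i<n - 1. of_real (c i) * e i f)) \<and>
   (\<forall>i<n - 1. \<forall>j<n - 1. g (\<pi> x) (e i) (e j) = (if i \<noteq> j then 0 else
       if i < n - 1 - p then 1 else -1))"
proof -
  assume x: "x \<in> U"
  have m: "n - 1 - p + p = n - 1" using p by simp
  from conjunct2[OF bspec[OF sig[unfolded pseudo_riemannian_on_real_def] pi_in[OF x]], unfolded m]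
  show ?thesis .
qed

lemma g_real: "x \<in> U \<Longrightarrow> X \<in> rtangent A (\<pi> x) \<Longrightarrow> Y \<in> rtangent A (\<pi> x) \<Longrightarrow> g (\<pi> x) X Y \<in> \<real>"
  using sig pi_in[of x] unfolding pseudo_riemannian_on_real_def by blast

lemma g_scale:
  assumes "x \<in> U" "X \<in> ctangent A (\<pi> x)" "Y \<in> ctangent A (\<pi> x)"
  shows "g (\<pi> x) (cvec_scale c X) Y = c * g (\<pi> x) X Y"
proof -
  have "\<forall>c. \<forall>X \<in> ctangent A (\<pi> x). \<forall>Y \<in> ctangent A (\<pi> x). g (\<pi> x) (cvec_scale c X) Y =
      c * g (\<pi> x) X Y"
    using g pi_in[OF assms(1)] unfolding complex_metric_def by blast
  then show ?thesis using assms by blast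
qed

text \<open>Besides \<open>\<sigma>(x)\<close>, with square \<open>-1\<close>, and \<open>\<kappa>\<nu>(x)\<close>, with square \<open>\<kappa>\<^sup>2\<close>, the frame consists of the
images of an orthonormal basis of the real tangent space. Counting signs gives \<open>n - q\<close> positive
vectors, so the frame can be indexed such that its signs are those of the coordinates of the
model quadric.\<close>

lemma orthonormal_frame:
  assumes c: "(C, \<phi>) \<in> A" and V: "openin (top_of_set U) V" "inj_on \<pi> V" "\<pi> ` V \<subseteq> C" and x: "x \<in> V"
  shows "\<exists>P :: 'N \<Rightarrow> _. (\<forall>a b. cbil (P a) (P b) = (if a = b then
      if positive_coord n q a then 1 else -1 else 0)) \<and>
    (\<forall>a. P a = \<sigma> x \<or> P a = u x \<or>
      (\<exists>\<beta>. P a = (\<Sum>k\<in>UNIV. of_real (\<beta> k) *s cdiff \<sigma> (coord_vec B V (\<phi> \<circ> \<pi>) k x))))"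
proof -
  have xU: "x \<in> U" using x V(1) openin_imp_subset by blast
  have B: "(V, \<phi> \<circ> \<pi>) \<in> B" using c V unfolding pullback_chart by blast
  have xC: "\<pi> x \<in> C" using x V(3) by blast
  let ?cv = "\<lambda>k. coord_vec B V (\<phi> \<circ> \<pi>) k x"
  obtain e where span: "\<forall>X \<in> rtangent A (\<pi> x). \<exists>c :: nat \<Rightarrow> real. X =
      (\<lambda>f. \<Sum>i<n - 1. of_real (c i) * e i f)"
    and e: "\<forall>i<n - 1. \<forall>j<n - 1. g (\<pi> x) (e i) (e j) = (if i \<noteq> j then 0 else
        if i < n - 1 - p then 1 else -1)"
    using span_real[OF xU] by blast
  obtain \<beta> where \<beta>: "\<forall>i<n - 1. e i = cvec_sum UNIV (\<lambda>k. of_real (\<beta> i k)) (\<lambda>k. coord_vec A C \<phi> k (\<pi>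
      x))"
    using rtangent_coord_span(1)[OF A c xC d span] by blast
  let ?X = "\<lambda>i. cvec_sum UNIV (\<lambda>k. of_real (\<beta> i k)) ?cv"
  have X: "?X i \<in> ctangent B x" for i
    by (intro cvec_sum_in_ctangent rtangent_subset coord_vec_in_rtangent[OF open_charts_cover B x])
  have push: "push \<pi> (?X i) = e i" if "i < n - 1" for i
    using \<beta> that by (simp add: push_cvec_sum push_coord_vec[OF c V x])
  define E where "E = (\<lambda>i. if i < n - 1 then cdiff \<sigma> (?X i) else if i = n - 1 then \<sigma> x else u x)"
  define pos where "pos = (\<lambda>i. i < n - 1 - p \<or> (i = n \<and> \<kappa> = 1))"
  have E: "cbil (E i) (E j) = (if i = j then if pos i then 1 else -1 else 0)" if "i < n + 1"
      "j < n + 1" for i j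
  proof -
    have xx: "cbil (cdiff \<sigma> (?X i)) (cdiff \<sigma> (?X j)) = (if i \<noteq> j then 0 else
        if i < n - 1 - p then 1 else -1)"
      if "i < n - 1" "j < n - 1" for i j
      using pullback_metric[OF xU X X] push that e by simp
    note ij = that
    have us: "cbil (\<sigma> x) (u x) = 0"
      using frame_relations(2)[OF xU] by (simp add: cbil_commute[of "\<sigma> x"])
    have xs: "cbil (cdiff \<sigma> (?X i)) (\<sigma> x) = 0" "cbil (cdiff \<sigma> (?X i)) (u x) = 0" for i
      using frame_relations(4,5)[OF xU X[of i]] by (simp_all add: cbil_commute[of "cdiff \<sigma> (?X i)"])
    have E1: "E i = cdiff \<sigma> (?X i)" "pos i \<longleftrightarrow> i < n - 1 - p" if "i < n - 1" for i
      using that by (auto simp: E_def pos_def)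
    have E2: "E (n - 1) = \<sigma> x" "\<not> pos (n - 1)" "E n = u x" "pos n \<longleftrightarrow> \<kappa> = 1" "n - 1 \<noteq> n" "n \<noteq> n - 1"
      using n by (auto simp: E_def pos_def)
    consider "i < n - 1" | "i = n - 1" | "i = n" using ij by linarith
    then show ?thesis
    proof cases
      case 1
      consider "j < n - 1" | "j = n - 1" | "j = n" using ij by linarith
      then show ?thesis
        by cases (use 1 E1 E2 xx xs in simp_all)
    next
      case 2
      consider "j < n - 1" | "j = n - 1" | "j = n" using ij by linarith
      then show ?thesis
        by cases (use 2 E2 E1 us frame_relations(1)[OF xU] frame_relations(5)[OF xU X[of j]] in
            simp_all)
    next
      case 3
      consider "j < n - 1" | "j = n - 1" | "j = n" using ij by linarith
      then show ?thesis
        by cases (use 3 E2 E1 frame_relations(2,3)[OF xU] frame_relations(4)[OF xU X[of j]] in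
            simp_all)
    qed
  qed
  have "card {i\<in>{..<n + 1}. pos i} = n - q"
  proof (cases "\<kappa> = 1")
    case True
    have "{i\<in>{..<n + 1}. pos i} = insert n {..<n - 1 - p}"
      using True n by (auto simp: pos_def)
    then show ?thesis using True \<kappa> n p by auto
  next
    case False
    have "{i\<in>{..<n + 1}. pos i} = {..<n - 1 - p}"
      using False n by (auto simp: pos_def)
    then show ?thesis using False \<kappa> n p by auto
  qed
  then have "\<exists>b. bij_betw b (UNIV :: 'N set) {..<n + 1} \<and> (\<forall>a. positive_coord n q a \<longleftrightarrow> pos (b a))"
    using N card_positive_coord[OF N] by (intro bij_matching_predicates) auto
  then obtain b where b: "bij_betw b (UNIV :: 'N set) {..<n + 1}" and pos:
      "\<And>a. positive_coord n q a \<longleftrightarrow> pos (b a)"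
    by blast
  have b1: "b a < n + 1" "b a = b a' \<longleftrightarrow> a = a'" for a a'
    using b by (auto simp: bij_betw_def inj_def)
  have r1: "E i = \<sigma> x \<or> E i = u x \<or> (\<exists>\<beta>. E i = (\<Sum>k\<in>UNIV. of_real (\<beta> k) *s cdiff \<sigma> (?cv k)))" for i
    by (auto simp: E_def cdiff_cvec_sum)
  have r2: "cbil (E (b a)) (E (b a')) = (if a = a' then
      if positive_coord n q a then 1 else -1 else 0)" for a a'
    using E[OF b1(1) b1(1)] b1(2) pos by simp
  show ?thesis
    by (intro exI[of _ "\<lambda>a. E (b a)"] conjI allI) (rule r2, rule r1)
qed

lemma chart_at:
  assumes x: "x \<in> U"
  obtains C \<phi> V where "(C, \<phi>) \<in> A" "openin (top_of_set U) V" "inj_on \<pi> V" "\<pi> ` V \<subseteq> C" "x \<in> V"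
proof -
  obtain C \<phi> where c: "(C, \<phi>) \<in> A" "\<pi> x \<in> C"
    using pi_in[OF x] by (force simp: points_def)
  then show ?thesis
    using chart_exists[OF x c] that by blast
qed

section \<open>The conjugation matrix along the immersion\<close>

text \<open>The identities are demanded on a neighbourhood and only for \<open>\<sigma>\<close> and \<open>\<kappa>\<nu>\<close>: differentiation
in an arbitrary chart extends them to \<open>d\<sigma>\<close>.\<close>

definition conj_at :: "complex^('N::{finite,linorder})^('N::{finite,linorder}) \<Rightarrow>
    'u::topological_space \<Rightarrow> bool" where
  "conj_at C x \<longleftrightarrow> (\<exists>T. openin (top_of_set U) T \<and> x \<in> T \<and>
     (\<forall>y\<in>T. C *v \<sigma> y = cnjv (\<sigma> y) \<and> C *v u y = cnjv (u y)))"

text \<open>Gauss and Weingarten in a chart: reality of the coefficients of \<open>d(\<kappa>\<nu>)\<close> is the reality of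
\<open>\<kappa>\<Psi>\<close>, and reality of the coefficients of the metric is the reality of \<open>g\<close>.\<close>

lemma conj_at_exists:
  assumes x: "x \<in> U"
  shows "\<exists>C T. openin (top_of_set U) T \<and> x \<in> T \<and>
     (\<forall>y\<in>T. C *v \<sigma> y = cnjv (\<sigma> y) \<and> C *v u y = cnjv (u y))"
proof -
  obtain C \<phi> V where c: "(C, \<phi>) \<in> A" and V: "openin (top_of_set U) V" "inj_on \<pi> V" "\<pi> ` V \<subseteq> C"
    and xV: "x \<in> V" using chart_at[OF x] .
  define \<psi> where "\<psi> = \<phi> \<circ> \<pi>"
  have B: "(V, \<psi>) \<in> B" using c V unfolding pullback_chart \<psi>_def by blast
  have VU: "V \<subseteq> U" by (rule openin_imp_subset[OF V(1)])
  have o: "open (\<psi> ` V)" by (rule open_chartsD(5)[OF open_charts_cover B])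
  then obtain r where r: "0 < r" "ball (\<psi> x) r \<subseteq> \<psi> ` V"
    using xV openE by blast
  let ?S = "ball (\<psi> x) r" and ?i = "inv_into V \<psi>"
  let ?s = "\<sigma> \<circ> ?i" and ?u = "u \<circ> ?i"
  let ?cv = "\<lambda>k z. coord_vec B V \<psi> k z"
  have i: "?i y \<in> V" "\<psi> (?i y) = y" "?i y \<in> U" if "y \<in> ?S" for y
    using that r VU by (auto simp: f_inv_into_f inv_into_into subset_iff)
  have "smooth_on (\<psi> ` V) ?s"
    using \<sigma>(1) B VU unfolding smooth_map_on_def by (force simp: Int_absorb2)
  then have s: "smooth_on ?S ?s" using r smooth_on_subset by blast
  have "smooth_on (\<psi> ` V) ?u"
    using smooth_u B VU unfolding smooth_map_on_def by (force simp: Int_absorb2)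
  then have u: "smooth_on ?S ?u" using r smooth_on_subset by blast
  have ds: "frechet_derivative ?s (at y) (axis k 1) = cdiff \<sigma> (?cv k (?i y))" if "y \<in> ?S" for y k
    using cdiff_coord_vec[OF open_charts_cover B i(1)[OF that] smooth_near_immersion[OF i(3)[OF
        that]], of k] i(2)[OF that] by simp
  have du: "frechet_derivative ?u (at y) (axis k 1) = cdiff u (?cv k (?i y))" if "y \<in> ?S" for y k
    using cdiff_coord_vec[OF open_charts_cover B i(1)[OF that] smooth_near_scaled_normal[OF i(3)[OF
        that]], of k] i(2)[OF that] by simp
  have cvB: "?cv k z \<in> ctangent B z" if "z \<in> V" for k z
    by (rule rtangent_subset[OF coord_vec_in_rtangent[OF open_charts_cover B that]])
  have push: "push \<pi> (?cv k z) = coord_vec A C \<phi> k (\<pi> z)" if "z \<in> V" for k z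
    unfolding \<psi>_def by (rule push_coord_vec[OF c V that])
  have cvA: "coord_vec A C \<phi> k (\<pi> z) \<in> rtangent A (\<pi> z)" if "z \<in> V" for k z
    by (rule coord_vec_in_rtangent[OF open_charts_base c]) (use V(3) that in auto)
  have "\<exists>C. \<forall>y\<in>?S. C *v ?s y = cnjv (?s y) \<and> C *v ?u y = cnjv (?u y)"
  proof (rule local_real_form[where \<epsilon> = "if \<kappa> = 1 then 1 else -1"])
    show "CARD('N) = CARD('d) + 2" using N d n by simp
    show "smooth_on ?S ?s" "smooth_on ?S ?u" by (fact s, fact u)
    show "open ?S" "convex ?S" by auto
    fix y assume y: "y \<in> ?S"
    let ?z = "?i y"
    note z = i[OF y]
    note rel = frame_relations[OF z(3)]
    show "cbil (?s y) (?s y) = -1" "cbil (?u y) (?s y) = 0"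
      "cbil (?u y) (?u y) = of_real (if \<kappa> = 1 then 1 else -1)"
      using rel by auto
    show "cbil (?u y) (frechet_derivative ?s (at y) (axis k 1)) = 0" for k
      using rel(4)[OF cvB[OF z(1)]] ds[OF y] by simp
    show "cbil (frechet_derivative ?s (at y) (axis k 1)) (frechet_derivative ?s (at y) (axis j 1))
        \<in> \<real>" for k j
      unfolding ds[OF y] pullback_metric[OF z(3) cvB[OF z(1)] cvB[OF z(1)]] push[OF z(1)]
      by (rule g_real[OF z(3) cvA[OF z(1)] cvA[OF z(1)]])
    show "cbil (frechet_derivative ?u (at y) (axis k 1)) (frechet_derivative ?s (at y) (axis j 1))
        \<in> \<real>" for k j
    proof -
      let ?Sk = "lift_endo B \<pi> \<Psi> ?z (?cv k ?z)"
      let ?Xk = "coord_vec A C \<phi> k (\<pi> ?z)" and ?Xj = "coord_vec A C \<phi> j (\<pi> ?z)"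
      obtain e where span: "\<forall>X \<in> rtangent A (\<pi> ?z). \<exists>c :: nat \<Rightarrow> real. X =
          (\<lambda>f. \<Sum>i<n - 1. of_real (c i) * e i f)"
        using span_real[OF z(3)] by blast
      note S = lift_endo[OF z(3) d span \<Psi> cvB[OF z(1)], of k]
      \<comment> \<open>The projection only adds a multiple of \<open>\<sigma>\<close>, which is orthogonal to all tangent vectors.\<close>
      have "cdiff \<sigma> ?Sk = cdiff \<nu> (?cv k ?z) + cbil (cdiff \<nu> (?cv k ?z)) (\<sigma> ?z) *s \<sigma> ?z"
        using shape[OF z(3) cvB[OF z(1)]] by (simp add: pullback_LC_def proj_XX_def)
      then have "cbil (cdiff \<nu> (?cv k ?z)) (cdiff \<sigma> (?cv j ?z)) =
          cbil (cdiff \<sigma> ?Sk) (cdiff \<sigma> (?cv j ?z))"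
        using rel(5)[OF cvB[OF z(1)]] by (simp add: cbil_simps)
      also have "\<dots> = g (\<pi> ?z) (\<Psi> (\<pi> ?z) ?Xk) ?Xj"
        unfolding pullback_metric[OF z(3) S(1) cvB[OF z(1)]] S(2) push[OF z(1)] ..
      finally have "cbil (cdiff u (?cv k ?z)) (cdiff \<sigma> (?cv j ?z)) =
          \<kappa> * g (\<pi> ?z) (\<Psi> (\<pi> ?z) ?Xk) ?Xj"
        by (simp add: cdiff_u[OF z(3) cvB[OF z(1)]] cbil_simps)
      also have "\<dots> = g (\<pi> ?z) (cvec_scale \<kappa> (\<Psi> (\<pi> ?z) ?Xk)) ?Xj"
      proof -
        have "\<Psi> (\<pi> ?z) ?Xk \<in> ctangent A (\<pi> ?z)"
          using \<Psi> pi_in[OF z(3)] rtangent_subset[OF cvA[OF z(1)]] unfolding endo_section_def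
              by blast
        then show ?thesis
          using g_scale[OF z(3) _ rtangent_subset[OF cvA[OF z(1)]]] by simp
      qed
      also have "\<dots> \<in> \<real>"
        using real pi_in[OF z(3)] cvA[OF z(1)] unfolding real_endo_def
        by (intro g_real[OF z(3)]) blast+
      finally show ?thesis unfolding ds[OF y] du[OF y] .
    qed
    fix v assume v: "cbil (?s y) v = 0" "cbil (?u y) v = 0"
      "\<And>k. cbil (frechet_derivative ?s (at y) (axis k 1)) v = 0"
    obtain P :: "'N \<Rightarrow> _" where P: "\<And>a b. cbil (P a) (P b) = (if a = b then
        if positive_coord n q a then 1 else -1 else 0)"
      and PE: "\<And>a. P a = \<sigma> ?z \<or> P a = u ?z \<or>
         (\<exists>\<beta>. P a = (\<Sum>k\<in>UNIV. of_real (\<beta> k) *s cdiff \<sigma> (coord_vec B V (\<phi> \<circ> \<pi>) k ?z)))"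
      using orthonormal_frame[OF c V z(1)] by blast
    have v': "cbil (\<sigma> ?z) v = 0" "cbil (u ?z) v = 0"
        "cbil (cdiff \<sigma> (coord_vec B V (\<phi> \<circ> \<pi>) k ?z)) v = 0" for k
      using v ds[OF y] by (simp_all add: \<psi>_def)
    have "cbil (P a) v = 0" for a
      using PE[of a] v' by (auto simp: cbil_sum_left cbil_simps cbil_zero)
    then show "v = 0"
      by (intro orthonormal_nondegenerate[of P "\<lambda>a.
          if positive_coord n q a then 1 else -1"]) (use P in auto)
  qed
  then obtain M where M: "\<And>y. y \<in> ?S \<Longrightarrow> M *v ?s y = cnjv (?s y) \<and> M *v ?u y = cnjv (?u y)" by blast
  let ?T = "V \<inter> \<psi> -` ?S"
  have inj: "inj_on \<psi> V" by (rule open_chartsD(2)[OF open_charts_cover B])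
  have "openin (top_of_set V) ?T"
    using continuous_openin_preimage_gen[OF open_chartsD(3)[OF open_charts_cover B], of ?S] by simp
  then have "openin (top_of_set U) ?T" using V(1) openin_trans by blast
  moreover have "M *v \<sigma> y = cnjv (\<sigma> y) \<and> M *v u y = cnjv (u y)" if "y \<in> ?T" for y
    using M[of "\<psi> y"] that inv_into_f_f[OF inj, of y] by simp
  ultimately show ?thesis
    using xV r(1) by (intro exI[of _ M] exI[of _ ?T]) auto
qed

end

section \<open>Orthogonal matrices and real coordinates\<close>

lemma bounded_linear_matrix: "bounded_linear (\<lambda>z. (M :: complex^'N^'N) *v z)"
  unfolding linear_conv_bounded_linear[symmetric]
proof (rule linearI)
  show "M *v (z + w) = M *v z + M *v w" for z w by (rule matrix_vector_right_distrib)
  show "M *v (r *\<^sub>R z) = r *\<^sub>R (M *v z)" for r z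
    by (simp add: vec_eq_iff matrix_vector_mult_def scaleR_sum_right)
qed

lemma cbil_orthogonal: "transpose M ** M = mat 1 \<Longrightarrow> cbil (M *v v) (M *v w) = cbil v w"
  by (simp add: cbil_matrix_vector matrix_vector_mul_assoc)

lemma reflection_matrix:
  fixes w :: "complex^'N"
  assumes w: "cbil w w \<noteq> 0"
  obtains R :: "complex^'N^'N" where "transpose R ** R = mat 1"
    "\<And>z. R *v z = z - (2 * cbil w z / cbil w w) *s w"
proof -
  define R :: "complex^'N^'N" where "R = (\<chi> i j. (if i =
      j then 1 else 0) - 2 / cbil w w * w $ i * w $ j)"
  have R: "R *v z = z - (2 * cbil w z / cbil w w) *s w" for z
  proof -
    have "(\<Sum>j\<in>UNIV. ((if i = j then 1 else 0) - 2 / cbil w w * w $ i * w $ j) * z $ j)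
        = (\<Sum>j\<in>UNIV. if i = j then z $ j else 0) - (\<Sum>j\<in>UNIV. (2 / cbil w w * w $ i) * (w $ j * z $
            j))" for i
      unfolding sum_subtractf[symmetric] by (rule sum.cong) (auto simp: algebra_simps)
    then have "(\<Sum>j\<in>UNIV. ((if i = j then 1 else 0) - 2 / cbil w w * w $ i * w $ j) * z $ j)
        = z $ i - (2 / cbil w w * w $ i) * cbil w z" for i
      unfolding cbil_def sum_distrib_left by simp
    then have "(R *v z) $ i = z $ i - (2 / cbil w w * w $ i) * cbil w z" for i
      by (simp add: R_def matrix_vector_mult_def)
    then show ?thesis by (simp add: vec_eq_iff)
  qed
  have "transpose R = R"
    by (simp add: R_def transpose_def vec_eq_iff mult_ac)
  moreover have "R *v (R *v z) = z" for z
    using w by (simp add: R cbil_simps vec_eq_iff field_simps)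
  then have "R ** R = mat 1"
    by (simp add: matrix_eq matrix_vector_mul_assoc[symmetric])
  ultimately show ?thesis by (intro that[OF _ R]) simp
qed

text \<open>With entries of \<open>J\<close> in \<open>{1, \<i>}\<close> this describes a real form of \<open>\<complex>\<^sup>N\<close>, the real vectors after
the substitution that defines \<open>iota\<close>.\<close>

definition real_coords :: "('N \<Rightarrow> complex) \<Rightarrow> complex^'N \<Rightarrow> bool" where
  "real_coords J z \<longleftrightarrow> (\<forall>i. z $ i / J i \<in> \<real>)"

lemma real_coords_simps:
  assumes J: "\<And>i. J i = 1 \<or> J i = \<i>"
  shows "real_coords J z \<Longrightarrow> real_coords J w \<Longrightarrow> real_coords J (z + w)"
    "real_coords J z \<Longrightarrow> real_coords J w \<Longrightarrow> real_coords J (z - w)"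
    "k \<in> \<real> \<Longrightarrow> real_coords J z \<Longrightarrow> real_coords J (k *s z)"
    "real_coords J z \<Longrightarrow> real_coords J w \<Longrightarrow> cbil z w \<in> \<real>"
proof -
  show "real_coords J z \<Longrightarrow> real_coords J w \<Longrightarrow> real_coords J (z + w)"
    "real_coords J z \<Longrightarrow> real_coords J w \<Longrightarrow> real_coords J (z - w)"
    by (simp_all add: real_coords_def add_divide_distrib diff_divide_distrib)
  show "k \<in> \<real> \<Longrightarrow> real_coords J z \<Longrightarrow> real_coords J (k *s z)"
    unfolding real_coords_def by (metis Reals_mult times_divide_eq_right vector_smult_component)
  assume zw: "real_coords J z" "real_coords J w"
  have "z $ i * w $ i \<in> \<real>" for i
  proof -
    have "z $ i * w $ i = (J i * J i) * ((z $ i / J i) * (w $ i / J i))"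
      using J[of i] by auto
    moreover have "J i * J i \<in> \<real>" using J[of i] by auto
    ultimately show ?thesis using zw unfolding real_coords_def by (metis Reals_mult)
  qed
  then show "cbil z w \<in> \<real>" unfolding cbil_def by (intro sum_in_Reals)
qed

text \<open>The reflection in \<open>a - b\<close> exchanges \<open>a\<close> and \<open>b\<close> unless \<open>a - b\<close> is isotropic. In that case
\<open>a + b\<close> is not isotropic, as the squares of \<open>a - b\<close> and \<open>a + b\<close> add up to \<open>-4\<close>, and the negative
of the reflection in \<open>a + b\<close> does it. Both have real coefficients on the real form.\<close>

lemma isometry_moving_point:
  assumes J: "\<And>i. J i = 1 \<or> J i = \<i>"
    and a: "cbil a a = -1" "real_coords J a" and b: "cbil b b = -1" "real_coords J b"
  shows "\<exists>R. transpose R ** R = mat 1 \<and> R *v a = b \<and> (\<forall>z. real_coords J z \<longrightarrow> real_coords J (R *v z))"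
proof (cases "cbil (a - b) (a - b) = 0")
  case False
  obtain R where R: "transpose R ** R = mat 1"
    "\<And>z. R *v z = z - (2 * cbil (a - b) z / cbil (a - b) (a - b)) *s (a - b)"
    using reflection_matrix[OF False] by blast
  have "2 * cbil (a - b) a = cbil (a - b) (a - b)"
    using a b by (simp add: cbil_simps cbil_commute[of b a])
  then have "R *v a = b" using False by (simp add: R)
  moreover have "real_coords J (R *v z)" if "real_coords J z" for z
    unfolding R(2) using that real_coords_simps[OF J] a b
    by (intro real_coords_simps(2)[OF J] real_coords_simps(3)[OF J] Reals_divide Reals_mult
        real_coords_simps(4)[OF J])
      auto
  ultimately show ?thesis using R(1) by blast
next
  case True
  have "cbil (a - b) (a - b) = - 2 * (1 + cbil a b)"
    using a b by (simp add: cbil_simps cbil_commute[of b a])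
  then have "1 + cbil a b = 0"
    using True unfolding mult_eq_0_iff by simp
  then have ab: "cbil a b = -1"
    by (simp add: eq_neg_iff_add_eq_0 add.commute)
  then have nz: "cbil (a + b) (a + b) = -4"
    using a b by (simp add: cbil_simps cbil_commute[of b a])
  obtain R where R: "transpose R ** R = mat 1"
    "\<And>z. R *v z = z - (2 * cbil (a + b) z / cbil (a + b) (a + b)) *s (a + b)"
    using reflection_matrix[of "a + b"] nz by auto
  have Rm: "(- R) *v z = (-1) *s (R *v z)" for z
    by (simp add: matrix_vector_mult_def vec_eq_iff sum_negf)
  have "cbil (a + b) a = -2"
    using ab a by (simp add: cbil_simps cbil_commute[of b a])
  then have "(- R) *v a = b"
    using nz by (simp add: Rm R vec_eq_iff)
  moreover have "real_coords J ((- R) *v z)" if "real_coords J z" for z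
    unfolding Rm R(2) using that a b
    by (intro real_coords_simps(1-3)[OF J] Reals_divide Reals_mult real_coords_simps(4)[OF J]) auto
  moreover have "transpose (- R) ** (- R) = mat 1"
    using R(1) by (simp add: transpose_def matrix_matrix_mult_def vec_eq_iff)
  ultimately show ?thesis by blast
qed

section \<open>Change of an immersion by an ambient isometry\<close>

context covered_manifold
begin

text \<open>Continuity is local and holds in each chart.\<close>

lemma smooth_map_on_continuous:
  fixes F :: "'u \<Rightarrow> 'b::real_normed_vector"
  assumes F: "smooth_map_on B U F"
  shows "continuous_on U F"
  unfolding continuous_on_def
proof
  fix x assume x: "x \<in> U"
  obtain C \<phi> where c: "(C, \<phi>) \<in> A" "\<pi> x \<in> C"
    using pi_in[OF x] by (force simp: points_def)
  obtain V where V: "x \<in> V" "openin (top_of_set U) V" "inj_on \<pi> V" "\<pi> ` V \<subseteq> C"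
    using chart_exists[OF x c] by blast
  define \<psi> where "\<psi> = \<phi> \<circ> \<pi>"
  have B: "(V, \<psi>) \<in> B" using c V unfolding pullback_chart \<psi>_def by blast
  have "smooth_on (\<psi> ` (V \<inter> U)) (F \<circ> inv_into V \<psi>)"
    using F B by (auto simp: smooth_map_on_def)
  moreover have "V \<inter> U = V" using openin_imp_subset[OF V(2)] by blast
  ultimately have "continuous_on (\<psi> ` V) (F \<circ> inv_into V \<psi>)"
    using smooth_on_continuous by metis
  then have "continuous_on V (F \<circ> inv_into V \<psi> \<circ> \<psi>)"
    by (rule continuous_on_compose[OF open_chartsD(3)[OF open_charts_cover B]])
  then have "continuous_on V F"
    by (rule continuous_on_eq) (use open_chartsD(2)[OF open_charts_cover B] in auto)
  then have cV: "(F \<longlongrightarrow> F x) (at x within V)"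
    using V(1) by (simp add: continuous_on_def)
  obtain G where G: "open G" "V = U \<inter> G" using V(2) by (auto simp: openin_open)
  have "at x within U = at x within V"
    by (rule at_within_nhd[of _ G]) (use G V(1) in auto)
  then show "(F \<longlongrightarrow> F x) (at x within U)" using cV by simp
qed

lemma smooth_near_U: "smooth_map_on B U F \<Longrightarrow> x \<in> U \<Longrightarrow> smooth_near B x F"
  unfolding smooth_near_def open_in_B using openin_subtopology_self by blast

text \<open>An orthogonal matrix is linear and preserves the bilinear form, so it maps normal fields
to normal fields and commutes with tangential projection; the representation becomes
conjugated.\<close>

lemma orthogonal_transform_data:
  fixes R :: "complex^'N^'N" and \<sigma> :: "'u \<Rightarrow> complex^'N"
  assumes data: "equivariant_immersion_with_data A U \<pi> g \<Psi> \<sigma>"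
    and R: "transpose R ** R = mat 1"
    and S: "\<And>x X. x \<in> U \<Longrightarrow> X \<in> ctangent B x \<Longrightarrow> lift_endo B \<pi> \<Psi> x X \<in> ctangent B x"
  shows "equivariant_immersion_with_data A U \<pi> g \<Psi> (\<lambda>x. R *v \<sigma> x)"
proof -
  note orth = cbil_orthogonal[OF R]
  have imm: "immersion_XX B \<sigma>" and met: "has_pullback_metric B \<sigma> (lift_form \<pi> g)"
    and sh: "has_shape_operator B \<sigma> (lift_endo B \<pi> \<Psi>)" and eq: "equivariant U \<pi> \<sigma>"
    using data by (simp_all add: equivariant_immersion_with_data_def Let_def)
  have R': "R ** transpose R = mat 1"
    using R by (simp add: matrix_left_right_inverse)
  have inj: "R *v v = R *v w \<longleftrightarrow> v = w" for v w
  proof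
    assume "R *v v = R *v w"
    then have "transpose R *v (R *v v) = transpose R *v (R *v w)" by simp
    then show "v = w" by (simp add: matrix_vector_mul_assoc R)
  qed simp
  have sm\<sigma>: "smooth_map_on B U \<sigma>" using imm by (simp add: immersion_XX_def)
  have oU: "open_in B U" by (simp add: open_in_B)
  have smR: "smooth_map_on B U (\<lambda>x. R *v F x)" if "smooth_map_on B U F" for F
    by (rule smooth_map_on_bounded_linear[OF open_charts_cover oU that bounded_linear_matrix])
  have cd: "cdiff (\<lambda>x. R *v F x) X = R *v cdiff F X"
    if "smooth_map_on B U F" "x \<in> U" "X \<in> ctangent B x" for F x X
    by (rule cdiff_matrix[OF open_charts_cover _ that(3) smooth_near_U[OF that(1,2)]]) (use that in
        simp)
  have "immersion_XX B (\<lambda>x. R *v \<sigma> x)"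
    unfolding immersion_XX_def points_B
  proof (intro conjI ballI)
    show "smooth_map_on B U (\<lambda>x. R *v \<sigma> x)" by (rule smR[OF sm\<sigma>])
    show "(\<lambda>x. R *v \<sigma> x) ` U \<subseteq> XX"
      using imm by (auto simp: immersion_XX_def XX_def orth)
    fix x assume x: "x \<in> U"
    then have "inj_on (cdiff \<sigma>) (rtangent B x)" using imm by (simp add: immersion_XX_def)
    then show "inj_on (cdiff (\<lambda>x. R *v \<sigma> x)) (rtangent B x)"
      using cd[OF sm\<sigma> x rtangent_subset] inj by (simp add: inj_on_def)
  qed
  moreover have "has_pullback_metric B (\<lambda>x. R *v \<sigma> x) (lift_form \<pi> g)"
    using met cd[OF sm\<sigma>] by (simp add: has_pullback_metric_def orth)
  moreover have "has_shape_operator B (\<lambda>x. R *v \<sigma> x) (lift_endo B \<pi> \<Psi>)"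
  proof -
    obtain \<nu> where un: "unit_normal B \<sigma> \<nu>"
      and s: "\<And>x X. x \<in> U \<Longrightarrow> X \<in> ctangent B x \<Longrightarrow> cdiff \<sigma> (lift_endo B \<pi> \<Psi> x X) = pullback_LC \<sigma> \<nu> x X"
      using sh by (auto simp: has_shape_operator_def)
    have sm\<nu>: "smooth_map_on B U \<nu>" using un by (simp add: unit_normal_def)
    have "unit_normal B (\<lambda>x. R *v \<sigma> x) (\<lambda>x. R *v \<nu> x)"
      using un smR[OF sm\<nu>] cd[OF sm\<sigma>] by (simp add: unit_normal_def tangent_XX_def orth)
    moreover have "cdiff (\<lambda>x. R *v \<sigma> x) (lift_endo B \<pi> \<Psi> x X) =
        pullback_LC (\<lambda>x. R *v \<sigma> x) (\<lambda>x. R *v \<nu> x) x X"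
      if "x \<in> U" "X \<in> ctangent B x" for x X
      using that cd[OF sm\<sigma> that(1) S[OF that]] cd[OF sm\<nu> that] s[OF that]
      by (simp add: pullback_LC_def proj_XX_def orth matrix_vector_right_distrib matrix_vector_vsm)
    ultimately show ?thesis by (auto simp: has_shape_operator_def)
  qed
  moreover have "equivariant U \<pi> (\<lambda>x. R *v \<sigma> x)"
  proof -
    obtain \<rho> where \<rho>: "\<rho> \<in> hom (deck_group U \<pi>) orthogonal_group"
      and e: "\<And>\<gamma> x. \<gamma> \<in> carrier (deck_group U \<pi>) \<Longrightarrow> x \<in> U \<Longrightarrow> \<sigma> (\<gamma> x) = \<rho> \<gamma> *v \<sigma> x"
      using eq by (auto simp: equivariant_def)
    let ?\<rho> = "\<lambda>\<gamma>. R ** \<rho> \<gamma> ** transpose R"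
    have cancel: "M ** transpose R ** R = M" for M :: "complex^'N^'N"
      by (simp add: matrix_mul_assoc[symmetric] R)
    have "transpose (?\<rho> \<gamma>) ** ?\<rho> \<gamma> = mat 1" if "\<gamma> \<in> carrier (deck_group U \<pi>)" for \<gamma>
    proof -
      have t: "transpose (\<rho> \<gamma>) ** \<rho> \<gamma> = mat 1"
        using \<rho> that by (auto simp: hom_def orthogonal_group_def)
      have "transpose (?\<rho> \<gamma>) ** ?\<rho> \<gamma> = R ** transpose (\<rho> \<gamma>) ** transpose R ** R ** \<rho> \<gamma> ** transpose
          R"
        by (simp add: matrix_transpose_mul matrix_mul_assoc)
      also have "\<dots> = R ** (transpose (\<rho> \<gamma>) ** \<rho> \<gamma>) ** transpose R"
        by (simp add: cancel) (simp add: matrix_mul_assoc)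
      finally show ?thesis by (simp add: t R')
    qed
    moreover have "?\<rho> (\<gamma> \<otimes>\<^bsub>deck_group U \<pi>\<^esub> \<delta>) = ?\<rho> \<gamma> ** ?\<rho> \<delta>"
      if "\<gamma> \<in> carrier (deck_group U \<pi>)" "\<delta> \<in> carrier (deck_group U \<pi>)" for \<gamma> \<delta>
    proof -
      have "\<rho> (\<gamma> \<otimes>\<^bsub>deck_group U \<pi>\<^esub> \<delta>) = \<rho> \<gamma> ** \<rho> \<delta>"
        using \<rho> that by (auto simp: hom_def orthogonal_group_def)
      moreover have "?\<rho> \<gamma> ** ?\<rho> \<delta> = R ** \<rho> \<gamma> ** transpose R ** R ** \<rho> \<delta> ** transpose R"
        by (simp add: matrix_mul_assoc)
      ultimately show ?thesis by (simp add: cancel) (simp add: matrix_mul_assoc)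
    qed
    ultimately have hom: "?\<rho> \<in> hom (deck_group U \<pi>) orthogonal_group"
      by (auto simp: hom_def orthogonal_group_def)
    have "R *v \<sigma> (\<gamma> x) = ?\<rho> \<gamma> *v (R *v \<sigma> x)"
      if "\<gamma> \<in> carrier (deck_group U \<pi>)" "x \<in> U" for \<gamma> x
      using e[OF that] by (simp add: matrix_vector_mul_assoc cancel)
    then show ?thesis
      unfolding equivariant_def by (intro bexI[OF _ hom] ballI)
  qed
  ultimately show ?thesis
    by (simp add: equivariant_immersion_with_data_def Let_def)
qed

end

section \<open>The image in a fixed real form\<close>

context real_immersion_data
begin

text \<open>Differentiating the two sides of \<open>C \<sigma> = cnj \<sigma>\<close> along the coordinate vectors, which commute
with conjugation, shows that \<open>C\<close> conjugates the whole orthonormal frame.\<close>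

lemma conj_at_frame:
  assumes x: "x \<in> U"
  shows "\<exists>P :: 'N \<Rightarrow> _. (\<forall>a b. cbil (P a) (P b) = (if a = b then
      if positive_coord n q a then 1 else -1 else 0)) \<and>
    (\<forall>C a. conj_at C x \<longrightarrow> C *v P a = cnjv (P a))"
proof -
  obtain C \<phi> V where c: "(C, \<phi>) \<in> A" and V: "openin (top_of_set U) V" "inj_on \<pi> V" "\<pi> ` V \<subseteq> C"
    and xV: "x \<in> V" using chart_at[OF x] .
  have B: "(V, \<phi> \<circ> \<pi>) \<in> B" using c V unfolding pullback_chart by blast
  let ?cv = "\<lambda>k. coord_vec B V (\<phi> \<circ> \<pi>) k x"
  obtain P :: "'N \<Rightarrow> _" where P: "\<forall>a b. cbil (P a) (P b) = (if a = b then
      if positive_coord n q a then 1 else -1 else 0)"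
    and PE: "\<And>a. P a = \<sigma> x \<or> P a = u x \<or>
         (\<exists>\<beta>. P a = (\<Sum>k\<in>UNIV. of_real (\<beta> k) *s cdiff \<sigma> (?cv k)))"
    using orthonormal_frame[OF c V xV] by blast
  have "C *v P a = cnjv (P a)" if C: "conj_at C x" for C a
  proof -
    obtain T where T: "openin (top_of_set U) T" "x \<in> T"
      and CT: "\<And>y. y \<in> T \<Longrightarrow> C *v \<sigma> y = cnjv (\<sigma> y)" "\<And>y. y \<in> T \<Longrightarrow> C *v u y = cnjv (u y)"
      using C unfolding conj_at_def by blast
    have cv: "?cv k \<in> ctangent B x" for k
      by (rule rtangent_subset[OF coord_vec_in_rtangent[OF open_charts_cover B xV]])
    have dC: "C *v cdiff \<sigma> (?cv k) = cnjv (cdiff \<sigma> (?cv k))" for k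
    proof -
      have "C *v cdiff \<sigma> (?cv k) = cdiff (\<lambda>y. C *v \<sigma> y) (?cv k)"
        using cdiff_matrix[OF open_charts_cover _ cv smooth_near_immersion[OF x]] x by simp
      also have "\<dots> = cdiff (\<lambda>y. cnjv (\<sigma> y)) (?cv k)"
      proof -
        have "?cv k (\<lambda>y. (C *v \<sigma> y) $ i) = ?cv k (\<lambda>y. cnjv (\<sigma> y) $ i)" for i
        proof (rule ctangent_local[OF cv])
          show "smooth_near B x (\<lambda>y. (C *v \<sigma> y) $ i)" "smooth_near B x (\<lambda>y. cnjv (\<sigma> y) $ i)"
            by (rule smooth_near_bounded_linear[OF open_charts_cover smooth_near_immersion[OF x]],
                rule bounded_linear_compose[OF bounded_linear_vec_nth],
                rule bounded_linear_matrix bounded_linear_cnjv)+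
          show "open_in B T" "x \<in> T" using T by (simp_all add: open_in_B)
          show "(C *v \<sigma> y) $ i = cnjv (\<sigma> y) $ i" if "y \<in> T" for y using CT(1)[OF that] by simp
        qed
        then show ?thesis by (simp add: cdiff_def)
      qed
      also have "\<dots> = cnjv (cdiff \<sigma> (?cv k))"
      proof -
        have "((\<lambda>y. cnjv (\<sigma> y)) \<circ> inv_into V (\<phi> \<circ> \<pi>) has_derivative
            (\<lambda>v. cnjv (frechet_derivative (\<sigma> \<circ> inv_into V (\<phi> \<circ> \<pi>)) (at ((\<phi> \<circ> \<pi>) x)) v))) (at ((\<phi> \<circ>
                \<pi>) x))"
          using bounded_linear.has_derivative[OF bounded_linear_cnjv
              smooth_near_chart(2)[OF open_charts_cover B xV smooth_near_immersion[OF x]]]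
          by (simp only: o_def)
        then have "frechet_derivative ((\<lambda>y. cnjv (\<sigma> y)) \<circ> inv_into V (\<phi> \<circ> \<pi>)) (at ((\<phi> \<circ> \<pi>) x)) =
            (\<lambda>v. cnjv (frechet_derivative (\<sigma> \<circ> inv_into V (\<phi> \<circ> \<pi>)) (at ((\<phi> \<circ> \<pi>) x)) v))"
          unfolding has_derivative_iff_frechet by blast
        then show ?thesis
          unfolding cdiff_coord_vec[OF open_charts_cover B xV smooth_near_immersion[OF x]]
            cdiff_coord_vec[OF open_charts_cover B xV smooth_near_bounded_linear[OF
                open_charts_cover smooth_near_immersion[OF x] bounded_linear_cnjv]]
          by simp
      qed
      finally show ?thesis .
    qed
    have sum: "C *v (\<Sum>k\<in>UNIV. of_real (\<beta> k) *s cdiff \<sigma> (?cv k)) =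
        cnjv (\<Sum>k\<in>UNIV. of_real (\<beta> k) *s cdiff \<sigma> (?cv k))" for \<beta>
    proof -
      have "C *v (\<Sum>k\<in>UNIV. of_real (\<beta> k) *s cdiff \<sigma> (?cv k)) =
          (\<Sum>k\<in>UNIV. of_real (\<beta> k) *s cnjv (cdiff \<sigma> (?cv k)))"
        by (simp add: vec.sum matrix_vector_vsm dC)
      also have "\<dots> = cnjv (\<Sum>k\<in>UNIV. of_real (\<beta> k) *s cdiff \<sigma> (?cv k))"
        by (simp add: cnjv_def vec_eq_iff)
      finally show ?thesis .
    qed
    show ?thesis
      using PE[of a] CT[OF T(2)] sum by auto
  qed
  then show ?thesis using P by blast
qed

text \<open>The orthonormal frame is a complex basis on which the matrix is prescribed.\<close>

lemma conj_at_unique: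
  assumes x: "x \<in> U" and C: "conj_at C x" "conj_at C' x"
  shows "C = C'"
proof -
  obtain P :: "'N \<Rightarrow> _" where P: "\<And>a b. cbil (P a) (P b) = (if a = b then
      if positive_coord n q a then 1 else -1 else 0)"
    and PC: "\<And>C a. conj_at C x \<Longrightarrow> C *v P a = cnjv (P a)"
    using conj_at_frame[OF x] by blast
  have nd: "v = 0" if "\<And>a. cbil (P a) v = 0" for v
    by (rule orthonormal_nondegenerate[of P "\<lambda>a.
        if positive_coord n q a then 1 else -1"]) (use P that in auto)
  have "C *v v = C' *v v" for v
  proof -
    obtain c where "v = (\<Sum>a\<in>UNIV. c a *s P a)" using frame_spans[OF nd] .
    then show ?thesis by (simp add: vec.sum matrix_vector_vsm PC[OF C(1)] PC[OF C(2)])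
  qed
  then show ?thesis by (simp add: matrix_eq)
qed

lemma conj_at_open: "openin (top_of_set U) {x \<in> U. conj_at C x}"
proof (subst openin_subopen, safe)
  fix x assume "x \<in> U" "conj_at C x"
  then obtain T where T: "openin (top_of_set U) T" "x \<in> T"
      and CT: "\<forall>y\<in>T. C *v \<sigma> y = cnjv (\<sigma> y) \<and> C *v u y = cnjv (u y)"
    unfolding conj_at_def by blast
  have "T \<subseteq> {x \<in> U. conj_at C x}"
    using openin_imp_subset[OF T(1)] T CT unfolding conj_at_def by blast
  then show "\<exists>T. openin (top_of_set U) T \<and> x \<in> T \<and> T \<subseteq> {x \<in> U. conj_at C x}"
    using T by blast
qed

text \<open>The points at which a given matrix works form an open set, and so does the complement, as
the union of the sets of the other matrices.\<close>

lemma conj_at_global: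
  assumes "x0 \<in> U"
  shows "\<exists>C. \<forall>x\<in>U. conj_at C x"
proof -
  obtain C where C: "conj_at C x0"
    using conj_at_exists[OF assms] unfolding conj_at_def by blast
  let ?S = "{x \<in> U. conj_at C x}"
  have "U - ?S = (\<Union>C'\<in>{C'. C' \<noteq> C}. {x \<in> U. conj_at C' x})"
  proof (intro equalityI subsetI)
    fix x assume x: "x \<in> U - ?S"
    then obtain C' where "conj_at C' x"
      using conj_at_exists[of x] unfolding conj_at_def by blast
    moreover from this have "C' \<noteq> C" using x by auto
    ultimately show "x \<in> (\<Union>C'\<in>{C'. C' \<noteq> C}. {x \<in> U. conj_at C' x})"
      using x by (intro UN_I[of C']) auto
  next
    fix x assume "x \<in> (\<Union>C'\<in>{C'. C' \<noteq> C}. {x \<in> U. conj_at C' x})"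
    then obtain C' where C': "C' \<noteq> C" "x \<in> U" "conj_at C' x" by blast
    then have "\<not> conj_at C x" using conj_at_unique[OF C'(2)] by auto
    then show "x \<in> U - ?S" using C'(2) by simp
  qed
  then have "openin (top_of_set U) (U - ?S)"
    using openin_Union conj_at_open by (metis (no_types, lifting) imageE)
  then have "closedin (top_of_set U) ?S" by (auto simp: closedin_def)
  then have "?S = {} \<or> ?S = U"
    using conn conj_at_open unfolding connected_clopen by blast
  then show ?thesis using C assms by blast
qed

abbreviation "J \<equiv> \<lambda>a. if positive_coord n q a then 1 else \<i>"

text \<open>With \<open>P\<close> an orthonormal basis of the real form whose squares \<open>\<plusminus>1\<close> are the squares of the
entries of \<open>J\<close>, the matrix with rows \<open>P\<^sub>a / J\<^sub>a\<close> is orthogonal. It sends \<open>\<sigma>(x)\<close> to the vector with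
coordinates \<open>\<langle>P\<^sub>a, \<sigma>(x)\<rangle> / J\<^sub>a\<close>, and the products are real because \<open>C\<close> preserves the form and
conjugates both factors.\<close>

lemma real_form:
  assumes x0: "x0 \<in> U"
  shows "\<exists>R :: (_, 'N) vec. transpose R ** R = mat 1 \<and> (\<forall>x\<in>U. real_coords J (R *v \<sigma> x))"
proof -
  obtain C where C: "\<And>x. x \<in> U \<Longrightarrow> conj_at C x" using conj_at_global[OF x0] by blast
  obtain P :: "'N \<Rightarrow> _" where P: "\<And>a b. cbil (P a) (P b) = (if a = b then
      if positive_coord n q a then 1 else -1 else 0)"
    and PC: "\<And>a. C *v P a = cnjv (P a)"
    using conj_at_frame[OF x0] C[OF x0] by blast
  have nd: "v = 0" if "\<And>a. cbil (P a) v = 0" for v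
    by (rule orthonormal_nondegenerate[of P "\<lambda>a.
        if positive_coord n q a then 1 else -1"]) (use P that in auto)
  have gram: "cbil (P a) (P b) \<in> \<real>" for a b by (simp add: P)
  have orth: "cbil (C *v v) (C *v w) = cbil v w" for v w
    by (rule conjugation_matrix(1)[OF nd gram PC])
  have real: "cbil (P a) (\<sigma> x) \<in> \<real>" if "x \<in> U" for x a
  proof -
    have "C *v \<sigma> x = cnjv (\<sigma> x)" using C[OF that] unfolding conj_at_def by blast
    then have "cnj (cbil (P a) (\<sigma> x)) = cbil (P a) (\<sigma> x)"
      using orth[of "P a" "\<sigma> x"] by (simp add: PC cbil_cnjv)
    then show ?thesis by (simp add: Reals_cnj_iff)
  qed
  define R where "R = (\<chi> a. (1 / J a) *s P a)"
  have Rv: "(R *v v) $ a = cbil (P a) v / J a" for v a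
    by (simp add: R_def matrix_vector_mult_def cbil_def sum_divide_distrib)
  have "(R ** transpose R) $ a $ b = cbil (P a) (P b) / (J a * J b)" for a b
    by (simp add: R_def matrix_matrix_mult_def transpose_def cbil_def sum_divide_distrib)
  then have "R ** transpose R = mat 1"
    by (simp add: vec_eq_iff P mat_def)
  then have "transpose R ** R = mat 1"
    by (simp add: matrix_left_right_inverse)
  moreover have "real_coords J (R *v \<sigma> x)" if "x \<in> U" for x
    unfolding real_coords_def
  proof
    fix a
    have "(R *v \<sigma> x) $ a / J a = (if positive_coord n q a then 1 else -1) * cbil (P a) (\<sigma> x)"
      by (simp add: Rv)
    then show "(R *v \<sigma> x) $ a / J a \<in> \<real>"
      using real[OF that, of a] by simp
  qed
  ultimately show ?thesis by (intro exI[of _ R] conjI ballI)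
qed

lemma lift_endo_ctangent:
  assumes "x \<in> U" "X \<in> ctangent B x"
  shows "lift_endo B \<pi> \<Psi> x X \<in> ctangent B x"
proof -
  obtain e where "\<forall>X \<in> rtangent A (\<pi> x). \<exists>c :: nat \<Rightarrow> real. X =
      (\<lambda>f. \<Sum>i<n - 1. of_real (c i) * e i f)"
    using span_real[OF assms(1)] by blast
  from lift_endo(1)[OF assms(1) d this \<Psi> assms(2)] show ?thesis .
qed

text \<open>The immersion in the real form, moved so that one image point lies in \<open>K\<close>, corresponds to
a continuous map into the quadric; the image of the connected cover stays in the component \<open>K\<close>,
which \<open>H\<close> covers.\<close>

lemma immersion_into_HH:
  fixes H :: "'h::topological_space set" and c :: "'h \<Rightarrow> real^('N::{finite,linorder})"
  assumes data: "equivariant_immersion_with_data A U \<pi> g \<Psi> \<sigma>" and H: "HH_model n q H c"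
  shows "\<exists>\<tau>. equivariant_immersion_with_data A U \<pi> g \<Psi> \<tau> \<and> \<tau> ` U \<subseteq> iota n q c ` H"
proof (cases "U = {}")
  case True
  then show ?thesis using data by blast
next
  case False
  then obtain x0 where x0: "x0 \<in> U" by blast
  obtain K where K: "K \<in> components (Q_quadric n q)" and cov: "universal_cover H c K"
    using H unfolding HH_model_def by blast
  have cH: "c ` H = K"
    using cov covering_space_imp_surjective unfolding universal_cover_def by blast
  obtain y0 where y0: "y0 \<in> K" using in_components_nonempty[OF K] by blast
  have KQ: "K \<subseteq> Q_quadric n q" by (rule in_components_subset[OF K])
  define \<iota> where "\<iota> = (\<lambda>y::real^('N::{finite,linorder}). \<chi> i. J i * of_real (y $ i))"
  have J: "J i = 1 \<or> J i = \<i>" for i by simp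
  have \<iota>real: "real_coords J (\<iota> y)" for y by (simp add: real_coords_def \<iota>_def)
  have of_real_minus_one: "complex_of_real r = -1 \<longleftrightarrow> r = -1" for r
    using of_real_eq_iff[of r "-1", where ?'a = complex] by simp
  have \<iota>cbil: "cbil (\<iota> y) (\<iota> y) = -1 \<longleftrightarrow> y \<in> Q_quadric n q" for y
  proof -
    have "cbil (\<iota> y) (\<iota> y) = (\<Sum>i\<in>UNIV. of_real (if positive_coord n q i then (y $ i)\<^sup>2 else - (y $
        i)\<^sup>2))"
      unfolding cbil_def by (rule sum.cong) (auto simp: \<iota>_def power2_eq_square algebra_simps)
    also have "\<dots> = of_real (\<Sum>i\<in>UNIV. if positive_coord n q i then (y $ i)\<^sup>2 else - (y $ i)\<^sup>2)"
      by simp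
    also have "\<dots> = -1 \<longleftrightarrow> (\<Sum>i\<in>UNIV. if positive_coord n q i then (y $ i)\<^sup>2 else - (y $ i)\<^sup>2) = -1"
      by (rule of_real_minus_one)
    finally show ?thesis unfolding Q_quadric_def mem_Collect_eq .
  qed
  obtain R :: "(_, 'N::{finite,linorder}) vec" where R: "transpose R ** R = mat 1" and RJ:
      "\<And>x. x \<in> U \<Longrightarrow> real_coords J (R *v \<sigma> x)"
    using real_form[OF x0] by blast
  have "cbil (R *v \<sigma> x0) (R *v \<sigma> x0) = -1"
    using frame_relations(1)[OF x0] by (simp add: cbil_orthogonal[OF R])
  moreover have "cbil (\<iota> y0) (\<iota> y0) = -1" using \<iota>cbil y0 KQ by blast
  ultimately obtain R' where R': "transpose R' ** R' = mat 1" "R' *v (R *v \<sigma> x0) = \<iota> y0"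
    "\<And>z. real_coords J z \<Longrightarrow> real_coords J (R' *v z)"
    using isometry_moving_point[of J, OF J _ RJ[OF x0] _ \<iota>real] by blast
  define \<tau> where "\<tau> = (\<lambda>x. R' *v (R *v \<sigma> x))"
  have \<tau>: "equivariant_immersion_with_data A U \<pi> g \<Psi> \<tau>"
    unfolding \<tau>_def
    by (intro orthogonal_transform_data R R' data lift_endo_ctangent)
  then have \<tau>s: "smooth_map_on B U \<tau>" and \<tau>X: "\<And>x. x \<in> U \<Longrightarrow> cbil (\<tau> x) (\<tau> x) = -1"
    by (auto simp: equivariant_immersion_with_data_def Let_def immersion_XX_def XX_def
        image_subset_iff)
  have \<tau>real: "real_coords J (\<tau> x)" if "x \<in> U" for x
    unfolding \<tau>_def by (intro R'(3) RJ that)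
  define f where "f = (\<lambda>x. \<chi> i. Re (\<tau> x $ i / J i))"
  have \<iota>f: "\<iota> (f x) = \<tau> x" if "x \<in> U" for x
  proof -
    have "J i * of_real (Re (\<tau> x $ i / J i)) = \<tau> x $ i" for i
    proof -
      have "of_real (Re (\<tau> x $ i / J i)) = \<tau> x $ i / J i"
        using \<tau>real[OF that] unfolding real_coords_def by (metis of_real_Re)
      then show ?thesis by auto
    qed
    then show ?thesis by (simp add: \<iota>_def f_def vec_eq_iff)
  qed
  have \<iota>inj: "\<iota> y = \<iota> y' \<Longrightarrow> y = y'" for y y'
    by (auto simp: \<iota>_def vec_eq_iff split: if_splits)
  have "continuous_on U (\<lambda>x. \<tau> x)" by (rule smooth_map_on_continuous[OF \<tau>s])
  then have "continuous_on U f"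
    unfolding f_def by (intro continuous_intros) auto
  then have "connected (f ` U)" by (rule connected_continuous_image[OF _ conn])
  moreover have "f ` U \<subseteq> Q_quadric n q"
  proof
    fix y assume "y \<in> f ` U"
    then obtain x where "x \<in> U" "y = f x" by blast
    then show "y \<in> Q_quadric n q" using \<iota>cbil[of y] \<iota>f \<tau>X by simp
  qed
  moreover have "f x0 = y0"
    by (rule \<iota>inj) (simp add: \<iota>f x0, simp add: \<tau>_def R'(2))
  then have "K \<inter> f ` U \<noteq> {}" using y0 x0 by blast
  ultimately have fK: "f ` U \<subseteq> K"
    using components_maximal[OF K] by blast
  have "\<tau> ` U \<subseteq> iota n q c ` H"
  proof
    fix z assume "z \<in> \<tau> ` U"
    then obtain x where x: "x \<in> U" "z = \<tau> x" by blast
    have "f x \<in> c ` H" unfolding cH using fK imageI[OF x(1)] by (rule subsetD)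
    then obtain h where h: "h \<in> H" "f x = c h" by (rule imageE)
    have "iota n q c h = \<iota> (f x)"
      by (simp add: iota_def \<iota>_def h vec_eq_iff)
    then show "z \<in> iota n q c ` H" using x h \<iota>f by (metis imageI)
  qed
  with \<tau> show ?thesis by blast
qed

end

theorem theorem4p11:
  fixes A :: "('m::{t2_space, second_countable_topology}, 'd::finite) atlas"
    and U :: "'u::topological_space set" and \<pi> :: "'u \<Rightarrow> 'm"
    and g :: "'m cform" and \<Psi> :: "'m cendo"
    and \<sigma>\<^sub>0 :: "'u \<Rightarrow> complex^('N::{finite,linorder})"
    and n p :: nat
  assumes "n \<ge> 2" and "CARD('d) = n - 1" and "CARD('N) = n + 1"
    and "smooth_atlas A" and "connected (points A)"
    and "universal_cover U \<pi> (points A)"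
    and "complex_metric A g" and "endo_section A \<Psi>"
    and "equivariant_immersion_with_data A U \<pi> g \<Psi> \<sigma>\<^sub>0"
    and "p \<le> n - 1"
    and "pseudo_riemannian_on_real A g (n - 1 - p) p"
  shows "(real_endo A \<Psi> \<longrightarrow>
            (\<forall>(H :: 'h::topological_space set) (c :: 'h \<Rightarrow> real^('N::{finite,linorder})).
               HH_model n p H c \<longrightarrow>
               (\<exists>\<sigma> :: 'u \<Rightarrow> complex^('N::{finite,linorder}).
                  equivariant_immersion_with_data A U \<pi> g \<Psi> \<sigma> \<and>
                  \<sigma> ` U \<subseteq> iota n p c ` H))) \<and>
         (real_endo A (\<lambda>x X. cvec_scale \<i> (\<Psi> x X)) \<longrightarrow>
            (\<forall>(H :: 'h set) (c :: 'h \<Rightarrow> real^('N::{finite,linorder})).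
               HH_model n (p + 1) H c \<longrightarrow>
               (\<exists>\<sigma> :: 'u \<Rightarrow> complex^('N::{finite,linorder}).
                  equivariant_immersion_with_data A U \<pi> g \<Psi> \<sigma> \<and>
                  \<sigma> ` U \<subseteq> iota n (p + 1) c ` H)))"
proof -
  interpret covered_manifold A U \<pi>
    by unfold_locales (use assms in \<open>auto simp: universal_cover_def\<close>)
  note data = assms(9)
  have imm: "immersion_XX B \<sigma>\<^sub>0" and met: "has_pullback_metric B \<sigma>\<^sub>0 (lift_form \<pi> g)"
    and sh: "has_shape_operator B \<sigma>\<^sub>0 (lift_endo B \<pi> \<Psi>)"
    using data by (simp_all add: equivariant_immersion_with_data_def Let_def)
  obtain \<nu> where \<nu>: "unit_normal B \<sigma>\<^sub>0 \<nu>"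
    and shape: "\<And>x X. x \<in> U \<Longrightarrow> X \<in> ctangent B x \<Longrightarrow> cdiff \<sigma>\<^sub>0 (lift_endo B \<pi> \<Psi> x X) = pullback_LC \<sigma>\<^sub>0 \<nu> x X"
    using sh by (auto simp: has_shape_operator_def)
  have sm: "smooth_map_on B U \<sigma>\<^sub>0" "\<sigma>\<^sub>0 ` U \<subseteq> XX"
    using imm by (simp_all add: immersion_XX_def)
  have conn: "connected U"
    using assms(6) simply_connected_connected by (auto simp: universal_cover_def)
  have main: "\<exists>\<sigma>. equivariant_immersion_with_data A U \<pi> g \<Psi> \<sigma> \<and> \<sigma> ` U \<subseteq> iota n q c ` H"
    if "\<kappa> = 1 \<and> q = p \<or> \<kappa> = \<i> \<and> q = p + 1" "real_endo A (\<lambda>x X. cvec_scale \<kappa> (\<Psi> x X))" "HH_model n q H c"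
    for \<kappa> q and H :: "'h set" and c :: "'h \<Rightarrow> real^('N::{finite,linorder})"
  proof -
    interpret real_immersion_data A U \<pi> g \<Psi> \<sigma>\<^sub>0 \<nu> \<kappa> n p q
      by unfold_locales (fact conn assms sm met \<nu> shape that)+
    show ?thesis by (rule immersion_into_HH[OF data that(3)])
  qed
  have "(\<lambda>x X. cvec_scale 1 (\<Psi> x X)) = \<Psi>" by (simp add: cvec_scale_def)
  then show ?thesis using main[of 1 p] main[of \<i> "p + 1"] by auto
qed

end
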